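(* Let $A_1$ and $A_2$ be unital $C^*$-algebras, let $\phi\colon E(A_1)\to E(A_2)$ be a surjection and let $p>0$. Then $\phi$ satisfies $$\|\phi(x)\diamond_p\phi(y)\|=\|x\diamond_p y\|\quad\text{for all } x,y\in E(A_1)$$ if and only if there exists a Jordan $*$-isomorphism $J\colon A_1\to A_2$ such that $\phi=J$ on $E(A_1)$.
   Context: For a unital $C^*$-algebra $A$ with unit $e$, $E(A)=\{a\in A\colon 0\le a\le e\}$ is the effect algebra of $A$ (the set of positive elements $a$ with $a\le e$). For $p>0$ and $x,y\in E(A)$, $x\diamond_p y=(x^{p/2}y^px^{p/2})^{1/p}$, with powers of positive elements taken via continuous functional calculus. A Jordan $*$-isomorphism $J\colon A_1\to A_2$ is a complex linear bijection that preserves the Jordan product $(ab+ba)/2$ and the involution. *)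

theory Defs
  imports "HOL-Analysis.Analysis"
begin

section \<open>Unital $C^*$-algebras\<close>

text \<open>
  The real scaling, norm and completeness come from the library classes; the complex scaling
  is tied to them by \<open>scaleR_scaleC\<close> and \<open>norm_scaleC\<close>. As usual for unital normed algebras,
  the unit has norm one, so the zero algebra is excluded.
\<close>

class unital_cstar_algebra = real_normed_algebra_1 + banach +
  fixes scaleC :: "complex \<Rightarrow> 'a \<Rightarrow> 'a"  (infixr \<open>*\<^sub>C\<close> 75)
    and adj :: "'a \<Rightarrow> 'a"
  assumes scaleC_add_right: "c *\<^sub>C (x + y) = c *\<^sub>C x + c *\<^sub>C y"
    and scaleC_add_left: "(c + d) *\<^sub>C x = c *\<^sub>C x + d *\<^sub>C x"
    and scaleC_scaleC: "c *\<^sub>C (d *\<^sub>C x) = (c * d) *\<^sub>C x"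
    and scaleR_scaleC: "r *\<^sub>R x = complex_of_real r *\<^sub>C x"
    and mult_scaleC_left: "(c *\<^sub>C x) * y = c *\<^sub>C (x * y)"
    and mult_scaleC_right: "x * (c *\<^sub>C y) = c *\<^sub>C (x * y)"
    and norm_scaleC: "norm (c *\<^sub>C x) = cmod c * norm x"
    and adj_add: "adj (x + y) = adj x + adj y"
    and adj_scaleC: "adj (c *\<^sub>C x) = cnj c *\<^sub>C adj x"
    and adj_mult: "adj (x * y) = adj y * adj x"
    and adj_adj: "adj (adj x) = x"
    and cstar_identity: "norm (adj x * x) = (norm x)\<^sup>2"


section \<open>Spectrum, order and the effect algebra\<close>

definition spectrum :: "'a::unital_cstar_algebra \<Rightarrow> complex set" where
  "spectrum a = {c. \<not> (\<exists>b. b * (c *\<^sub>C 1 - a) = 1 \<and> (c *\<^sub>C 1 - a) * b = 1)}"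

definition self_adjoint :: "'a::unital_cstar_algebra \<Rightarrow> bool" where
  "self_adjoint a \<longleftrightarrow> adj a = a"

definition positive :: "'a::unital_cstar_algebra \<Rightarrow> bool" where
  "positive a \<longleftrightarrow> self_adjoint a \<and> (\<forall>c\<in>spectrum a. c \<in> \<real> \<and> 0 \<le> Re c)"

definition cstar_le :: "'a::unital_cstar_algebra \<Rightarrow> 'a \<Rightarrow> bool" where
  "cstar_le a b \<longleftrightarrow> positive (b - a)"

definition effects :: "'a::unital_cstar_algebra set" where
  "effects = {a. cstar_le 0 a \<and> cstar_le a 1}"


section \<open>Continuous functional calculus\<close>

text \<open>
  \<open>is_functional_calculus a \<Phi>\<close>: \<open>\<Phi>\<close> is an isometric unital $*$-homomorphism from the algebra of
  continuous functions on the spectrum of \<open>a\<close> that sends the identity function to \<open>a\<close>. Continuous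
  functions on the spectrum are represented by total functions that are continuous on it; the
  clause \<open>\<Phi> f = \<Phi> g\<close> says that only the values on the spectrum matter. For normal \<open>a\<close>
  such a \<open>\<Phi>\<close> exists and is unique on the functions that are continuous on the spectrum.
\<close>

definition is_functional_calculus ::
    "'a::unital_cstar_algebra \<Rightarrow> ((complex \<Rightarrow> complex) \<Rightarrow> 'a) \<Rightarrow> bool" where
  "is_functional_calculus a \<Phi> \<longleftrightarrow>
     \<Phi> (\<lambda>z. 1) = 1 \<and> \<Phi> (\<lambda>z. z) = a \<and>
     (\<forall>f. continuous_on (spectrum a) f \<longrightarrow>
        \<Phi> (\<lambda>z. cnj (f z)) = adj (\<Phi> f) \<and>
        (\<forall>c. \<Phi> (\<lambda>z. c * f z) = c *\<^sub>C \<Phi> f) \<and>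
        norm (\<Phi> f) = (SUP z\<in>spectrum a. cmod (f z))) \<and>
     (\<forall>f g. continuous_on (spectrum a) f \<and> continuous_on (spectrum a) g \<longrightarrow>
        \<Phi> (\<lambda>z. f z + g z) = \<Phi> f + \<Phi> g \<and>
        \<Phi> (\<lambda>z. f z * g z) = \<Phi> f * \<Phi> g \<and>
        ((\<forall>z\<in>spectrum a. f z = g z) \<longrightarrow> \<Phi> f = \<Phi> g))"

definition cfc :: "(complex \<Rightarrow> complex) \<Rightarrow> 'a::unital_cstar_algebra \<Rightarrow> 'a" where
  "cfc f a = (THE b. \<exists>\<Phi>. is_functional_calculus a \<Phi> \<and> \<Phi> f = b)"

text \<open>Meant for positive \<open>a\<close> and \<open>r > 0\<close>; note that \<open>0 powr r = 0\<close>.\<close>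

definition cpow :: "'a::unital_cstar_algebra \<Rightarrow> real \<Rightarrow> 'a" where
  "cpow a r = cfc (\<lambda>z. complex_of_real (Re z powr r)) a"

definition diamond :: "real \<Rightarrow> 'a::unital_cstar_algebra \<Rightarrow> 'a \<Rightarrow> 'a" where
  "diamond p x y = cpow (cpow x (p / 2) * cpow y p * cpow x (p / 2)) (1 / p)"


section \<open>Jordan $*$-isomorphisms\<close>

definition jordan_prod :: "'a::unital_cstar_algebra \<Rightarrow> 'a \<Rightarrow> 'a" where
  "jordan_prod a b = (1 / 2) *\<^sub>R (a * b + b * a)"

definition jordan_star_isomorphism ::
    "('a::unital_cstar_algebra \<Rightarrow> 'b::unital_cstar_algebra) \<Rightarrow> bool" where
  "jordan_star_isomorphism J \<longleftrightarrow>
     bij J \<and>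
     (\<forall>x y. J (x + y) = J x + J y) \<and>
     (\<forall>c x. J (c *\<^sub>C x) = c *\<^sub>C J x) \<and>
     (\<forall>x y. J (jordan_prod x y) = jordan_prod (J x) (J y)) \<and>
     (\<forall>x. J (adj x) = adj (J x))"

end

theory Submission
  imports Defs "HOL-Computational_Algebra.Fundamental_Theorem_Algebra"
begin

text \<open>
  Since \<open>\<parallel>x \<diamond>\<^sub>p y\<parallel>\<^sup>p = \<parallel>x\<^bsup>p/2\<^esup> y\<^sup>p x\<^bsup>p/2\<^esup>\<parallel>\<close>, the map \<open>T x = \<phi>(x\<^bsup>1/p\<^esup>)\<^sup>p\<close> preserves
  \<open>\<parallel>z\<^bsup>1/2\<^esup> x z\<^bsup>1/2\<^esup>\<parallel>\<close>. These norms determine the order (take \<open>z\<close> to be a multiple of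
  \<open>(y + \<epsilon>)\<^sup>-\<^sup>1\<close>) and scale with \<open>x\<close>, so \<open>T\<close> extends to a homogeneous order isomorphism of the positive
  cones that fixes \<open>1\<close>. On the invertible positive elements it is therefore an isometry of Thompson's
  metric, and the Mazur--Ulam argument with the reflections \<open>x \<mapsto> m x\<^sup>-\<^sup>1 m\<close> gives
  \<open>T(m x m) = T m T x T m\<close>. Comparing \<open>(1 + T z)\<^sup>n\<close> with \<open>T(1 + z)\<^sup>n\<close> termwise yields
  \<open>1 + T z \<le> T(1 + z)\<close>, and the same for the inverse of \<open>T\<close> yields equality. Conjugating by
  \<open>x\<^bsup>1/2\<^esup>\<close> shows that \<open>T\<close> is additive; being also multiplicative on squares, it extends to a Jordan
  \<open>*\<close>-isomorphism, which commutes with powers and hence agrees with \<open>\<phi>\<close>.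
\<close>


section \<open>Scaling, involution and inverses\<close>

text \<open>Order and scaling alone say nothing about sums or products. Products m x m come from
  geometry: x -> m x^-1 m reverses order and inverts scalars, so it is an isometry of Thompson's
  metric, and m is its only fixed point among the invertible positive elements. The metric is finite
  only between invertible elements, so the argument runs on the open cone; effects without inverse
  are recovered at the end by adding small multiples of 1. T fixes 1 because 1 is the greatest
  effect. The exponent p is absorbed by the bijection x -> x^p of the effects. The C*-algebra facts
  are derived from the axioms. Their root is that a self-adjoint element has a spectral value whose
  modulus is its norm; averaging resolvents over roots of -1 replaces the analytic spectral radius
  formula. It makes the polynomial calculus isometric, from which continuous calculus, positivity of
  a* a, square roots and their monotonicity are built.\<close>

interpretation scaleC: vector_space "scaleC :: complex \<Rightarrow> 'a::unital_cstar_algebra \<Rightarrow> 'a"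
  by unfold_locales
    (simp_all add: scaleC_add_right scaleC_add_left scaleC_scaleC flip: scaleR_scaleC,
     metis of_real_1 scaleR_one scaleR_scaleC)

lemmas [simp] = mult_scaleC_left mult_scaleC_right scaleC_scaleC adj_adj

lemma adj_scaleR [simp]: "adj (r *\<^sub>R x) = r *\<^sub>R adj (x :: 'a::unital_cstar_algebra)"
  by (simp add: scaleR_scaleC adj_scaleC)

lemma adj_0 [simp]: "adj 0 = (0 :: 'a::unital_cstar_algebra)"
  by (metis adj_scaleR scaleR_zero_left)

lemma adj_minus [simp]: "adj (- x) = - adj (x :: 'a::unital_cstar_algebra)"
  by (metis adj_scaleR scaleR_minus1_left)

lemma adj_diff: "adj (x - y) = adj x - adj (y :: 'a::unital_cstar_algebra)"
  using adj_add[of x "- y"] by simp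

lemma adj_1 [simp]: "adj 1 = (1 :: 'a::unital_cstar_algebra)"
  by (metis adj_adj adj_mult mult_1_right)

lemma adj_power: "adj (x ^ n) = adj (x :: 'a::unital_cstar_algebra) ^ n"
  by (induction n) (simp_all add: adj_mult power_commutes)

text \<open>The C*-identity with submultiplicativity bounds \<open>norm x\<close> by
  \<open>norm (adj x)\<close>; the involution gives the reverse bound.\<close>

lemma norm_adj [simp]: "norm (adj x) = norm (x :: 'a::unital_cstar_algebra)"
proof -
  have *: "norm x \<le> norm (adj x)" for x :: 'a
  proof (cases "x = 0")
    case False
    have "norm x * norm x \<le> norm (adj x) * norm x"
      using cstar_identity[of x] norm_mult_ineq[of "adj x" x] by (simp add: power2_eq_square)
    with False show ?thesis by simp
  qed simp
  from *[of x] *[of "adj x"] show ?thesis by simp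
qed

lemma self_adjoint_add [intro]: "self_adjoint x \<Longrightarrow> self_adjoint y \<Longrightarrow> self_adjoint (x + y)"
  by (simp add: self_adjoint_def adj_add)

lemma self_adjoint_diff [intro]: "self_adjoint x \<Longrightarrow> self_adjoint y \<Longrightarrow> self_adjoint (x - y)"
  by (simp add: self_adjoint_def adj_diff)

lemma self_adjoint_minus [intro]: "self_adjoint x \<Longrightarrow> self_adjoint (- x)"
  by (simp add: self_adjoint_def)

lemma self_adjoint_scaleR [intro]: "self_adjoint x \<Longrightarrow> self_adjoint (r *\<^sub>R x)"
  by (simp add: self_adjoint_def)

lemma self_adjoint_1 [simp]: "self_adjoint 1" and self_adjoint_0 [simp]: "self_adjoint 0"
  by (simp_all add: self_adjoint_def)

lemma self_adjoint_power [intro]: "self_adjoint x \<Longrightarrow> self_adjoint (x ^ n)"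
  by (simp add: self_adjoint_def adj_power)

lemma norm_self_adjoint_square: "self_adjoint x \<Longrightarrow> norm (x * x) = (norm x)\<^sup>2"
  using cstar_identity[of x] by (simp add: self_adjoint_def)

section \<open>Two-sided inverses and the spectrum\<close>

definition has_inverse :: "'a::ring_1 \<Rightarrow> bool" where
  "has_inverse a \<longleftrightarrow> (\<exists>b. a * b = 1 \<and> b * a = 1)"

text \<open>Outside the invertible elements the value is an unspecified choice, so the laws about it
  carry invertibility hypotheses.\<close>

definition cinv :: "'a::ring_1 \<Rightarrow> 'a" where
  "cinv a = (SOME b. a * b = 1 \<and> b * a = 1)"

lemma cinv:
  assumes "has_inverse a"
  shows "a * cinv a = 1" "cinv a * a = 1"
  using someI_ex[of "\<lambda>b. a * b = 1 \<and> b * a = 1"] assms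
  unfolding has_inverse_def cinv_def by blast+

lemma cinv_cancel [simp]:
  assumes "has_inverse a"
  shows "a * (cinv a * b) = b" "cinv a * (a * b) = b"
  using assms by (simp_all add: cinv flip: mult.assoc)

lemma has_inverseI: "a * b = 1 \<Longrightarrow> b * a = 1 \<Longrightarrow> has_inverse a"
  unfolding has_inverse_def by blast

lemma left_right_inverse:
  assumes "b * a = 1" "a * c = (1 :: 'a::ring_1)"
  shows "has_inverse a"
  by (metis assms has_inverseI mult.assoc mult_1_left mult_1_right)

lemma cinv_unique:
  assumes "a * b = 1" "b * a = 1" shows "cinv a = b"
  by (metis assms cinv(1) has_inverseI mult.assoc mult_1_left mult_1_right)

lemma has_inverse_1 [simp]: "has_inverse 1" and cinv_1 [simp]: "cinv 1 = 1"
  by (auto intro: has_inverseI cinv_unique)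

lemma not_has_inverse_0 [simp]: "\<not> has_inverse (0 :: 'a::ring_1)"
  by (simp add: has_inverse_def)

lemma has_inverse_cinv [simp]: "has_inverse a \<Longrightarrow> has_inverse (cinv a)"
  and cinv_cinv [simp]: "has_inverse a \<Longrightarrow> cinv (cinv a) = a"
  by (auto intro: has_inverseI[of _ a] cinv_unique simp: cinv)

lemma has_inverse_mult [intro]: "has_inverse a \<Longrightarrow> has_inverse b \<Longrightarrow> has_inverse (a * b)"
  by (rule has_inverseI[of _ "cinv b * cinv a"]) (simp_all add: mult.assoc cinv)

lemma cinv_mult: "has_inverse a \<Longrightarrow> has_inverse b \<Longrightarrow> cinv (a * b) = cinv b * cinv a"
  by (rule cinv_unique) (simp_all add: mult.assoc cinv)

text \<open>A factor of an invertible product need not be invertible; commuting moves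
  \<open>b\<close> to either side, so \<open>cinv (a * b)\<close> yields both a left and a right
  inverse of \<open>a\<close>.\<close>

lemma has_inverse_mult_commute:
  assumes "has_inverse (a * b)" "a * b = b * a"
  shows "has_inverse (a :: 'a::ring_1)"
proof (rule left_right_inverse)
  show "(cinv (a * b) * b) * a = 1"
    using cinv[OF assms(1)] assms(2) by (simp add: mult.assoc)
  show "a * (b * cinv (a * b)) = 1"
    using cinv[OF assms(1)] by (simp flip: mult.assoc)
qed

lemma has_inverse_scaleC:
  fixes a :: "'a::unital_cstar_algebra"
  shows "c \<noteq> 0 \<Longrightarrow> has_inverse a \<Longrightarrow> has_inverse (c *\<^sub>C a)"
  by (rule has_inverseI[of _ "inverse c *\<^sub>C cinv a"]) (simp_all add: cinv)

lemma has_inverse_scaleC_iff [simp]: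
  fixes a :: "'a::unital_cstar_algebra"
  shows "has_inverse (c *\<^sub>C a) \<longleftrightarrow> c \<noteq> 0 \<and> has_inverse a"
  using has_inverse_scaleC[of c a] has_inverse_scaleC[of "inverse c" "c *\<^sub>C a"]
  by (cases "c = 0") auto

lemma has_inverse_scaleR_iff [simp]:
  fixes a :: "'a::unital_cstar_algebra"
  shows "has_inverse (r *\<^sub>R a) \<longleftrightarrow> r \<noteq> 0 \<and> has_inverse a"
  by (simp add: scaleR_scaleC)

lemma has_inverse_minus_iff [simp]:
  fixes a :: "'a::unital_cstar_algebra"
  shows "has_inverse (- a) \<longleftrightarrow> has_inverse a"
  using has_inverse_scaleR_iff[of "-1" a] by simp

lemma cinv_scaleR:
  fixes a :: "'a::unital_cstar_algebra"
  shows "r \<noteq> 0 \<Longrightarrow> has_inverse a \<Longrightarrow> cinv (r *\<^sub>R a) = inverse r *\<^sub>R cinv a"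
  by (rule cinv_unique) (simp_all add: cinv)

lemma adj_cinv: "has_inverse a \<Longrightarrow> adj (cinv a) = cinv (adj a)"
  for a :: "'a::unital_cstar_algebra"
  by (rule cinv_unique[symmetric]) (simp_all add: cinv flip: adj_mult)

lemma spectrum_iff: "c \<in> spectrum a \<longleftrightarrow> \<not> has_inverse (c *\<^sub>C 1 - a)"
  unfolding spectrum_def has_inverse_def by auto

lemma spectrum_iff': "c \<in> spectrum a \<longleftrightarrow> \<not> has_inverse (a - c *\<^sub>C 1)"
  unfolding spectrum_iff using has_inverse_minus_iff[of "a - c *\<^sub>C 1"] by simp

lemma has_inverse_iff_spectrum: "has_inverse a \<longleftrightarrow> 0 \<notin> spectrum a"
  by (simp add: spectrum_iff')

section \<open>Neumann series and continuity of inversion\<close>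

lemma neumann:
  fixes x :: "'a::unital_cstar_algebra"
  assumes "norm x < 1"
  shows has_inverse_neumann: "has_inverse (1 - x)"
    and norm_cinv_diff_neumann: "norm (cinv (1 - x) - 1) \<le> norm x / (1 - norm x)"
proof -
  have s: "summable (\<lambda>n. x ^ n)"
    using assms by (rule complete_algebra_summable_geometric)
  let ?s = "\<Sum>n. x ^ n"
  have 1: "(\<Sum>n. x ^ Suc n) = ?s - 1"
    using suminf_split_head[OF s] by simp
  have "x * ?s = ?s - 1"
    using suminf_mult[OF s, of x] 1 by simp
  moreover have "?s * x = ?s - 1"
    using suminf_mult2[OF s, of x] 1 by (simp add: power_commutes)
  ultimately have "(1 - x) * ?s = 1" "?s * (1 - x) = 1"
    by (simp_all add: algebra_simps)
  then show inv: "has_inverse (1 - x)" by (rule has_inverseI)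
  define y where "y = cinv (1 - x)"
  have y: "y = 1 + x * y"
    using cinv(1)[OF inv] by (simp add: y_def algebra_simps)
  have "norm y \<le> 1 + norm x * norm y"
    using norm_triangle_ineq[of 1 "x * y"] norm_mult_ineq[of x y] y by simp
  then have ny: "norm y \<le> 1 / (1 - norm x)"
    using assms by (simp add: field_simps)
  have "norm (y - 1) \<le> norm x * norm y"
    using y norm_mult_ineq[of x y] by (metis add_diff_cancel_left')
  also have "\<dots> \<le> norm x / (1 - norm x)"
    using mult_left_mono[OF ny, of "norm x"] by simp
  finally show "norm (cinv (1 - x) - 1) \<le> norm x / (1 - norm x)" by (simp add: y_def)
qed

lemma perturb_inverse:
  fixes a b :: "'a::unital_cstar_algebra"
  assumes a: "has_inverse a" and d: "norm (cinv a) * norm (a - b) < 1"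
  shows has_inverse_perturb: "has_inverse b"
    and norm_cinv_perturb:
      "norm (cinv b - cinv a) \<le> (norm (cinv a))\<^sup>2 * norm (a - b) / (1 - norm (cinv a) * norm (a - b))"
proof -
  \<comment> \<open>Chosen so that \<open>b = a * (1 - x)\<close>, which reduces both claims to the
    Neumann series at \<open>1 - x\<close>.\<close>
  define x where "x = cinv a * (a - b)"
  have nx: "norm x \<le> norm (cinv a) * norm (a - b)"
    unfolding x_def by (rule norm_mult_ineq)
  with d have x1: "norm x < 1" by simp
  have b: "b = a * (1 - x)"
    using a by (simp add: x_def algebra_simps)
  show "has_inverse b"
    unfolding b using a has_inverse_neumann[OF x1] by blast
  have "cinv b - cinv a = (cinv (1 - x) - 1) * cinv a"
    unfolding b using cinv_mult[OF a has_inverse_neumann[OF x1]] by (simp add: algebra_simps)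
  then have "norm (cinv b - cinv a) \<le> norm (cinv (1 - x) - 1) * norm (cinv a)"
    by (simp add: norm_mult_ineq)
  also have "\<dots> \<le> norm x / (1 - norm x) * norm (cinv a)"
    by (intro mult_right_mono norm_cinv_diff_neumann x1) simp
  also have "\<dots> \<le> (norm (cinv a) * norm (a - b)) / (1 - norm (cinv a) * norm (a - b)) * norm (cinv a)"
    using nx d by (intro mult_right_mono frac_le) auto
  finally show "norm (cinv b - cinv a) \<le> (norm (cinv a))\<^sup>2 * norm (a - b) / (1 - norm (cinv a) * norm (a - b))"
    by (simp add: power2_eq_square mult_ac)
qed

lemma tendsto_cinv:
  fixes a :: "'a::unital_cstar_algebra"
  assumes a: "has_inverse a" and f: "(f \<longlongrightarrow> a) F"
  shows "((\<lambda>x. cinv (f x)) \<longlongrightarrow> cinv a) F"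
proof -
  have 0: "((\<lambda>x. norm (a - f x)) \<longlongrightarrow> 0) F"
    using tendsto_norm[OF tendsto_diff[OF tendsto_const[of a] f]] by simp
  have "((\<lambda>x. norm (cinv a) * norm (a - f x)) \<longlongrightarrow> norm (cinv a) * 0) F"
    by (intro tendsto_intros 0)
  then have ev: "\<forall>\<^sub>F x in F. norm (cinv a) * norm (a - f x) < 1"
    by (rule order_tendstoD) simp
  have "((\<lambda>x. (norm (cinv a))\<^sup>2 * norm (a - f x) / (1 - norm (cinv a) * norm (a - f x)))
      \<longlongrightarrow> (norm (cinv a))\<^sup>2 * 0 / (1 - norm (cinv a) * 0)) F"
    by (intro tendsto_intros 0) simp
  then have "((\<lambda>x. (norm (cinv a))\<^sup>2 * norm (a - f x) / (1 - norm (cinv a) * norm (a - f x)))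
      \<longlongrightarrow> 0) F" by simp
  then have "((\<lambda>x. cinv (f x) - cinv a) \<longlongrightarrow> 0) F"
    by (rule Lim_null_comparison[rotated])
      (use ev in \<open>auto elim!: eventually_mono intro: norm_cinv_perturb[OF a]\<close>)
  then show ?thesis by (rule LIM_zero_cancel)
qed


section \<open>The spectrum of a self-adjoint element\<close>

lemma spectrum_norm_le:
  fixes a :: "'a::unital_cstar_algebra"
  assumes "c \<in> spectrum a"
  shows "cmod c \<le> norm a"
proof (rule ccontr)
  assume "\<not> cmod c \<le> norm a"
  then have less: "norm a < cmod c" by simp
  then have c: "c \<noteq> 0" by (smt (verit) norm_ge_zero norm_zero)
  have "norm (inverse c *\<^sub>C a) < 1"
    using less c by (simp add: norm_scaleC norm_divide divide_simps)
  from has_inverse_neumann[OF this]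
  have "has_inverse (c *\<^sub>C (1 - inverse c *\<^sub>C a))"
    using c by simp
  also have "c *\<^sub>C (1 - inverse c *\<^sub>C a) = c *\<^sub>C 1 - a"
    using c by (simp add: scaleC.scale_right_diff_distrib)
  finally show False using assms by (simp add: spectrum_iff)
qed

lemma spectrum_shift: "c \<in> spectrum (a + d *\<^sub>C 1) \<longleftrightarrow> c - d \<in> spectrum a"
  by (simp add: spectrum_iff scaleC.scale_left_diff_distrib algebra_simps)

text \<open>Arens' trick: compare \<open>\<bar>c + it\<bar>\<^sup>2\<close> with \<open>\<parallel>a + it\<parallel>\<^sup>2 \<le> \<parallel>a\<parallel>\<^sup>2 + t\<^sup>2\<close> for large \<open>t\<close>.\<close>

lemma spectrum_self_adjoint_real:
  fixes a :: "'a::unital_cstar_algebra"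
  assumes sa: "self_adjoint a" and c: "c \<in> spectrum a"
  shows "c \<in> \<real>"
proof (rule ccontr)
  assume "c \<notin> \<real>"
  then have im: "Im c \<noteq> 0" by (simp add: complex_is_Real_iff)
  have *: "2 * t * Im c \<le> (norm a)\<^sup>2" for t :: real
  proof -
    have "c + \<i> * of_real t \<in> spectrum (a + (\<i> * of_real t) *\<^sub>C 1)"
      using c by (simp add: spectrum_shift)
    from spectrum_norm_le[OF this]
    have "(cmod (c + \<i> * of_real t))\<^sup>2 \<le> (norm (a + (\<i> * of_real t) *\<^sub>C 1))\<^sup>2"
      by simp
    also have "\<dots> = norm (adj (a + (\<i> * of_real t) *\<^sub>C 1) * (a + (\<i> * of_real t) *\<^sub>C 1))"
      by (rule cstar_identity[symmetric])
    also have "adj (a + (\<i> * of_real t) *\<^sub>C 1) * (a + (\<i> * of_real t) *\<^sub>C 1)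
        = a * a + of_real (t\<^sup>2) *\<^sub>C 1"
      using sa by (simp add: self_adjoint_def adj_add adj_scaleC algebra_simps power2_eq_square)
    also have "norm \<dots> \<le> (norm a)\<^sup>2 + t\<^sup>2"
      using norm_triangle_ineq[of "a * a" "of_real (t\<^sup>2) *\<^sub>C 1"] norm_self_adjoint_square[OF sa]
      by (simp add: norm_scaleC norm_power)
    finally have "(Re c)\<^sup>2 + (Im c + t)\<^sup>2 \<le> (norm a)\<^sup>2 + t\<^sup>2"
      by (simp add: cmod_power2)
    moreover have "(Im c + t)\<^sup>2 = (Im c)\<^sup>2 + 2 * t * Im c + t\<^sup>2"
      by (simp add: power2_eq_square algebra_simps)
    ultimately show ?thesis
      using zero_le_power2[of "Re c"] zero_le_power2[of "Im c"] by linarith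
  qed
  \<comment> \<open>This shift turns the left side of the bound into
    \<open>(norm a)\<^sup>2 + 1\<close>; dividing by \<open>Im c\<close> also absorbs its
    sign.\<close>
  from *[of "((norm a)\<^sup>2 + 1) / (2 * Im c)"] im show False by simp
qed

lemma self_adjoint_spectrum_eq_Re:
  "self_adjoint a \<Longrightarrow> c \<in> spectrum a \<Longrightarrow> c = complex_of_real (Re c)"
  by (metis spectrum_self_adjoint_real of_real_Re)

text \<open>The C*-identity controls squares, so the power formula is taken along exponents that are
  powers of two; that is enough to keep \<open>norm (a ^ N) = 1\<close> in the spectral argument
  below.\<close>

lemma norm_self_adjoint_power2:
  fixes a :: "'a::unital_cstar_algebra"
  assumes "self_adjoint a"
  shows "norm (a ^ (2 ^ n)) = norm a ^ (2 ^ n)"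
proof (induction n)
  case (Suc n)
  have "norm (a ^ (2 ^ n) * a ^ (2 ^ n)) = (norm a ^ (2 ^ n))\<^sup>2"
    using norm_self_adjoint_square[OF self_adjoint_power[OF assms], of "2 ^ n"] Suc by simp
  then show ?case by (simp add: power_mult power2_eq_square flip: power_add mult_2)
qed simp

text \<open>
  If neither \<open>1\<close> nor \<open>-1\<close> were in the spectrum of \<open>a\<close> with \<open>\<parallel>a\<parallel> = 1\<close>, then \<open>1 - z a\<close> would be
  invertible on the closed unit disc with uniformly continuous inverse. The averages
  \<open>(1 - z\<^sup>2a\<^sup>2)\<^sup>-\<^sup>1 = ((1 - za)\<^sup>-\<^sup>1 + (1 + za)\<^sup>-\<^sup>1)/2\<close> and their iterates inherit the modulus of
  continuity, so \<open>(1 - a\<^bsup>N\<^esup>)\<^sup>-\<^sup>1\<close> is close to \<open>(1 - r\<^bsup>N\<^esup>a\<^bsup>N\<^esup>)\<^sup>-\<^sup>1\<close>, which tends to \<open>1\<close> along \<open>N = 2\<^bsup>n\<^esup>\<close> for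
  \<open>r < 1\<close>; but \<open>\<parallel>a\<^bsup>N\<^esup>\<parallel> = 1\<close>.
\<close>

lemma self_adjoint_norm_one_in_spectrum:
  fixes a :: "'a::unital_cstar_algebra"
  assumes sa: "self_adjoint a" and n1: "norm a = 1"
  shows "1 \<in> spectrum a \<or> -1 \<in> spectrum a"
proof (rule ccontr)
  assume no: "\<not> (1 \<in> spectrum a \<or> -1 \<in> spectrum a)"
  define D where "D = cball (0::complex) 1"
  have inv: "has_inverse (1 - z *\<^sub>C a)" if "z \<in> D" for z
  proof (cases "z = 0")
    case False
    \<comment> \<open>Being real, of modulus at most \<open>norm a = 1\<close> and at least 1, such
      a spectral value would be \<open>1\<close> or \<open>-1\<close>.\<close>
    have "inverse z \<notin> spectrum a"
    proof
      assume z: "inverse z \<in> spectrum a"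
      have "cmod (inverse z) \<le> 1"
        using spectrum_norm_le[OF z] n1 by simp
      moreover have "cmod (inverse z) \<ge> 1"
        using that False by (simp add: D_def norm_inverse one_le_inverse)
      ultimately have "cmod (inverse z) = 1" by simp
      then have "\<bar>Re (inverse z)\<bar> = 1"
        using self_adjoint_spectrum_eq_Re[OF sa z] norm_of_real[of "Re (inverse z)"] by metis
      then have "inverse z = 1 \<or> inverse z = -1"
        using self_adjoint_spectrum_eq_Re[OF sa z] by (metis abs_eq_iff abs_1 of_real_1 of_real_minus)
      with no z show False by auto
    qed
    then have "has_inverse (z *\<^sub>C (inverse z *\<^sub>C 1 - a))"
      using False by (simp add: spectrum_iff)
    then show ?thesis using False by (simp add: scaleC.scale_right_diff_distrib)
  qed simp
  have "continuous_on D (\<lambda>z. cinv (1 - z *\<^sub>C a))"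
    unfolding continuous_on_def
  proof (intro ballI tendsto_cinv inv)
    fix z
    have "bounded_linear (\<lambda>z. z *\<^sub>C a)"
      by (rule bounded_linear_intro[of _ "norm a"])
        (simp_all add: scaleC_add_left scaleR_scaleC norm_scaleC scaleR_conv_of_real)
    then show "((\<lambda>z. 1 - z *\<^sub>C a) \<longlongrightarrow> 1 - z *\<^sub>C a) (at z within D)"
      by (intro tendsto_intros bounded_linear.tendsto[of "\<lambda>z. z *\<^sub>C a"])
  qed
  then have "uniformly_continuous_on D (\<lambda>z. cinv (1 - z *\<^sub>C a))"
    by (rule compact_uniformly_continuous) (simp add: D_def)
  then obtain \<delta> where \<delta>: "\<delta> > 0" and uc:
    "\<And>z w. z \<in> D \<Longrightarrow> w \<in> D \<Longrightarrow> cmod (w - z) < \<delta> \<Longrightarrow>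
        norm (cinv (1 - w *\<^sub>C a) - cinv (1 - z *\<^sub>C a)) < 1/8"
    unfolding uniformly_continuous_on_def dist_norm by (metis zero_less_divide_1_iff zero_less_numeral)
  \<comment> \<open>The same \<open>\<delta>\<close> and the same bound 1/8 serve every
    \<open>N = 2 ^ n\<close>; this uniformity allows a radius \<open>r < 1\<close> to be fixed
    before \<open>N\<close> is taken large.\<close>
  have main: "has_inverse (1 - (z ^ N) *\<^sub>C (a ^ N)) \<and>
      (\<forall>w\<in>D. cmod (w - z) < \<delta> \<longrightarrow> norm (cinv (1 - (w ^ N) *\<^sub>C (a ^ N)) - cinv (1 - (z ^ N) *\<^sub>C (a ^ N))) < 1/8)"
    if "z \<in> D" and N: "N = 2 ^ n" for z n and N :: nat
    using that
  proof (induction n arbitrary: z N)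
    case 0
    then show ?case using inv uc by auto
  next
    case (Suc n)
    define M where "M = (2::nat) ^ n"
    \<comment> \<open>Since \<open>\<omega> ^ M = -1\<close>, passing from \<open>z\<close> to
      \<open>\<omega> * z\<close> stays in the disc and negates \<open>z ^ M\<close>; this supplies
      both factors of \<open>1 - (z ^ N) *\<^sub>C (a ^ N)\<close>.\<close>
    define \<omega> where "\<omega> = cis (pi / real M)"
    have M: "M > 0" by (simp add: M_def)
    have \<omega>: "\<omega> ^ M = -1" using M by (simp add: \<omega>_def Complex.DeMoivre)
    have \<omega>1: "cmod \<omega> = 1" by (simp add: \<omega>_def)
    have NM: "N = M + M" using Suc.prems by (simp add: M_def)
    have avg: "has_inverse (1 - (z ^ N) *\<^sub>C (a ^ N)) \<and> cinv (1 - (z ^ N) *\<^sub>C (a ^ N)) =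
       (1/2) *\<^sub>R (cinv (1 - (z ^ M) *\<^sub>C (a ^ M)) + cinv (1 - ((\<omega> * z) ^ M) *\<^sub>C (a ^ M)))"
      if "z \<in> D" for z
    proof -
      let ?b = "(z ^ M) *\<^sub>C (a ^ M)"
      have b': "((\<omega> * z) ^ M) *\<^sub>C (a ^ M) = - ?b"
        using \<omega> by (simp add: power_mult_distrib)
      have wz: "\<omega> * z \<in> D" using that \<omega>1 by (simp add: D_def norm_mult)
      have 1: "has_inverse (1 - ?b)" and 2: "has_inverse (1 + ?b)"
        using Suc.IH[OF that M_def] Suc.IH[OF wz M_def] b' by auto
      have N: "1 - (z ^ N) *\<^sub>C (a ^ N) = (1 - ?b) * (1 + ?b)"
        by (simp add: NM power_add algebra_simps)
      have "cinv (1 - ?b) = cinv (1 - ?b) * ((1 + ?b) * cinv (1 + ?b))" using cinv[OF 2] by simp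
      then have p: "cinv (1 - ?b) = (cinv (1 - ?b) * (1 + ?b)) * cinv (1 + ?b)" by (simp only: mult.assoc)
      have "cinv (1 - ?b) + cinv (1 + ?b) =
          cinv (1 - ?b) * (1 + ?b) * cinv (1 + ?b) + cinv (1 - ?b) * (1 - ?b) * cinv (1 + ?b)"
        using p cinv(2)[OF 1] by simp
      also have "\<dots> = cinv (1 - ?b) * ((1 + ?b) + (1 - ?b)) * cinv (1 + ?b)"
        by (simp only: distrib_left distrib_right)
      also have "(1 + ?b) + (1 - ?b) = 2 *\<^sub>R (1::'a)" by (simp add: scaleR_2)
      finally have q: "cinv (1 - ?b) + cinv (1 + ?b) = 2 *\<^sub>R (cinv (1 - ?b) * cinv (1 + ?b))" by simp
      have c: "(1 - ?b) * (1 + ?b) = (1 + ?b) * (1 - ?b)"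
        by (simp add: algebra_simps)
      have "cinv ((1 - ?b) * (1 + ?b)) = cinv (1 - ?b) * cinv (1 + ?b)"
        using cinv_mult[OF 2 1] c by simp
      then show ?thesis using 1 2 q N b' by auto
    qed
    show ?case
    proof (intro conjI ballI impI)
      show "has_inverse (1 - (z ^ N) *\<^sub>C (a ^ N))" using avg[OF Suc.prems(1)] by blast
      fix w assume w: "w \<in> D" "cmod (w - z) < \<delta>"
      have wz: "\<omega> * z \<in> D" "\<omega> * w \<in> D" using Suc.prems w \<omega>1 by (simp_all add: D_def norm_mult)
      have "cmod (\<omega> * w - \<omega> * z) < \<delta>"
        using w(2) \<omega>1 by (metis mult_1 norm_mult right_diff_distrib)
      then have i2: "norm (cinv (1 - ((\<omega> * w) ^ M) *\<^sub>C (a ^ M)) - cinv (1 - ((\<omega> * z) ^ M) *\<^sub>C (a ^ M))) < 1/8"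
        (is "norm (?w2 - ?z2) < _")
        using Suc.IH[OF wz(1) M_def] wz by blast
      have i1: "norm (cinv (1 - (w ^ M) *\<^sub>C (a ^ M)) - cinv (1 - (z ^ M) *\<^sub>C (a ^ M))) < 1/8"
        (is "norm (?w1 - ?z1) < _")
        using Suc.IH[OF Suc.prems(1) M_def] w by blast
      have "norm (cinv (1 - (w ^ N) *\<^sub>C (a ^ N)) - cinv (1 - (z ^ N) *\<^sub>C (a ^ N)))
        = norm ((1/2) *\<^sub>R ((?w1 - ?z1) + (?w2 - ?z2)))"
        using avg[OF Suc.prems(1)] avg[OF w(1)] by (simp add: algebra_simps)
      also have "\<dots> \<le> (1/2) * (norm (?w1 - ?z1) + norm (?w2 - ?z2))"
        using norm_triangle_ineq[of "?w1 - ?z1" "?w2 - ?z2"] by simp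
      also have "\<dots> < 1/8" using i1 i2 by simp
      finally show "norm (cinv (1 - (w ^ N) *\<^sub>C (a ^ N)) - cinv (1 - (z ^ N) *\<^sub>C (a ^ N))) < 1/8" .
    qed
  qed
  \<comment> \<open>Strictly below 1, yet within \<open>\<delta>\<close> of 1; the maximum with 0
    covers large \<open>\<delta>\<close>.\<close>
  define r where "r = max 0 (1 - \<delta> / 2)"
  have r: "0 \<le> r" "r < 1" "\<bar>r - 1\<bar> < \<delta>" using \<delta> by (auto simp: r_def)
  have "(\<lambda>k. r ^ k) \<longlonglongrightarrow> 0" using r by (simp add: LIMSEQ_power_zero)
  \<comment> \<open>The constants: a norm below 1/16 puts the Neumann inverse within 1/15 of 1, and
    adding 1/8 leaves \<open>norm (1 - u) < 1/4\<close>; inverting \<open>u\<close> back gives a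
    distance from 1 below 1/3, while \<open>norm (a ^ N) = 1\<close>.\<close>
  then have "\<forall>\<^sub>F k in sequentially. r ^ k < 1/16" by (rule order_tendstoD) simp
  then obtain K where K: "\<And>k. k \<ge> K \<Longrightarrow> r ^ k < 1/16" by (auto simp: eventually_sequentially)
  define N where "N = (2::nat) ^ K"
  have rN: "r ^ N < 1/16" by (rule K) (simp add: N_def less_imp_le)
  have aN: "norm (a ^ N) = 1" using norm_self_adjoint_power2[OF sa, of K] n1 by (simp add: N_def)
  have mem: "1 \<in> D" "of_real r \<in> D" using r by (simp_all add: D_def)
  define u where "u = cinv (1 - a ^ N)"
  have u: "has_inverse (1 - a ^ N)" using main[OF mem(1) N_def] by simp
  have close: "norm (cinv (1 - (of_real r ^ N) *\<^sub>C (a ^ N)) - u) < 1/8"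
  proof -
    have "cmod (of_real r - 1) < \<delta>" using r(3) by (metis norm_of_real of_real_1 of_real_diff)
    then show ?thesis using main[OF mem(1) N_def] mem(2) by (simp add: u_def)
  qed
  let ?x = "(of_real r ^ N) *\<^sub>C (a ^ N)"
  have nx: "norm ?x = r ^ N" using r aN by (simp add: norm_scaleC norm_power)
  have x1: "norm ?x < 1" using nx rN by simp
  have "norm (cinv (1 - ?x) - 1) \<le> norm ?x / (1 - norm ?x)" by (rule norm_cinv_diff_neumann[OF x1])
  also have "\<dots> \<le> 1/15" using nx rN r(1) by (simp add: field_simps)
  finally have "norm (1 - u) < 1/4"
    using close norm_triangle_ineq[of "1 - cinv (1 - ?x)" "cinv (1 - ?x) - u"]
    by (simp add: norm_minus_commute)
  then have v: "norm (1 - u) < 1" and v4: "norm (1 - u) < 1/4" by auto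
  have "cinv u = 1 - a ^ N" using u by (simp add: u_def)
  then have "norm (a ^ N) = norm (cinv (1 - (1 - u)) - 1)" by (simp add: norm_minus_commute)
  also have "\<dots> \<le> norm (1 - u) / (1 - norm (1 - u))" by (rule norm_cinv_diff_neumann[OF v])
  also have "\<dots> < 1" using v4 by (simp add: field_simps)
  finally show False using aN by simp
qed

lemma spectrum_scaleC: "d \<noteq> 0 \<Longrightarrow> c \<in> spectrum (d *\<^sub>C a) \<longleftrightarrow> c / d \<in> spectrum a"
proof -
  assume d: "d \<noteq> 0"
  have "c *\<^sub>C 1 - d *\<^sub>C a = d *\<^sub>C ((c / d) *\<^sub>C 1 - a)"
    using d by (simp add: scaleC.scale_right_diff_distrib)
  then show ?thesis using d by (simp add: spectrum_iff)
qed

lemma self_adjoint_norm_in_spectrum: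
  fixes a :: "'a::unital_cstar_algebra"
  assumes sa: "self_adjoint a"
  obtains c where "c \<in> spectrum a" "cmod c = norm a"
proof (cases "a = 0")
  case True
  have "0 \<in> spectrum a" by (simp add: spectrum_iff True)
  then show ?thesis using that True by simp
next
  case False
  define b where "b = (1 / norm a) *\<^sub>R a"
  have "self_adjoint b" "norm b = 1"
    using sa False by (auto simp: b_def)
  from self_adjoint_norm_one_in_spectrum[OF this]
  obtain d where d: "d \<in> spectrum b" "cmod d = 1" by (metis norm_minus_cancel norm_one)
  have "of_real (norm a) * d \<in> spectrum a"
    using d(1) False spectrum_scaleC[of "of_real (1 / norm a)" d a]
    by (simp add: b_def scaleR_scaleC mult.commute)
  then show ?thesis using that d(2) by (simp add: norm_mult)
qed

lemma closed_spectrum: "closed (spectrum (a :: 'a::unital_cstar_algebra))"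
proof -
  have "open (- spectrum a)"
    unfolding open_contains_ball
  proof
    fix c assume "c \<in> - spectrum a"
    then have i: "has_inverse (c *\<^sub>C 1 - a)" by (simp add: spectrum_iff)
    let ?k = "norm (cinv (c *\<^sub>C 1 - a))"
    have "d \<in> - spectrum a" if "d \<in> ball c (1 / (?k + 1))" for d
    proof -
      have "norm ((c *\<^sub>C 1 - a) - (d *\<^sub>C 1 - a)) = cmod (c - d)"
        by (simp add: norm_scaleC flip: scaleC.scale_left_diff_distrib)
      also have "\<dots> < 1 / (?k + 1)" using that by (simp add: dist_norm)
      finally have "?k * norm ((c *\<^sub>C 1 - a) - (d *\<^sub>C 1 - a)) \<le> ?k * (1 / (?k + 1))"
        by (intro mult_left_mono) simp_all
      also have "\<dots> < 1" by (simp add: divide_less_eq add_nonneg_pos)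
      finally show ?thesis using has_inverse_perturb[OF i] by (simp add: spectrum_iff)
    qed
    then show "\<exists>e>0. ball c e \<subseteq> - spectrum a"
      by (intro exI[of _ "1 / (?k + 1)"]) (auto simp: add_nonneg_pos)
  qed
  then show ?thesis by (simp add: closed_def)
qed

section \<open>Continuous functional calculus of a self-adjoint element\<close>

text \<open>Horner evaluation: the coefficients are complex while the argument lies in the algebra,
  so constants enter through \<open>scaleC\<close>.\<close>

definition peval :: "'a::unital_cstar_algebra \<Rightarrow> complex poly \<Rightarrow> 'a" where
  "peval a p = fold_coeffs (\<lambda>c b. c *\<^sub>C 1 + a * b) p 0"

lemma peval_0 [simp]: "peval a 0 = 0"
  by (simp add: peval_def)

lemma peval_pCons [simp]: "peval a (pCons c p) = c *\<^sub>C 1 + a * peval a p"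
  by (cases "p = 0 \<and> c = 0") (auto simp: peval_def)

lemma peval_add: "peval a (p + q) = peval a p + peval a q"
  by (induction p q rule: poly_induct2) (simp_all add: scaleC_add_left algebra_simps)

lemma peval_smult: "peval a (smult c p) = c *\<^sub>C peval a p"
  by (induction p) (simp_all add: scaleC_add_right)

lemma peval_minus: "peval a (- p) = - peval a p"
  using peval_smult[of a "-1" p] by simp

lemma peval_diff: "peval a (p - q) = peval a p - peval a q"
  using peval_add[of a p "- q"] by (simp add: peval_minus)

lemma peval_mult: "peval a (p * q) = peval a p * peval a q"
  by (induction p) (simp_all add: peval_add peval_smult algebra_simps)

lemma adj_peval:
  assumes "self_adjoint a"
  shows "adj (peval a p) = peval a (map_poly cnj p)"
proof (induction p)
  case (pCons c p)
  have "a * peval a q = peval a q * a" for q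
    using peval_mult[of a "[:0, 1:]" q] peval_mult[of a q "[:0, 1:]"] by (simp add: mult.commute)
  with pCons assms show ?case
    by (simp add: map_poly_pCons adj_add adj_mult adj_scaleC self_adjoint_def)
qed simp

lemma poly_cnj_real:
  assumes "z \<in> \<real>"
  shows "poly (map_poly cnj p) z = cnj (poly p z)"
  using assms by (induction p) (auto simp: map_poly_pCons Reals_cnj_iff)

text \<open>Over the complex numbers \<open>q\<close> splits, up to a nonzero constant, into linear
  factors whose roots avoid the spectrum, and each such factor is invertible at \<open>a\<close>.
  Applied to \<open>q - [:c:]\<close> this is the half of spectral mapping that needs algebraic
  closedness.\<close>

lemma has_inverse_peval:
  fixes a :: "'a::unital_cstar_algebra"
  assumes "q \<noteq> 0" "\<And>z. z \<in> spectrum a \<Longrightarrow> poly q z \<noteq> 0"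
  shows "has_inverse (peval a q)"
  using assms
proof (induction "degree q" arbitrary: q)
  case 0
  then obtain c where "q = [:c:]" by (metis degree_eq_zeroE)
  with 0 show ?case by simp
next
  case (Suc n)
  have "\<not> constant (poly q)"
    using Suc.hyps(2) by (simp add: constant_degree)
  then obtain z where z: "poly q z = 0" using fundamental_theorem_of_algebra by blast
  then obtain r where r: "q = [:- z, 1:] * r" by (auto simp: poly_eq_0_iff_dvd elim: dvdE)
  have r0: "r \<noteq> 0" using r Suc.prems(1) by auto
  have "degree q = Suc (degree r)" using r0 unfolding r by (subst degree_mult_eq) auto
  with Suc.hyps r r0 Suc.prems(2) have "has_inverse (peval a r)" by auto
  moreover have "z \<notin> spectrum a" using Suc.prems(2) z by auto
  then have "has_inverse (peval a [:- z, 1:])" by (simp add: spectrum_iff')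
  ultimately show ?case unfolding r peval_mult by blast
qed

text \<open>The polynomial \<open>q - [:poly q z:]\<close> has the factor \<open>[:- z, 1:]\<close>,
  and polynomials in \<open>a\<close> commute; an inverse of the product would therefore invert
  \<open>a - z *\<^sub>C 1\<close>.\<close>

lemma poly_in_spectrum_peval:
  fixes a :: "'a::unital_cstar_algebra"
  assumes "z \<in> spectrum a"
  shows "poly q z \<in> spectrum (peval a q)"
proof -
  obtain r where r: "q - [:poly q z:] = [:- z, 1:] * r"
    by (metis dvdE poly_diff poly_eq_0_iff_dvd poly_pCons poly_0 mult_zero_right add_0_right diff_self)
  have "peval a q - poly q z *\<^sub>C 1 = peval a ([:- z, 1:] * r)"
    unfolding r[symmetric] by (simp add: peval_diff)
  also have "\<dots> = (a - z *\<^sub>C 1) * peval a r"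
    unfolding peval_mult by simp
  finally have 1: "peval a q - poly q z *\<^sub>C 1 = (a - z *\<^sub>C 1) * peval a r" .
  have "(a - z *\<^sub>C 1) * peval a r = peval a r * (a - z *\<^sub>C 1)"
    using peval_mult[of a "[:- z, 1:]" r] peval_mult[of a r "[:- z, 1:]"] by (simp add: mult.commute)
  with 1 assms show ?thesis
    unfolding spectrum_iff' using has_inverse_mult_commute by metis
qed

lemma spectrum_nonempty: "self_adjoint a \<Longrightarrow> spectrum a \<noteq> {}"
  using self_adjoint_norm_in_spectrum by blast

lemma norm_peval_le:
  fixes a :: "'a::unital_cstar_algebra"
  assumes sa: "self_adjoint a" and le: "\<And>z. z \<in> spectrum a \<Longrightarrow> cmod (poly p z) \<le> M"
  shows "norm (peval a p) \<le> M"
proof -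
  obtain z0 where "z0 \<in> spectrum a" using spectrum_nonempty[OF sa] by blast
  then have M: "0 \<le> M" using le by (meson norm_ge_zero order_trans)
  \<comment> \<open>Its value at \<open>a\<close> is self-adjoint, so its norm is attained on its
    spectrum; on the real spectrum of \<open>a\<close> the values of \<open>q\<close> are the
    squared moduli of those of \<open>p\<close>.\<close>
  define q where "q = map_poly cnj p * p"
  have q: "peval a q = adj (peval a p) * peval a p"
    by (simp add: q_def peval_mult adj_peval[OF sa])
  then have "self_adjoint (peval a q)" by (simp add: self_adjoint_def adj_mult)
  then obtain c where c: "c \<in> spectrum (peval a q)" "cmod c = norm (peval a q)"
    by (rule self_adjoint_norm_in_spectrum)
  have "\<exists>z\<in>spectrum a. poly q z = c"
  proof (rule ccontr)
    assume no: "\<not> ?thesis"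
    \<comment> \<open>The zero polynomial would make \<open>c\<close> a value of \<open>q\<close> at
      \<open>z0\<close>; this is where a nonempty spectrum is needed.\<close>
    then have "q - [:c:] \<noteq> 0" using \<open>z0 \<in> spectrum a\<close> by auto
    then have "has_inverse (peval a (q - [:c:]))" using no by (intro has_inverse_peval) auto
    with c(1) show False by (simp add: peval_diff spectrum_iff')
  qed
  then obtain z where z: "z \<in> spectrum a" "poly q z = c" by blast
  have "poly q z = cnj (poly p z) * poly p z"
    using poly_cnj_real[OF spectrum_self_adjoint_real[OF sa z(1)]] by (simp add: q_def)
  then have "cmod c = (cmod (poly p z))\<^sup>2" using z by (simp add: norm_mult power2_eq_square)
  then have "(norm (peval a p))\<^sup>2 = (cmod (poly p z))\<^sup>2" using c q cstar_identity[of "peval a p"] by simp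
  then have "norm (peval a p) = cmod (poly p z)" by simp
  then show ?thesis using le z by simp
qed

text \<open>Expresses that \<open>b\<close> is \<open>f(a)\<close>: one polynomial approximates
  \<open>f\<close> on the spectrum and \<open>b\<close> in norm simultaneously. As a relation it
  lets algebraic laws and Jordan isomorphisms be checked on polynomials before any particular
  calculus is chosen.\<close>

definition fc_rel :: "'a::unital_cstar_algebra \<Rightarrow> (complex \<Rightarrow> complex) \<Rightarrow> 'a \<Rightarrow> bool" where
  "fc_rel a f b \<longleftrightarrow> (\<forall>\<epsilon>>0. \<exists>p. (\<forall>z\<in>spectrum a. cmod (f z - poly p z) \<le> \<epsilon>) \<and> norm (b - peval a p) \<le> \<epsilon>)"

lemma fc_relD:
  assumes "fc_rel a f b" "\<epsilon> > 0"
  obtains p where "\<And>z. z \<in> spectrum a \<Longrightarrow> cmod (f z - poly p z) \<le> \<epsilon>" "norm (b - peval a p) \<le> \<epsilon>"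
  using assms unfolding fc_rel_def by blast

lemma fc_rel_seq:
  "fc_rel a f b \<longleftrightarrow> (\<exists>p. (\<lambda>n. peval a (p n)) \<longlonglongrightarrow> b \<and> uniform_limit (spectrum a) (\<lambda>n. poly (p n)) f sequentially)"
proof
  assume "fc_rel a f b"
  then have "\<exists>p. (\<forall>z\<in>spectrum a. cmod (f z - poly p z) \<le> 1 / real (Suc n)) \<and> norm (b - peval a p) \<le> 1 / real (Suc n)" for n
    unfolding fc_rel_def by simp
  then obtain p where p: "\<And>n z. z\<in>spectrum a \<Longrightarrow> cmod (f z - poly (p n) z) \<le> 1 / real (Suc n)"
    "\<And>n. norm (b - peval a (p n)) \<le> 1 / real (Suc n)" by metis
  have lim: "(\<lambda>n. 1 / real (Suc n)) \<longlonglongrightarrow> 0"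
    using LIMSEQ_inverse_real_of_nat by (simp add: inverse_eq_divide)
  have "(\<lambda>n. peval a (p n) - b) \<longlonglongrightarrow> 0"
    by (rule Lim_null_comparison[OF _ lim]) (use p(2) in \<open>simp add: norm_minus_commute\<close>)
  then have "(\<lambda>n. peval a (p n)) \<longlonglongrightarrow> b" by (rule LIM_zero_cancel)
  moreover have "uniform_limit (spectrum a) (\<lambda>n. poly (p n)) f sequentially"
  proof (rule uniform_limitI)
    fix e :: real assume "e > 0"
    with lim have "\<forall>\<^sub>F n in sequentially. 1 / real (Suc n) < e" by (rule order_tendstoD)
    then show "\<forall>\<^sub>F n in sequentially. \<forall>x\<in>spectrum a. dist (poly (p n) x) (f x) < e"
    proof (eventually_elim, intro ballI)
      fix n x assume "1 / real (Suc n) < e" "x \<in> spectrum a"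
      then show "dist (poly (p n) x) (f x) < e"
        using p(1)[of x n] by (simp add: dist_norm norm_minus_commute)
    qed
  qed
  ultimately show "\<exists>p. (\<lambda>n. peval a (p n)) \<longlonglongrightarrow> b \<and> uniform_limit (spectrum a) (\<lambda>n. poly (p n)) f sequentially"
    by blast
next
  assume "\<exists>p. (\<lambda>n. peval a (p n)) \<longlonglongrightarrow> b \<and> uniform_limit (spectrum a) (\<lambda>n. poly (p n)) f sequentially"
  then obtain p where p: "(\<lambda>n. peval a (p n)) \<longlonglongrightarrow> b" "uniform_limit (spectrum a) (\<lambda>n. poly (p n)) f sequentially"
    by blast
  show "fc_rel a f b"
    unfolding fc_rel_def
  proof (intro allI impI)
    fix \<epsilon> :: real assume \<epsilon>: "\<epsilon> > 0"
    have "\<forall>\<^sub>F n in sequentially. dist (peval a (p n)) b < \<epsilon> \<and> (\<forall>x\<in>spectrum a. dist (poly (p n) x) (f x) < \<epsilon>)"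
      using tendstoD[OF p(1) \<epsilon>] uniform_limitD[OF p(2) \<epsilon>] by eventually_elim simp
    then obtain n where "dist (peval a (p n)) b < \<epsilon>" "\<forall>x\<in>spectrum a. dist (poly (p n) x) (f x) < \<epsilon>"
      by (auto simp: eventually_sequentially)
    then show "\<exists>p. (\<forall>z\<in>spectrum a. cmod (f z - poly p z) \<le> \<epsilon>) \<and> norm (b - peval a p) \<le> \<epsilon>"
      by (metis dist_commute dist_norm less_imp_le)
  qed
qed

lemma fc_rel_norm_le:
  assumes sa: "self_adjoint a" and r: "fc_rel a f b"
    and le: "\<And>z. z \<in> spectrum a \<Longrightarrow> cmod (f z) \<le> M"
  shows "norm b \<le> M"
proof (rule field_le_epsilon)
  fix e :: real assume "e > 0"
  then obtain p where p: "\<And>z. z \<in> spectrum a \<Longrightarrow> cmod (f z - poly p z) \<le> e / 2" "norm (b - peval a p) \<le> e / 2"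
    using fc_relD[OF r, of "e / 2"] by auto
  have "norm (peval a p) \<le> M + e / 2"
  proof (rule norm_peval_le[OF sa])
    fix z assume z: "z \<in> spectrum a"
    show "cmod (poly p z) \<le> M + e / 2"
      using p(1)[OF z] le[OF z] norm_triangle_ineq2[of "poly p z" "f z"] by (simp add: norm_minus_commute)
  qed
  then show "norm b \<le> M + e"
    using p(2) norm_triangle_ineq2[of b "peval a p"] by simp
qed

text \<open>Invertibility is an open condition: were \<open>f z *\<^sub>C 1 - b\<close> invertible,
  so would be \<open>poly p z *\<^sub>C 1 - peval a p\<close> for a close \<open>p\<close>, against
  spectral mapping for polynomials.\<close>

lemma fc_rel_in_spectrum:
  assumes r: "fc_rel a f b" and z: "z \<in> spectrum a"
  shows "f z \<in> spectrum b"
proof (rule ccontr)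
  assume "f z \<notin> spectrum b"
  then have i: "has_inverse (f z *\<^sub>C 1 - b)" by (simp add: spectrum_iff)
  define k where "k = norm (cinv (f z *\<^sub>C 1 - b))"
  \<comment> \<open>Two errors of size \<open>e\<close> add up to \<open>1 / (k + 1)\<close>, whose
    product with \<open>k\<close> stays below 1 as the perturbation lemma requires.\<close>
  define e where "e = 1 / (2 * (k + 1))"
  have k: "k \<ge> 0" by (simp add: k_def)
  then have e: "e > 0" by (simp add: e_def)
  obtain p where p: "\<And>z. z \<in> spectrum a \<Longrightarrow> cmod (f z - poly p z) \<le> e" "norm (b - peval a p) \<le> e"
    using fc_relD[OF r e] by blast
  have "norm ((f z *\<^sub>C 1 - b) - (poly p z *\<^sub>C 1 - peval a p)) = norm ((f z - poly p z) *\<^sub>C 1 - (b - peval a p))"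
    by (simp add: algebra_simps scaleC.scale_left_diff_distrib)
  also have "\<dots> \<le> e + e"
    using norm_triangle_ineq4[of "(f z - poly p z) *\<^sub>C 1" "b - peval a p"] p(1)[OF z] p(2)
    by (simp add: norm_scaleC)
  also have "e + e = 1 / (k + 1)" using k by (simp add: e_def divide_simps)
  finally have "k * norm ((f z *\<^sub>C 1 - b) - (poly p z *\<^sub>C 1 - peval a p)) \<le> k * (1 / (k + 1))"
    using k by (intro mult_left_mono)
  also have "\<dots> < 1" using k by simp
  finally have "has_inverse (poly p z *\<^sub>C 1 - peval a p)"
    unfolding k_def by (rule has_inverse_perturb[OF i])
  then show False using poly_in_spectrum_peval[OF z, of p] by (simp add: spectrum_iff)
qed

lemma fc_rel_bounded:
  assumes "fc_rel a f b" shows "bounded (f ` spectrum a)"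
  using spectrum_norm_le[OF fc_rel_in_spectrum[OF assms]] by (auto simp: bounded_iff)

lemma fc_rel_poly: "fc_rel a (poly p) (peval a p)"
  unfolding fc_rel_def by (intro allI impI exI[of _ p]) simp

lemma fc_rel_cong:
  assumes "fc_rel a f b" "\<And>z. z \<in> spectrum a \<Longrightarrow> f z = g z"
  shows "fc_rel a g b"
  using assms unfolding fc_rel_def by metis

lemma fc_rel_const: "fc_rel a (\<lambda>z. c) (c *\<^sub>C 1)"
  by (rule fc_rel_cong[OF fc_rel_poly[of a "[:c:]", simplified]]) simp

lemma fc_rel_id: "fc_rel a (\<lambda>z. z) a"
  by (rule fc_rel_cong[OF fc_rel_poly[of a "[:0, 1:]", simplified]]) simp

lemma fc_rel_add:
  assumes "fc_rel a f b" "fc_rel a g c"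
  shows "fc_rel a (\<lambda>z. f z + g z) (b + c)"
proof -
  obtain p q where p: "(\<lambda>n. peval a (p n)) \<longlonglongrightarrow> b" "uniform_limit (spectrum a) (\<lambda>n. poly (p n)) f sequentially"
    and q: "(\<lambda>n. peval a (q n)) \<longlonglongrightarrow> c" "uniform_limit (spectrum a) (\<lambda>n. poly (q n)) g sequentially"
    using assms unfolding fc_rel_seq by blast
  show ?thesis
    unfolding fc_rel_seq
    using tendsto_add[OF p(1) q(1)] uniform_limit_add[OF p(2) q(2)]
    by (intro exI[of _ "\<lambda>n. p n + q n"]) (simp add: peval_add poly_add[abs_def])
qed

lemma fc_rel_mult:
  assumes "fc_rel a f b" "fc_rel a g c"
  shows "fc_rel a (\<lambda>z. f z * g z) (b * c)"
proof -
  obtain p q where p: "(\<lambda>n. peval a (p n)) \<longlonglongrightarrow> b" "uniform_limit (spectrum a) (\<lambda>n. poly (p n)) f sequentially"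
    and q: "(\<lambda>n. peval a (q n)) \<longlonglongrightarrow> c" "uniform_limit (spectrum a) (\<lambda>n. poly (q n)) g sequentially"
    using assms unfolding fc_rel_seq by blast
  show ?thesis
    unfolding fc_rel_seq
    using tendsto_mult[OF p(1) q(1)]
      uniform_lim_mult[OF p(2) q(2) fc_rel_bounded[OF assms(1)] fc_rel_bounded[OF assms(2)]]
    by (intro exI[of _ "\<lambda>n. p n * q n"]) (simp add: peval_mult poly_mult[abs_def])
qed

lemma fc_rel_scaleC: "fc_rel a f b \<Longrightarrow> fc_rel a (\<lambda>z. c * f z) (c *\<^sub>C b)"
  using fc_rel_mult[OF fc_rel_const, of a f b c] by simp

lemma fc_rel_diff:
  assumes "fc_rel a f b" "fc_rel a g c"
  shows "fc_rel a (\<lambda>z. f z - g z) (b - c)"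
  using fc_rel_add[OF assms(1) fc_rel_scaleC[OF assms(2), of "-1"]] by simp

lemma fc_rel_cnj:
  assumes sa: "self_adjoint a" and r: "fc_rel a f b"
  shows "fc_rel a (\<lambda>z. cnj (f z)) (adj b)"
  unfolding fc_rel_def
proof (intro allI impI)
  fix \<epsilon> :: real assume "\<epsilon> > 0"
  then obtain p where p: "\<And>z. z \<in> spectrum a \<Longrightarrow> cmod (f z - poly p z) \<le> \<epsilon>" "norm (b - peval a p) \<le> \<epsilon>"
    using fc_relD[OF r] by blast
  show "\<exists>p. (\<forall>z\<in>spectrum a. cmod (cnj (f z) - poly p z) \<le> \<epsilon>) \<and> norm (adj b - peval a p) \<le> \<epsilon>"
  proof (intro exI[of _ "map_poly cnj p"] conjI ballI)
    fix z assume z: "z \<in> spectrum a"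
    show "cmod (cnj (f z) - poly (map_poly cnj p) z) \<le> \<epsilon>"
      using p(1)[OF z] poly_cnj_real[OF spectrum_self_adjoint_real[OF sa z]]
      by (metis complex_cnj_diff complex_mod_cnj)
  next
    show "norm (adj b - peval a (map_poly cnj p)) \<le> \<epsilon>"
      using p(2) by (metis adj_diff adj_peval[OF sa] norm_adj)
  qed
qed

lemma fc_rel_unique:
  assumes "self_adjoint a" "fc_rel a f b" "fc_rel a f c"
  shows "b = c"
  using fc_rel_norm_le[OF assms(1) fc_rel_diff[OF assms(2,3)], of 0] by simp

lemma fc_rel_norm_eq:
  assumes sa: "self_adjoint a" and r: "fc_rel a f b"
  shows "norm b = (SUP z\<in>spectrum a. cmod (f z))"
proof (rule antisym)
  have bd: "bdd_above ((\<lambda>z. cmod (f z)) ` spectrum a)"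
    using spectrum_norm_le[OF fc_rel_in_spectrum[OF r]] by (intro bdd_aboveI[of _ "norm b"]) auto
  show "norm b \<le> (SUP z\<in>spectrum a. cmod (f z))"
    by (rule fc_rel_norm_le[OF sa r]) (rule cSUP_upper[OF _ bd])
  show "(SUP z\<in>spectrum a. cmod (f z)) \<le> norm b"
    using spectrum_norm_le[OF fc_rel_in_spectrum[OF r]]
    by (intro cSUP_least spectrum_nonempty[OF sa])
qed

text \<open>The spectrum of a self-adjoint element is a compact set of reals, so Weierstrass
  approximation on the real line applies to the real and imaginary parts separately.\<close>

lemma polynomial_approx_on_spectrum:
  assumes sa: "self_adjoint a" and f: "continuous_on (spectrum a) f" and e: "e > 0"
  shows "\<exists>p. \<forall>z\<in>spectrum a. cmod (f z - poly p z) < e"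
proof -
  define S where "S = complex_of_real -` spectrum a"
  have S: "compact S"
  proof -
    have "bounded S"
      using spectrum_norm_le[of _ a] unfolding bounded_iff S_def by (metis norm_of_real real_norm_def vimage_eq)
    moreover have "closed S"
      unfolding S_def by (intro closed_vimage closed_spectrum continuous_intros)
    ultimately show ?thesis by (simp add: compact_eq_bounded_closed)
  qed
  have c: "continuous_on S (\<lambda>x. f (of_real x))"
    by (rule continuous_on_compose2[OF f]) (auto simp: S_def intro: continuous_intros)
  have *: "\<exists>p. \<forall>x\<in>S. cmod (of_real (g x) - poly p (of_real x)) < e / 2"
    if g: "continuous_on S g" for g :: "real \<Rightarrow> real"
  proof -
    obtain h where h: "real_polynomial_function h" "\<And>x. x \<in> S \<Longrightarrow> \<bar>g x - h x\<bar> < e / 2"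
      using Stone_Weierstrass_real_polynomial_function[OF S g, of "e / 2"] e by auto
    then obtain c n where hs: "h = (\<lambda>x. \<Sum>i\<le>n. c i * x ^ i)"
      unfolding real_polynomial_function_iff_sum by blast
    have "poly (\<Sum>i\<le>n. monom (of_real (c i)) i) (of_real x) = complex_of_real (h x)" for x
      by (simp add: hs poly_sum poly_monom)
    then show ?thesis
      using h(2) by (intro exI[of _ "\<Sum>i\<le>n. monom (of_real (c i)) i"]) (metis norm_of_real of_real_diff)
  qed
  obtain p where p: "\<And>x. x\<in>S \<Longrightarrow> cmod (of_real (Re (f (of_real x))) - poly p (of_real x)) < e / 2"
    using *[of "\<lambda>x. Re (f (of_real x))"] continuous_on_Re[OF c] by blast
  obtain q where q: "\<And>x. x\<in>S \<Longrightarrow> cmod (of_real (Im (f (of_real x))) - poly q (of_real x)) < e / 2"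
    using *[of "\<lambda>x. Im (f (of_real x))"] continuous_on_Im[OF c] by blast
  show ?thesis
  proof (intro exI[of _ "p + smult \<i> q"] ballI)
    fix z assume z: "z \<in> spectrum a"
    define x where "x = Re z"
    have zx: "z = of_real x" using self_adjoint_spectrum_eq_Re[OF sa z] by (simp add: x_def)
    have x: "x \<in> S" using z zx by (simp add: S_def)
    have "f z - poly (p + smult \<i> q) z = (of_real (Re (f (of_real x))) - poly p (of_real x))
        + \<i> * (of_real (Im (f (of_real x))) - poly q (of_real x))"
      by (subst complex_eq[of "f z"]) (simp add: zx algebra_simps)
    also have "cmod \<dots> \<le> cmod (of_real (Re (f (of_real x))) - poly p (of_real x))
        + cmod (of_real (Im (f (of_real x))) - poly q (of_real x))"
      by (rule order.trans[OF norm_triangle_ineq]) (simp add: norm_mult)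
    also have "\<dots> < e" using p[OF x] q[OF x] by simp
    finally show "cmod (f z - poly (p + smult \<i> q) z) < e" .
  qed
qed

lemma fc_rel_exists:
  assumes sa: "self_adjoint a" and f: "continuous_on (spectrum a) f"
  shows "\<exists>b. fc_rel a f b"
proof -
  have "\<exists>p. \<forall>z\<in>spectrum a. cmod (f z - poly p z) < 1 / real (Suc n)" for n
    by (rule polynomial_approx_on_spectrum[OF sa f]) simp
  then obtain p where p: "\<And>n z. z \<in> spectrum a \<Longrightarrow> cmod (f z - poly (p n) z) < 1 / real (Suc n)"
    by metis
  have lim: "(\<lambda>n. 1 / real (Suc n)) \<longlonglongrightarrow> 0"
    using LIMSEQ_inverse_real_of_nat by (simp add: inverse_eq_divide)
  have u: "uniform_limit (spectrum a) (\<lambda>n. poly (p n)) f sequentially"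
  proof (rule uniform_limitI)
    fix e :: real assume "e > 0"
    with lim have "\<forall>\<^sub>F n in sequentially. 1 / real (Suc n) < e" by (rule order_tendstoD)
    then show "\<forall>\<^sub>F n in sequentially. \<forall>x\<in>spectrum a. dist (poly (p n) x) (f x) < e"
    proof (eventually_elim, intro ballI)
      fix n x assume "1 / real (Suc n) < e" "x \<in> spectrum a"
      then show "dist (poly (p n) x) (f x) < e"
        using p[of x n] by (simp add: dist_norm norm_minus_commute)
    qed
  qed
  have "Cauchy (\<lambda>n. peval a (p n))"
  proof (rule metric_CauchyI)
    fix e :: real assume e: "e > 0"
    then have "\<forall>\<^sub>F n in sequentially. \<forall>x\<in>spectrum a. dist (poly (p n) x) (f x) < e / 4"
      by (intro uniform_limitD[OF u]) simp
    then obtain N where N: "\<And>n x. n \<ge> N \<Longrightarrow> x \<in> spectrum a \<Longrightarrow> dist (poly (p n) x) (f x) < e / 4"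
      by (auto simp: eventually_sequentially)
    have "dist (peval a (p m)) (peval a (p n)) < e" if "m \<ge> N" "n \<ge> N" for m n
    proof -
      have "norm (peval a (p m - p n)) \<le> e / 2"
      proof (rule norm_peval_le[OF sa])
        fix z assume z: "z \<in> spectrum a"
        show "cmod (poly (p m - p n) z) \<le> e / 2"
          using N[OF that(1) z] N[OF that(2) z] dist_triangle2[of "poly (p m) z" "poly (p n) z" "f z"]
          by (simp add: dist_norm)
      qed
      then show ?thesis using e by (simp add: dist_norm peval_diff)
    qed
    then show "\<exists>N. \<forall>m\<ge>N. \<forall>n\<ge>N. dist (peval a (p m)) (peval a (p n)) < e" by blast
  qed
  then obtain b where "(\<lambda>n. peval a (p n)) \<longlonglongrightarrow> b" using Cauchy_convergent convergent_def by blast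
  with u show ?thesis unfolding fc_rel_seq by blast
qed

section \<open>Existence and uniqueness of the functional calculus\<close>

lemma fc_rel_is_functional_calculus:
  assumes sa: "self_adjoint a"
    and \<Phi>: "\<And>f. continuous_on (spectrum a) f \<Longrightarrow> fc_rel a f (\<Phi> f)"
  shows "is_functional_calculus a \<Phi>"
proof -
  note u = fc_rel_unique[OF sa]
  show ?thesis
    unfolding is_functional_calculus_def
  proof (intro conjI allI impI)
    show "\<Phi> (\<lambda>z. 1) = 1" using u[OF \<Phi> fc_rel_const[of _ 1]] by simp
    show "\<Phi> (\<lambda>z. z) = a" using u[OF \<Phi> fc_rel_id] by simp
    fix f :: "complex \<Rightarrow> complex" assume f: "continuous_on (spectrum a) f"
    show "\<Phi> (\<lambda>z. cnj (f z)) = adj (\<Phi> f)"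
      using f by (intro u[OF \<Phi> fc_rel_cnj[OF sa \<Phi>]] continuous_intros)
    fix c :: complex
    show "\<Phi> (\<lambda>z. c * f z) = c *\<^sub>C \<Phi> f"
      using f by (intro u[OF \<Phi> fc_rel_scaleC[OF \<Phi>]] continuous_intros)
    show "norm (\<Phi> f) = (SUP z\<in>spectrum a. cmod (f z))"
      using \<Phi>[OF f] by (rule fc_rel_norm_eq[OF sa])
  next
    fix f g :: "complex \<Rightarrow> complex" assume fg: "continuous_on (spectrum a) f \<and> continuous_on (spectrum a) g"
    show "\<Phi> (\<lambda>z. f z + g z) = \<Phi> f + \<Phi> g"
      using fg by (intro u[OF \<Phi> fc_rel_add[OF \<Phi> \<Phi>]] continuous_intros) auto
    show "\<Phi> (\<lambda>z. f z * g z) = \<Phi> f * \<Phi> g"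
      using fg by (intro u[OF \<Phi> fc_rel_mult[OF \<Phi> \<Phi>]] continuous_intros) auto
    show "\<Phi> f = \<Phi> g" if "\<forall>z\<in>spectrum a. f z = g z"
      using fg that by (intro u[OF \<Phi> fc_rel_cong[OF \<Phi>]]) auto
  qed
qed

text \<open>The ring laws force \<open>\<Phi>\<close> to agree with \<open>peval\<close> on
  polynomials, and the sup-norm clause carries this to uniform limits. So all calculi agree on
  continuous functions, which is what the \<open>THE\<close> in \<open>cfc\<close> needs.\<close>

lemma is_functional_calculus_fc_rel:
  assumes sa: "self_adjoint a" and fc: "is_functional_calculus a \<Phi>"
    and f: "continuous_on (spectrum a) f"
  shows "fc_rel a f (\<Phi> f)"
proof -
  have one: "\<Phi> (\<lambda>z. 1) = 1" and id: "\<Phi> (\<lambda>z. z) = a"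
    and sc: "\<And>f c. continuous_on (spectrum a) f \<Longrightarrow> \<Phi> (\<lambda>z. c * f z) = c *\<^sub>C \<Phi> f"
    and nm: "\<And>f. continuous_on (spectrum a) f \<Longrightarrow> norm (\<Phi> f) = (SUP z\<in>spectrum a. cmod (f z))"
    and ad: "\<And>f g. continuous_on (spectrum a) f \<Longrightarrow> continuous_on (spectrum a) g \<Longrightarrow> \<Phi> (\<lambda>z. f z + g z) = \<Phi> f + \<Phi> g"
    and mu: "\<And>f g. continuous_on (spectrum a) f \<Longrightarrow> continuous_on (spectrum a) g \<Longrightarrow> \<Phi> (\<lambda>z. f z * g z) = \<Phi> f * \<Phi> g"
    using fc unfolding is_functional_calculus_def by blast+
  have cp: "continuous_on A (poly p)" for A and p :: "complex poly"
    by (intro continuous_intros)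
  have po: "\<Phi> (poly p) = peval a p" for p
  proof (induction p)
    case 0
    have "\<Phi> (\<lambda>z. 0 * 1) = 0 *\<^sub>C \<Phi> (\<lambda>z. 1)" by (rule sc) simp
    moreover have "poly 0 = (\<lambda>z::complex. 0 * 1)" by auto
    ultimately show ?case by simp
  next
    case (pCons c p)
    have "poly (pCons c p) = (\<lambda>z. c * 1 + z * poly p z)" by auto
    then have "\<Phi> (poly (pCons c p)) = \<Phi> (\<lambda>z. c * 1 + z * poly p z)" by simp
    also have "\<dots> = \<Phi> (\<lambda>z. c * 1) + \<Phi> (\<lambda>z. z * poly p z)"
      by (rule ad) (intro continuous_intros)+
    also have "\<Phi> (\<lambda>z. c * 1) = c *\<^sub>C \<Phi> (\<lambda>z. 1)" by (rule sc) simp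
    also have "\<Phi> (\<lambda>z. z * poly p z) = \<Phi> (\<lambda>z. z) * \<Phi> (poly p)"
      by (rule mu) (intro continuous_intros cp)+
    finally show ?case by (simp add: one id pCons)
  qed
  show ?thesis
    unfolding fc_rel_def
  proof (intro allI impI)
    fix \<epsilon> :: real assume "\<epsilon> > 0"
    then obtain p where p: "\<forall>z\<in>spectrum a. cmod (f z - poly p z) < \<epsilon>"
      using polynomial_approx_on_spectrum[OF sa f] by blast
    have c: "continuous_on (spectrum a) (\<lambda>z. f z + (-1) * poly p z)"
      by (intro continuous_intros f cp)
    have "\<Phi> f - peval a p = \<Phi> f + (-1) *\<^sub>C \<Phi> (poly p)" by (simp add: po)
    also have "\<dots> = \<Phi> f + \<Phi> (\<lambda>z. (-1) * poly p z)" using sc[OF cp, of "-1"] by simp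
    also have "\<dots> = \<Phi> (\<lambda>z. f z + (-1) * poly p z)"
      by (rule ad[symmetric]) (intro continuous_intros f cp)+
    also have "norm \<dots> = (SUP z\<in>spectrum a. cmod (f z + (-1) * poly p z))" by (rule nm[OF c])
    also have "\<dots> \<le> \<epsilon>" using p by (intro cSUP_least spectrum_nonempty[OF sa]) (auto simp: less_imp_le)
    finally show "\<exists>p. (\<forall>z\<in>spectrum a. cmod (f z - poly p z) \<le> \<epsilon>) \<and> norm (\<Phi> f - peval a p) \<le> \<epsilon>"
      using p by (intro exI[of _ p]) (auto simp: less_imp_le)
  qed
qed

lemma fc_rel_cfc:
  assumes sa: "self_adjoint a" and f: "continuous_on (spectrum a) f"
  shows "fc_rel a f (cfc f a)"
proof -
  have "\<exists>\<Phi>. \<forall>f. continuous_on (spectrum a) f \<longrightarrow> fc_rel a f (\<Phi> f)"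
    using fc_rel_exists[OF sa] by metis
  then obtain \<Phi> where \<Phi>: "\<And>f. continuous_on (spectrum a) f \<Longrightarrow> fc_rel a f (\<Phi> f)" by blast
  have "cfc f a = \<Phi> f"
    unfolding cfc_def
  proof (rule the_equality)
    show "\<exists>\<Psi>. is_functional_calculus a \<Psi> \<and> \<Psi> f = \<Phi> f"
      using fc_rel_is_functional_calculus[OF sa \<Phi>] by blast
    fix b assume "\<exists>\<Psi>. is_functional_calculus a \<Psi> \<and> \<Psi> f = b"
    then show "b = \<Phi> f"
      using fc_rel_unique[OF sa] is_functional_calculus_fc_rel[OF sa _ f] \<Phi>[OF f] by blast
  qed
  then show ?thesis using \<Phi>[OF f] by simp
qed

lemma cfc_eqI:
  assumes "self_adjoint a" "continuous_on (spectrum a) f" "fc_rel a f b"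
  shows "cfc f a = b"
  using fc_rel_unique[OF assms(1) fc_rel_cfc[OF assms(1,2)] assms(3)] .

lemma cfc_cong:
  assumes "self_adjoint a" "continuous_on (spectrum a) f" "\<And>z. z \<in> spectrum a \<Longrightarrow> f z = g z"
  shows "cfc f a = cfc g a"
proof (rule cfc_eqI[OF assms(1,2)])
  have "continuous_on (spectrum a) g"
    by (rule iffD1[OF continuous_on_cong[OF refl assms(3)] assms(2)])
  from fc_rel_cfc[OF assms(1) this] show "fc_rel a f (cfc g a)"
    by (rule fc_rel_cong) (simp add: assms(3))
qed

lemma cfc_mult:
  assumes "self_adjoint a" "continuous_on (spectrum a) f" "continuous_on (spectrum a) g"
  shows "cfc (\<lambda>z. f z * g z) a = cfc f a * cfc g a"
  using assms by (intro cfc_eqI fc_rel_mult fc_rel_cfc continuous_intros)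

lemma cfc_id: "self_adjoint a \<Longrightarrow> cfc (\<lambda>z. z) a = a"
  by (intro cfc_eqI fc_rel_id continuous_intros)

lemma self_adjoint_cfc:
  assumes sa: "self_adjoint a" and f: "continuous_on (spectrum a) f"
    and re: "\<And>z. z \<in> spectrum a \<Longrightarrow> f z \<in> \<real>"
  shows "self_adjoint (cfc f a)"
proof -
  have "fc_rel a f (adj (cfc f a))"
    by (rule fc_rel_cong[OF fc_rel_cnj[OF sa fc_rel_cfc[OF sa f]]]) (use re in \<open>simp add: Reals_cnj_iff\<close>)
  from cfc_eqI[OF sa f this] show ?thesis by (simp add: self_adjoint_def)
qed

text \<open>If \<open>d\<close> is not a value of \<open>f\<close> on the spectrum, then
  \<open>inverse (d - f z)\<close> is continuous there, and its calculus value inverts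
  \<open>d *\<^sub>C 1 - cfc f a\<close>.\<close>

lemma spectrum_cfc:
  assumes sa: "self_adjoint a" and f: "continuous_on (spectrum a) f"
  shows "spectrum (cfc f a) = f ` spectrum a"
proof
  show "f ` spectrum a \<subseteq> spectrum (cfc f a)"
    using fc_rel_in_spectrum[OF fc_rel_cfc[OF sa f]] by blast
  show "spectrum (cfc f a) \<subseteq> f ` spectrum a"
  proof (rule ccontr)
    assume "\<not> ?thesis"
    then obtain d where d: "d \<in> spectrum (cfc f a)" "\<And>z. z \<in> spectrum a \<Longrightarrow> d - f z \<noteq> 0" by auto
    have c: "continuous_on (spectrum a) (\<lambda>z. d - f z)" by (intro continuous_intros f)
    then have ci: "continuous_on (spectrum a) (\<lambda>z. inverse (d - f z))"
      using d(2) by (intro continuous_intros f) auto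
    have e: "fc_rel a (\<lambda>z. d - f z) (d *\<^sub>C 1 - cfc f a)"
      by (intro fc_rel_diff fc_rel_const fc_rel_cfc sa f)
    have i: "fc_rel a (\<lambda>z. inverse (d - f z)) (cfc (\<lambda>z. inverse (d - f z)) a)"
      by (rule fc_rel_cfc[OF sa ci])
    have "fc_rel a (\<lambda>z. 1) ((d *\<^sub>C 1 - cfc f a) * cfc (\<lambda>z. inverse (d - f z)) a)"
      by (rule fc_rel_cong[OF fc_rel_mult[OF e i]]) (use d(2) in auto)
    moreover have "fc_rel a (\<lambda>z. 1) (cfc (\<lambda>z. inverse (d - f z)) a * (d *\<^sub>C 1 - cfc f a))"
      by (rule fc_rel_cong[OF fc_rel_mult[OF i e]]) (use d(2) in auto)
    moreover have "fc_rel a (\<lambda>z. 1) 1" using fc_rel_const[of a 1] by simp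
    ultimately have "has_inverse (d *\<^sub>C 1 - cfc f a)"
      using fc_rel_unique[OF sa] by (metis has_inverseI)
    with d(1) show False by (simp add: spectrum_iff)
  qed
qed

text \<open>For polynomial \<open>g\<close> this is the homomorphism law. In general a polynomial
  close to \<open>g\<close> on the spectrum of \<open>cfc f a\<close> is equally close along
  \<open>f\<close> on the spectrum of \<open>a\<close>, so the two sides differ by at most any
  \<open>e\<close>.\<close>

lemma cfc_compose:
  assumes sa: "self_adjoint a" and f: "continuous_on (spectrum a) f"
    and re: "\<And>z. z \<in> spectrum a \<Longrightarrow> f z \<in> \<real>"
    and g: "continuous_on (f ` spectrum a) g"
  shows "cfc g (cfc f a) = cfc (\<lambda>z. g (f z)) a"
proof -
  have gf: "continuous_on (spectrum a) (\<lambda>z. g (f z))"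
    by (rule continuous_on_compose2[OF g f]) auto
  have g': "continuous_on (spectrum (cfc f a)) g"
    using g by (simp add: spectrum_cfc[OF sa f])
  have po: "fc_rel a (\<lambda>z. poly p (f z)) (peval (cfc f a) p)" for p
  proof (induction p)
    case 0
    then show ?case using fc_rel_const[of a 0] by simp
  next
    case (pCons c p)
    then show ?case
      using fc_rel_add[OF fc_rel_const[of a c] fc_rel_mult[OF fc_rel_cfc[OF sa f] pCons.IH]] by simp
  qed
  have "norm (cfc g (cfc f a) - cfc (\<lambda>z. g (f z)) a) \<le> 0"
  proof (rule field_le_epsilon)
    fix e :: real assume "e > 0"
    then obtain p where p: "\<And>z. z \<in> spectrum (cfc f a) \<Longrightarrow> cmod (g z - poly p z) \<le> e / 2"
        "norm (cfc g (cfc f a) - peval (cfc f a) p) \<le> e / 2"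
      using fc_relD[OF fc_rel_cfc[OF self_adjoint_cfc[OF sa f re] g'], of "e / 2"] by auto
    have "norm (cfc (\<lambda>z. g (f z)) a - peval (cfc f a) p) \<le> e / 2"
      by (rule fc_rel_norm_le[OF sa fc_rel_diff[OF fc_rel_cfc[OF sa gf] po]])
        (use p(1) in \<open>simp add: spectrum_cfc[OF sa f]\<close>)
    then show "norm (cfc g (cfc f a) - cfc (\<lambda>z. g (f z)) a) \<le> 0 + e"
      using p(2) norm_triangle_ineq4[of "cfc g (cfc f a) - peval (cfc f a) p" "cfc (\<lambda>z. g (f z)) a - peval (cfc f a) p"]
      by simp
  qed
  then show ?thesis by simp
qed


section \<open>Positive elements\<close>

lemma positive_self_adjoint [dest]: "positive a \<Longrightarrow> self_adjoint a"
  by (simp add: positive_def)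

lemma positive_adj [simp]: "positive a \<Longrightarrow> adj a = a"
  using positive_self_adjoint self_adjoint_def by blast

lemma spectrum_reflect: "c \<in> spectrum (d *\<^sub>C 1 - a) \<longleftrightarrow> d - c \<in> spectrum a"
  unfolding spectrum_iff[of c] spectrum_iff'[of "d - c"]
  using has_inverse_minus_iff[of "c *\<^sub>C 1 - (d *\<^sub>C 1 - a)"]
  by (simp add: scaleC.scale_left_diff_distrib algebra_simps)

lemma positiveI:
  assumes "self_adjoint a" "\<And>c. c \<in> spectrum a \<Longrightarrow> 0 \<le> Re c"
  shows "positive a"
  using assms spectrum_self_adjoint_real by (auto simp: positive_def)

lemma positiveD: "positive a \<Longrightarrow> c \<in> spectrum a \<Longrightarrow> 0 \<le> Re c"
  by (simp add: positive_def)

text \<open>Reflecting the spectrum at \<open>t\<close> moves it into [0, 2t], and positivity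
  singles out the half [0, t], which the norm detects. The norm form turns closure of the positive
  elements under sums into the triangle inequality.\<close>

lemma positive_iff_norm:
  assumes sa: "self_adjoint a" and t: "norm a \<le> t"
  shows "positive a \<longleftrightarrow> norm (t *\<^sub>R 1 - a) \<le> t"
proof
  assume pos: "positive a"
  have sa': "self_adjoint (t *\<^sub>R 1 - a)" by (intro self_adjoint_diff self_adjoint_scaleR sa self_adjoint_1)
  obtain c where c: "c \<in> spectrum (t *\<^sub>R 1 - a)" "cmod c = norm (t *\<^sub>R 1 - a)"
    by (rule self_adjoint_norm_in_spectrum[OF sa'])
  have m: "of_real t - c \<in> spectrum a"
    using c(1) by (simp add: scaleR_scaleC spectrum_reflect)
  have c': "c = of_real (Re c)" by (rule self_adjoint_spectrum_eq_Re[OF sa' c(1)])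
  have "0 \<le> t - Re c" using positiveD[OF pos m] by simp
  moreover have "\<bar>t - Re c\<bar> \<le> t"
    using spectrum_norm_le[OF m] t abs_Re_le_cmod[of "of_real t - c"] by simp
  ultimately have "\<bar>Re c\<bar> \<le> t" by linarith
  then show "norm (t *\<^sub>R 1 - a) \<le> t" using c(2) c' by (metis norm_of_real)
next
  assume le: "norm (t *\<^sub>R 1 - a) \<le> t"
  show "positive a"
  proof (rule positiveI[OF sa])
    fix c assume "c \<in> spectrum a"
    then have "of_real t - c \<in> spectrum (t *\<^sub>R 1 - a)"
      by (simp add: scaleR_scaleC spectrum_reflect)
    from spectrum_norm_le[OF this] show "0 \<le> Re c"
      using le abs_Re_le_cmod[of "of_real t - c"] by simp
  qed
qed

lemma positive_add [intro]:
  assumes "positive a" "positive b"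
  shows "positive (a + b)"
proof -
  have sa: "self_adjoint a" "self_adjoint b" using assms by auto
  have "norm ((norm a + norm b) *\<^sub>R 1 - (a + b)) = norm ((norm a *\<^sub>R 1 - a) + (norm b *\<^sub>R 1 - b))"
    by (simp add: algebra_simps)
  also have "\<dots> \<le> norm a + norm b"
    using norm_triangle_ineq[of "norm a *\<^sub>R 1 - a" "norm b *\<^sub>R 1 - b"]
      positive_iff_norm[OF sa(1) order_refl] positive_iff_norm[OF sa(2) order_refl] assms by simp
  finally show ?thesis
    using positive_iff_norm[of "a + b" "norm a + norm b"] sa norm_triangle_ineq[of a b] by auto
qed

lemma positive_0 [simp]: "positive (0 :: 'a::unital_cstar_algebra)"
proof (rule positiveI)
  fix c :: complex assume "c \<in> spectrum (0 :: 'a)"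
  then show "0 \<le> Re c" using spectrum_norm_le[of c "0 :: 'a"] by simp
qed simp

lemma positive_1 [simp]: "positive (1 :: 'a::unital_cstar_algebra)"
  using positive_iff_norm[of "1 :: 'a" 1] by simp

lemma positive_scaleR [intro]:
  assumes "positive a" "0 \<le> r"
  shows "positive (r *\<^sub>R a)"
proof (cases "r = 0")
  case True
  then show ?thesis by simp
next
  case False
  show ?thesis
  proof (rule positiveI)
    show "self_adjoint (r *\<^sub>R a)" using assms by auto
    fix c assume "c \<in> spectrum (r *\<^sub>R a)"
    then have "c / of_real r \<in> spectrum a" using False by (simp add: scaleR_scaleC spectrum_scaleC)
    from positiveD[OF assms(1) this] show "0 \<le> Re c" using assms(2) False by (simp add: zero_le_divide_iff)
  qed
qed

lemma positive_antisym:
  assumes "positive a" "positive (- a)"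
  shows "a = 0"
proof -
  have sa: "self_adjoint a" using assms by auto
  obtain c where c: "c \<in> spectrum a" "cmod c = norm a" by (rule self_adjoint_norm_in_spectrum[OF sa])
  have "- c \<in> spectrum (- a)" using c(1) spectrum_scaleC[of "-1" "- c" a] by simp
  then have "Re c = 0" using positiveD[OF assms(1) c(1)] positiveD[OF assms(2)] by fastforce
  then have "c = 0" using self_adjoint_spectrum_eq_Re[OF sa c(1)] by simp
  then show ?thesis using c(2) by simp
qed

lemma positive_cfc:
  assumes sa: "self_adjoint a" and f: "continuous_on (spectrum a) f"
    and re: "\<And>z. z \<in> spectrum a \<Longrightarrow> f z \<in> \<real> \<and> 0 \<le> Re (f z)"
  shows "positive (cfc f a)"
  by (rule positiveI[OF self_adjoint_cfc[OF sa f]]) (use re in \<open>auto simp: spectrum_cfc[OF sa f]\<close>)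

lemma positive_self_adjoint_square:
  assumes sa: "self_adjoint a"
  shows "positive (a * a)"
proof -
  have "cfc (\<lambda>z. z * z) a = a * a"
    using cfc_mult[OF sa, of "\<lambda>z. z" "\<lambda>z. z"] cfc_id[OF sa] by simp
  moreover have "positive (cfc (\<lambda>z. z * z) a)"
  proof (rule positive_cfc[OF sa])
    fix z assume z: "z \<in> spectrum a"
    from self_adjoint_spectrum_eq_Re[OF sa z]
    show "z * z \<in> \<real> \<and> 0 \<le> Re (z * z)"
      by (metis Re_complex_of_real Reals_of_real of_real_mult zero_le_square)
  qed (intro continuous_intros)
  ultimately show ?thesis by simp
qed

lemma spectrum_mult_commute:
  fixes x y :: "'a::unital_cstar_algebra"
  assumes "c \<noteq> 0" "c \<in> spectrum (x * y)"
  shows "c \<in> spectrum (y * x)"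
proof (rule ccontr)
  assume "c \<notin> spectrum (y * x)"
  then have i: "has_inverse (c *\<^sub>C 1 - y * x)" by (simp add: spectrum_iff)
  define u where "u = cinv (c *\<^sub>C 1 - y * x)"
  have 1: "c *\<^sub>C u = 1 + y * (x * u)" "c *\<^sub>C u = 1 + u * (y * x)"
    using cinv[OF i] by (simp_all add: u_def algebra_simps)
  have 2: "c *\<^sub>C (u * y) = y + y * (x * (u * y))" "c *\<^sub>C (x * u) = x + x * (u * (y * x))"
    using arg_cong[OF 1(1), of "\<lambda>w. w * y"] arg_cong[OF 1(2), of "\<lambda>w. x * w"] by (simp_all add: algebra_simps)
  \<comment> \<open>The witness comes from rearranging the formal geometric series of (c - xy)^-1
    into c^-1 (1 + x (c - yx)^-1 y).\<close>
  have "(c *\<^sub>C 1 - x * y) * (inverse c *\<^sub>C (1 + x * u * y)) = inverse c *\<^sub>C (c *\<^sub>C 1 - x * y + x * (c *\<^sub>C (u * y)) - x * (y * (x * (u * y))))"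
    by (simp add: algebra_simps)
  also have "\<dots> = 1" unfolding 2 using assms(1) by (simp add: algebra_simps)
  finally have a: "(c *\<^sub>C 1 - x * y) * (inverse c *\<^sub>C (1 + x * u * y)) = 1" .
  have "(inverse c *\<^sub>C (1 + x * u * y)) * (c *\<^sub>C 1 - x * y) = inverse c *\<^sub>C (c *\<^sub>C 1 - x * y + (c *\<^sub>C (x * u)) * y - x * (u * (y * x)) * y)"
    by (simp add: algebra_simps)
  also have "\<dots> = 1" unfolding 2 using assms(1) by (simp add: algebra_simps)
  finally have "has_inverse (c *\<^sub>C 1 - x * y)" using a by (intro has_inverseI)
  with assms(2) show False by (simp add: spectrum_iff)
qed

text \<open>With self-adjoint parts \<open>h\<close> and \<open>k\<close> of \<open>y\<close>, the
  sum of \<open>adj y * y\<close> and \<open>y * adj y\<close> is twice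
  \<open>h * h + k * k\<close>, hence positive. The two products share their nonzero spectrum, so
  both are negative, and \<open>adj y * y\<close> turns out positive and negative at once.\<close>

lemma adj_mult_eq_0_if_negative:
  fixes y :: "'a::unital_cstar_algebra"
  assumes neg: "positive (- (adj y * y))"
  shows "y = 0"
proof -
  have neg': "positive (- (y * adj y))"
  proof (rule positiveI)
    show "self_adjoint (- (y * adj y))" by (simp add: self_adjoint_def adj_mult)
    fix c assume c: "c \<in> spectrum (- (y * adj y))"
    show "0 \<le> Re c"
    proof (cases "c = 0")
      case False
      have "c \<in> spectrum (adj y * (- y))"
        by (rule spectrum_mult_commute[OF False]) (use c in simp)
      then show ?thesis using positiveD[OF neg] by simp
    qed simp
  qed
  define h where "h = (1/2) *\<^sub>C (y + adj y)"
  define k where "k = (\<i>/2) *\<^sub>C (adj y - y)"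
  have sa: "self_adjoint h" "self_adjoint k"
    by (simp_all add: h_def k_def self_adjoint_def adj_scaleC adj_add adj_diff algebra_simps
        scaleC.scale_right_diff_distrib)
  have hk: "h * h + k * k = (1/2) *\<^sub>C (adj y * y) + (1/2) *\<^sub>C (y * adj y)"
  proof -
    have "h * h + k * k = (1/4) *\<^sub>C ((y + adj y) * (y + adj y)) + (- (1/4)) *\<^sub>C ((adj y - y) * (adj y - y))"
      by (simp add: h_def k_def)
    also have "\<dots> = (1/4) *\<^sub>C ((y + adj y) * (y + adj y) - (adj y - y) * (adj y - y))"
      by (simp only: scaleC.scale_minus_left scaleC.scale_right_diff_distrib add_uminus_conv_diff)
    also have "(y + adj y) * (y + adj y) - (adj y - y) * (adj y - y) = 2 *\<^sub>C (adj y * y) + 2 *\<^sub>C (y * adj y)"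
    proof -
      have "2 *\<^sub>C w = w + w" for w :: 'a
        using scaleC_add_left[of 1 1 w] by simp
      then show ?thesis by (simp add: algebra_simps)
    qed
    finally show ?thesis by (simp add: scaleC_add_right)
  qed
  have "adj y * y = 2 *\<^sub>R (h * h + k * k) + (- (y * adj y))"
    unfolding hk by (simp add: scaleR_scaleC scaleC_add_right)
  moreover have "positive (2 *\<^sub>R (h * h + k * k) + (- (y * adj y)))"
    using positive_self_adjoint_square[OF sa(1)] positive_self_adjoint_square[OF sa(2)] neg'
    by (intro positive_add positive_scaleR) auto
  ultimately have "positive (adj y * y)" by simp
  then have "adj y * y = 0" using neg by (rule positive_antisym)
  then show ?thesis using cstar_identity[of y] by simp
qed

text \<open>Let \<open>n\<close> be the negative part of \<open>x = adj b * b\<close>. Then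
  \<open>n * x * n\<close> equals both \<open>adj (b * n) * (b * n)\<close> and minus the cube of
  \<open>n\<close>, so the preceding lemma gives \<open>b * n = 0\<close>, which forces
  \<open>n = 0\<close>.\<close>

lemma positive_adj_mult:
  fixes b :: "'a::unital_cstar_algebra"
  shows "positive (adj b * b)"
proof -
  define x where "x = adj b * b"
  have sa: "self_adjoint x" by (simp add: x_def self_adjoint_def adj_mult)
  define f :: "complex \<Rightarrow> complex" where "f = (\<lambda>z. of_real (max 0 (- Re z)))"
  have f: "continuous_on A f" for A unfolding f_def by (intro continuous_intros)
  define n where "n = cfc f x"
  have nsa: "self_adjoint n" unfolding n_def
    by (rule self_adjoint_cfc[OF sa f]) (simp add: f_def)
  have xn: "x * n = - (n * n)"
  proof -
    have "x * n = cfc (\<lambda>z. z * f z) x"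
      using cfc_mult[OF sa continuous_on_id f] cfc_id[OF sa] by (simp add: n_def)
    also have "\<dots> = cfc (\<lambda>z. f z * (-1 * f z)) x"
    proof (rule cfc_cong[OF sa])
      fix z assume "z \<in> spectrum x"
      from self_adjoint_spectrum_eq_Re[OF sa this]
      show "z * f z = f z * (-1 * f z)"
        by (simp add: f_def max_def)
    qed (intro continuous_intros f)
    also have "\<dots> = - (n * n)"
    proof (rule cfc_eqI[OF sa])
      have "fc_rel x (\<lambda>z. f z * (-1 * f z)) (n * ((-1) *\<^sub>C n))"
        unfolding n_def by (intro fc_rel_mult fc_rel_scaleC fc_rel_cfc sa f)
      then show "fc_rel x (\<lambda>z. f z * (-1 * f z)) (- (n * n))" by simp
    qed (intro continuous_intros f)
    finally show ?thesis .
  qed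
  have n3: "n * n * n = cfc (\<lambda>z. f z * f z * f z) x"
    unfolding n_def by (simp add: cfc_mult[OF sa] f continuous_on_mult)
  have "positive (n * n * n)"
    unfolding n3 by (rule positive_cfc[OF sa]) (auto simp: f_def intro!: continuous_intros)
  moreover have "- (adj (b * n) * (b * n)) = n * n * n"
  proof -
    have "adj (b * n) * (b * n) = n * (x * n)"
      using nsa by (simp add: adj_mult self_adjoint_def x_def mult.assoc)
    then show ?thesis unfolding xn by (simp add: mult.assoc)
  qed
  ultimately have "positive (- (adj (b * n) * (b * n)))" by simp
  then have "b * n = 0" by (rule adj_mult_eq_0_if_negative)
  then have "x * n = 0" by (simp add: x_def mult.assoc)
  then have "norm (n * n) = 0" using xn by simp
  then have n0: "n = 0" using norm_self_adjoint_square[OF nsa] by simp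
  show ?thesis
  proof (rule positiveI)
    show "self_adjoint (adj b * b)" using sa by (simp add: x_def)
    fix c assume "c \<in> spectrum (adj b * b)"
    then have "f c \<in> spectrum n"
      unfolding n_def using spectrum_cfc[OF sa f] by (simp add: x_def)
    then have "f c = 0" using spectrum_norm_le[of "f c" n] n0 by simp
    then show "0 \<le> Re c" by (simp add: f_def max_def split: if_splits)
  qed
qed


section \<open>Powers of positive elements\<close>

abbreviation psqrt :: "'a::unital_cstar_algebra \<Rightarrow> 'a" where
  "psqrt a \<equiv> cpow a (1/2)"

lemma continuous_on_cpow:
  assumes "positive a" "r > 0"
  shows "continuous_on (spectrum a) (\<lambda>z. complex_of_real (Re z powr r))"
  using assms positiveD[OF assms(1)]
  by (intro continuous_on_of_real continuous_on_powr' continuous_intros) auto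

lemma spectrum_cpow:
  assumes "positive a" "r > 0"
  shows "spectrum (cpow a r) = (\<lambda>z. complex_of_real (Re z powr r)) ` spectrum a"
  unfolding cpow_def using assms by (intro spectrum_cfc continuous_on_cpow) auto

lemma positive_cpow [simp]: "positive a \<Longrightarrow> r > 0 \<Longrightarrow> positive (cpow a r)"
  unfolding cpow_def by (intro positive_cfc continuous_on_cpow) auto

lemma cpow_1 [simp]:
  assumes "positive a"
  shows "cpow a 1 = a"
proof -
  have sa: "self_adjoint a" using assms by auto
  have "cpow a 1 = cfc (\<lambda>z. z) a"
    unfolding cpow_def
  proof (rule cfc_cong[OF sa continuous_on_cpow])
    fix z assume z: "z \<in> spectrum a"
    show "complex_of_real (Re z powr 1) = z"
      using self_adjoint_spectrum_eq_Re[OF sa z] positiveD[OF assms z] by simp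
  qed (use assms in auto)
  then show ?thesis by (simp add: cfc_id[OF sa])
qed

lemma cpow_add:
  assumes "positive a" "r > 0" "s > 0"
  shows "cpow a r * cpow a s = cpow a (r + s)"
proof -
  have sa: "self_adjoint a" using assms by auto
  have "cpow a r * cpow a s = cfc (\<lambda>z. complex_of_real (Re z powr r) * complex_of_real (Re z powr s)) a"
    unfolding cpow_def using assms by (intro cfc_mult[symmetric] sa continuous_on_cpow)
  also have "(\<lambda>z. complex_of_real (Re z powr r) * complex_of_real (Re z powr s)) = (\<lambda>z. complex_of_real (Re z powr (r + s)))"
    by (simp add: powr_add fun_eq_iff)
  finally show ?thesis by (simp add: cpow_def)
qed

lemma cpow_cpow:
  assumes "positive a" "r > 0" "s > 0"
  shows "cpow (cpow a r) s = cpow a (r * s)"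
proof -
  have sa: "self_adjoint a" using assms by auto
  have "cpow (cpow a r) s = cfc (\<lambda>z. complex_of_real (Re (complex_of_real (Re z powr r)) powr s)) a"
    unfolding cpow_def[of a] unfolding cpow_def
  proof (rule cfc_compose[OF sa continuous_on_cpow])
    show "continuous_on ((\<lambda>z. complex_of_real (Re z powr r)) ` spectrum a) (\<lambda>z. complex_of_real (Re z powr s))"
      using continuous_on_cpow[of "cpow a r" s] assms by (simp add: spectrum_cpow)
  qed (use assms in auto)
  then show ?thesis by (simp add: powr_powr cpow_def)
qed

lemma psqrt_mult_self [simp]: "positive a \<Longrightarrow> psqrt a * psqrt a = a"
  by (simp add: cpow_add)

lemma positive_sandwich_adj:
  fixes c :: "'a::unital_cstar_algebra"
  assumes "positive a" shows "positive (adj c * a * c)"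
proof -
  have "adj c * a * c = adj c * (psqrt a * psqrt a) * c" using assms by simp
  also have "\<dots> = adj (psqrt a * c) * (psqrt a * c)"
    unfolding adj_mult using assms by (simp only: mult.assoc positive_adj positive_cpow half_gt_zero zero_less_one)
  finally show ?thesis using positive_adj_mult by metis
qed

lemma positive_sandwich:
  "self_adjoint s \<Longrightarrow> positive a \<Longrightarrow> positive (s * a * s)"
  using positive_sandwich_adj[of a s] by (simp add: self_adjoint_def)

text \<open>The spectrum of a power gives one inequality; applied to \<open>cpow a r\<close> with
  exponent \<open>1 / r\<close> it yields the other.\<close>

lemma norm_cpow:
  assumes "positive a" "r > 0"
  shows "norm (cpow a r) = norm a powr r"
proof -
  have le: "norm (cpow a r) \<le> norm a powr r" if a: "positive a" and r: "r > 0" for a :: 'a and r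
  proof -
    obtain c where c: "c \<in> spectrum (cpow a r)" "cmod c = norm (cpow a r)"
      using self_adjoint_norm_in_spectrum positive_cpow[OF a r] by blast
    then obtain z where z: "z \<in> spectrum a" "c = complex_of_real (Re z powr r)"
      by (auto simp: spectrum_cpow[OF a r])
    have "cmod c = Re z powr r" using z by simp
    also have "\<dots> \<le> norm a powr r"
      using positiveD[OF a z(1)] spectrum_norm_le[OF z(1)] complex_Re_le_cmod[of z] r
      by (intro powr_mono2) auto
    finally show ?thesis using c by simp
  qed
  have "norm a = norm (cpow (cpow a r) (1 / r))" using assms by (simp add: cpow_cpow)
  also have "\<dots> \<le> norm (cpow a r) powr (1 / r)" using assms by (intro le) auto
  finally have "norm a powr r \<le> (norm (cpow a r) powr (1 / r)) powr r"
    using assms by (intro powr_mono2) auto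
  also have "\<dots> = norm (cpow a r)" using assms by (simp add: powr_powr)
  finally show ?thesis using le[OF assms] by simp
qed

lemma norm_diamond:
  assumes "positive x" "positive y" "p > 0"
  shows "norm (diamond p x y) = norm (cpow x (p / 2) * cpow y p * cpow x (p / 2)) powr (1 / p)"
  unfolding diamond_def using assms
  by (intro norm_cpow positive_sandwich positive_cpow positive_self_adjoint) auto


section \<open>The order of the self-adjoint part\<close>

lemma cstar_le_0_iff: "cstar_le 0 a \<longleftrightarrow> positive a"
  by (simp add: cstar_le_def)

lemma cstar_le_refl [simp]: "cstar_le a a"
  by (simp add: cstar_le_def)

lemma cstar_le_trans [trans]: "cstar_le a b \<Longrightarrow> cstar_le b c \<Longrightarrow> cstar_le a c"
  using positive_add[of "b - a" "c - b"] by (simp add: cstar_le_def)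

lemma cstar_le_antisym: "cstar_le a b \<Longrightarrow> cstar_le b a \<Longrightarrow> a = b"
  using positive_antisym[of "b - a"] by (simp add: cstar_le_def)

lemma cstar_le_add: "cstar_le a b \<Longrightarrow> cstar_le c d \<Longrightarrow> cstar_le (a + c) (b + d)"
  using positive_add[of "b - a" "d - c"] by (simp add: cstar_le_def algebra_simps)

lemma cstar_le_add_right_iff [simp]: "cstar_le (a + c) (b + c) \<longleftrightarrow> cstar_le a b"
  by (simp add: cstar_le_def)

lemma cstar_le_add_left_iff [simp]: "cstar_le (c + a) (c + b) \<longleftrightarrow> cstar_le a b"
  by (simp add: cstar_le_def)

lemma cstar_le_scaleR: "cstar_le a b \<Longrightarrow> 0 \<le> r \<Longrightarrow> cstar_le (r *\<^sub>R a) (r *\<^sub>R b)"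
  using positive_scaleR[of "b - a" r] by (simp add: cstar_le_def scaleR_diff_right)

lemma cstar_le_scaleR_iff:
  assumes "r > 0"
  shows "cstar_le (r *\<^sub>R a) (r *\<^sub>R b) \<longleftrightarrow> cstar_le a b"
  using cstar_le_scaleR[of a b r] cstar_le_scaleR[of "r *\<^sub>R a" "r *\<^sub>R b" "inverse r"] assms by auto

lemma cstar_le_scaleR_left: "positive a \<Longrightarrow> r \<le> s \<Longrightarrow> cstar_le (r *\<^sub>R a) (s *\<^sub>R a)"
  using positive_scaleR[of a "s - r"] by (simp add: cstar_le_def scaleR_diff_left)

lemma cstar_le_sandwich: "self_adjoint s \<Longrightarrow> cstar_le a b \<Longrightarrow> cstar_le (s * a * s) (s * b * s)"
  using positive_sandwich[of s "b - a"] by (simp add: cstar_le_def algebra_simps)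

lemma cstar_le_sum:
  assumes "\<And>i. i \<in> I \<Longrightarrow> cstar_le (f i) (g i)"
  shows "cstar_le (sum f I) (sum g I)"
  using assms by (induction I rule: infinite_finite_induct) (auto intro: cstar_le_add)

lemma positive_mono: "positive a \<Longrightarrow> cstar_le a b \<Longrightarrow> positive b"
  using cstar_le_trans[of 0 a b] by (simp add: cstar_le_0_iff)

lemma cstar_le_norm:
  assumes "self_adjoint a"
  shows "cstar_le a (norm a *\<^sub>R 1)"
  unfolding cstar_le_def
proof (rule positiveI)
  show "self_adjoint (norm a *\<^sub>R 1 - a)" by (intro self_adjoint_diff self_adjoint_scaleR assms self_adjoint_1)
  fix c assume "c \<in> spectrum (norm a *\<^sub>R 1 - a)"
  then have "of_real (norm a) - c \<in> spectrum a" by (simp add: scaleR_scaleC spectrum_reflect)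
  from spectrum_norm_le[OF this] show "0 \<le> Re c"
    using abs_Re_le_cmod[of "of_real (norm a) - c"] by simp
qed

lemma cstar_le_scaleR_1_iff:
  assumes "positive a" "0 \<le> t"
  shows "cstar_le a (t *\<^sub>R 1) \<longleftrightarrow> norm a \<le> t"
proof
  assume le: "cstar_le a (t *\<^sub>R 1)"
  have sa: "self_adjoint a" using assms by auto
  obtain c where c: "c \<in> spectrum a" "cmod c = norm a" by (rule self_adjoint_norm_in_spectrum[OF sa])
  have "of_real t - c \<in> spectrum (t *\<^sub>R 1 - a)" using c(1) by (simp add: scaleR_scaleC spectrum_reflect)
  from positiveD[OF _ this] le have "Re c \<le> t" by (simp add: cstar_le_def)
  moreover have "cmod c = Re c"
    using self_adjoint_spectrum_eq_Re[OF sa c(1)] positiveD[OF assms(1) c(1)] by (metis abs_of_nonneg norm_of_real)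
  ultimately show "norm a \<le> t" using c(2) by simp
next
  assume "norm a \<le> t"
  with assms show "cstar_le a (t *\<^sub>R 1)"
    by (meson cstar_le_norm cstar_le_scaleR_left cstar_le_trans positive_1 positive_self_adjoint)
qed

lemma norm_mono:
  assumes "positive a" "cstar_le a b"
  shows "norm a \<le> norm b"
proof -
  have "positive b" by (rule positive_mono[OF assms])
  then have "cstar_le a (norm b *\<^sub>R 1)"
    using assms(2) cstar_le_norm cstar_le_trans by blast
  then show ?thesis using assms(1) by (simp add: cstar_le_scaleR_1_iff)
qed

lemma cstar_le_epsilon:
  assumes "\<And>e. e > 0 \<Longrightarrow> cstar_le a (b + e *\<^sub>R 1)"
  shows "cstar_le a b"
  unfolding cstar_le_def
proof (rule positiveI)
  \<comment> \<open>Self-adjointness is part of the order relation, so it can be read off from the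
    instance \<open>e = 1\<close>.\<close>
  have "self_adjoint (b + 1 *\<^sub>R 1 - a)" using assms[of 1] by (auto simp: cstar_le_def)
  then have "self_adjoint ((b + 1 *\<^sub>R 1 - a) - 1)" by (rule self_adjoint_diff) simp
  then show "self_adjoint (b - a)" by (simp add: algebra_simps)
  fix c assume c: "c \<in> spectrum (b - a)"
  have "- Re c \<le> 0"
  proof (rule field_le_epsilon)
    fix e :: real assume e: "e > 0"
    have "c + of_real e \<in> spectrum ((b - a) + of_real e *\<^sub>C 1)"
      using c by (simp add: spectrum_shift)
    then have "0 \<le> Re (c + of_real e)"
      using assms[OF e] positiveD unfolding cstar_le_def
      by (metis add_diff_eq add.commute scaleR_scaleC diff_add_eq)
    then show "- Re c \<le> 0 + e" by simp
  qed
  then show "0 \<le> Re c" by simp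
qed

lemma effects_iff: "a \<in> effects \<longleftrightarrow> positive a \<and> norm a \<le> 1"
  using cstar_le_scaleR_1_iff[of a 1] by (auto simp: effects_def cstar_le_0_iff)

lemma cpow_effects: "a \<in> effects \<Longrightarrow> r > 0 \<Longrightarrow> cpow a r \<in> effects"
  by (simp add: effects_iff norm_cpow powr_le1)

section \<open>Invertible positive elements\<close>

definition pos_inv :: "'a::unital_cstar_algebra \<Rightarrow> bool" where
  "pos_inv x \<longleftrightarrow> positive x \<and> has_inverse x"

lemma pos_invD [dest]: "pos_inv x \<Longrightarrow> positive x" "pos_inv x \<Longrightarrow> has_inverse x"
  by (simp_all add: pos_inv_def)

lemma pos_inv_1 [simp]: "pos_inv 1"
  by (simp add: pos_inv_def)

lemma pos_inv_scaleR: "pos_inv x \<Longrightarrow> r > 0 \<Longrightarrow> pos_inv (r *\<^sub>R x)"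
  by (auto simp: pos_inv_def)

lemma pos_inv_psqrt:
  assumes "pos_inv x"
  shows "pos_inv (psqrt x)"
proof -
  have "psqrt x * (psqrt x * cinv x) = 1" "(cinv x * psqrt x) * psqrt x = 1"
    using assms by (simp_all add: pos_inv_def cinv mult.assoc flip: mult.assoc[of "psqrt x" "psqrt x"])
  then have "has_inverse (psqrt x)" using left_right_inverse by blast
  then show ?thesis using assms by (simp add: pos_inv_def)
qed

lemma pos_inv_cinv:
  assumes "pos_inv x"
  shows "pos_inv (cinv x)"
proof -
  have s: "pos_inv (psqrt x)" using pos_inv_psqrt[OF assms] .
  then have "cinv x = cinv (psqrt x) * cinv (psqrt x)"
    using cinv_mult[of "psqrt x" "psqrt x"] assms by (auto simp: pos_inv_def)
  also have "\<dots> = adj (cinv (psqrt x)) * cinv (psqrt x)"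
    using s by (simp add: adj_cinv pos_inv_def)
  finally show ?thesis using positive_adj_mult assms by (metis has_inverse_cinv pos_inv_def)
qed

text \<open>With \<open>k = norm (cinv x)\<close>, conjugating \<open>cinv x \<le> k\<close> by the
  square root of \<open>x\<close> gives \<open>1 \<le> k x\<close>; the bound is the reciprocal of
  \<open>k\<close>.\<close>

lemma pos_inv_bounded_below:
  assumes "pos_inv x"
  obtains e where "e > 0" "cstar_le (e *\<^sub>R 1) x"
proof -
  define s where "s = psqrt x"
  have s: "pos_inv s" "s * s = x" using assms pos_inv_psqrt[OF assms] by (auto simp: s_def)
  have ix: "cinv x = cinv s * cinv s" using cinv_mult[of s s] s by auto
  let ?k = "norm (cinv x)"
  have k: "?k > 0" using has_inverse_cinv[of x] assms not_has_inverse_0 by (metis pos_inv_def zero_less_norm_iff)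
  have "cstar_le (s * cinv x * s) (s * (?k *\<^sub>R 1) * s)"
    using s(1) pos_inv_cinv[OF assms] by (intro cstar_le_sandwich cstar_le_norm) auto
  also have "s * cinv x * s = 1" using s(1) by (simp add: ix mult.assoc pos_inv_def cinv)
  also have "s * (?k *\<^sub>R 1) * s = ?k *\<^sub>R x" using s(2) by simp
  finally have "cstar_le (inverse ?k *\<^sub>R 1) (inverse ?k *\<^sub>R (?k *\<^sub>R x))"
    by (intro cstar_le_scaleR) auto
  then have "cstar_le (inverse ?k *\<^sub>R 1) x" using k by simp
  then show ?thesis using that[of "inverse ?k"] k by simp
qed

lemma pos_invI:
  assumes "e > 0" "cstar_le (e *\<^sub>R 1) x"
  shows "pos_inv x"
proof -
  have "positive x"
    using assms positive_mono[of "e *\<^sub>R 1" x] positive_scaleR[OF positive_1, of e] by simp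
  moreover have "0 \<notin> spectrum x"
  proof
    assume "0 \<in> spectrum x"
    then have "- of_real e \<in> spectrum (x - e *\<^sub>R 1)"
      using spectrum_shift[of "- of_real e" x "- of_real e"] by (simp add: scaleR_scaleC)
    from positiveD[OF _ this] show False using assms by (simp add: cstar_le_def)
  qed
  ultimately show ?thesis by (simp add: pos_inv_def has_inverse_iff_spectrum)
qed

lemma pos_inv_mono: "pos_inv x \<Longrightarrow> cstar_le x y \<Longrightarrow> pos_inv y"
  by (meson cstar_le_trans pos_invI pos_inv_bounded_below)

lemma pos_inv_add_positive: "pos_inv x \<Longrightarrow> positive y \<Longrightarrow> pos_inv (x + y)"
  using pos_inv_mono[of x "x + y"] by (simp add: cstar_le_def)

lemma pos_inv_sandwich: "pos_inv s \<Longrightarrow> pos_inv x \<Longrightarrow> pos_inv (s * x * s)"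
  by (auto simp: pos_inv_def intro: positive_sandwich)

lemma cstar_le_sandwich_iff:
  assumes "pos_inv s"
  shows "cstar_le (s * a * s) (s * b * s) \<longleftrightarrow> cstar_le a b"
proof
  assume "cstar_le (s * a * s) (s * b * s)"
  then have "cstar_le (cinv s * (s * a * s) * cinv s) (cinv s * (s * b * s) * cinv s)"
    by (rule cstar_le_sandwich[rotated]) (use pos_inv_cinv[OF assms] in auto)
  then show "cstar_le a b" using assms by (simp add: mult.assoc pos_inv_def cinv)
qed (use assms in \<open>auto intro: cstar_le_sandwich\<close>)

text \<open>Operator monotonicity of the square root. The hypothesis says that \<open>x * v\<close>
  with \<open>v = cinv y\<close> has norm at most 1; the self-adjoint element
  \<open>u * x * u\<close> with \<open>u * u = v\<close> has the same nonzero spectrum, so its norm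
  is at most 1 too.\<close>

lemma cstar_le_of_square_le:
  assumes x: "positive x" and y: "pos_inv y" and le: "cstar_le (x * x) (y * y)"
  shows "cstar_le x y"
proof -
  define v where "v = cinv y"
  have v: "pos_inv v" and vy: "v * y = 1" "y * v = 1"
    using y pos_inv_cinv[OF y] by (auto simp: v_def cinv)
  define u where "u = psqrt v"
  have u: "pos_inv u" "u * u = v" using v pos_inv_psqrt[OF v(1)] by (auto simp: u_def)
  have "cstar_le (v * (x * x) * v) (v * (y * y) * v)"
    using v le by (intro cstar_le_sandwich) auto
  also have "v * (y * y) * v = (v * y) * (y * v)" by (simp add: mult.assoc)
  also have "\<dots> = 1 *\<^sub>R 1" using vy by simp
  also have "v * (x * x) * v = adj (x * v) * (x * v)"
    using x v by (simp add: adj_mult pos_inv_def mult.assoc)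
  finally have "norm (adj (x * v) * (x * v)) \<le> 1"
    by (subst (asm) cstar_le_scaleR_1_iff[OF positive_adj_mult]) simp_all
  then have xv: "norm (x * v) \<le> 1" by (simp add: cstar_identity power2_le_imp_le abs_square_le_1)
  have pu: "positive (u * x * u)" using u x by (intro positive_sandwich) auto
  obtain c where c: "c \<in> spectrum (u * x * u)" "cmod c = norm (u * x * u)"
    using self_adjoint_norm_in_spectrum pu by blast
  have "norm (u * x * u) \<le> 1"
  proof (cases "c = 0")
    case True
    then show ?thesis using c by simp
  next
    case False
    have "c \<in> spectrum ((x * u) * u)"
      by (rule spectrum_mult_commute[OF False]) (use c(1) in \<open>simp add: mult.assoc\<close>)
    then show ?thesis using spectrum_norm_le[of c] xv c(2) by (fastforce simp: mult.assoc u(2))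
  qed
  then have "cstar_le (u * x * u) 1" using cstar_le_scaleR_1_iff[OF pu, of 1] by simp
  also have "1 = u * y * u"
  proof -
    have "u * y * u = u * (y * v) * cinv u" using u by (simp add: mult.assoc pos_inv_def cinv flip: u(2))
    then show ?thesis using u(1) vy by (simp add: pos_inv_def cinv)
  qed
  finally show ?thesis using u(1) by (simp add: cstar_le_sandwich_iff)
qed


section \<open>Homogeneous order isomorphisms of the open cone\<close>

text \<open>Closedness of the order in the form needed twice below, where \<open>c n\<close> is a
  root whose index tends to infinity.\<close>

lemma cstar_le_limit:
  assumes c: "c \<longlonglongrightarrow> 1" and le: "\<And>n::nat. cstar_le x (c n *\<^sub>R y)" and y: "positive y"
  shows "cstar_le x y"
proof (rule cstar_le_epsilon)
  fix e :: real assume e: "e > 0"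
  have "(\<lambda>n. (c n - 1) * norm y) \<longlonglongrightarrow> (1 - 1) * norm y" by (intro tendsto_intros c)
  then have "(\<lambda>n. (c n - 1) * norm y) \<longlonglongrightarrow> 0" by simp
  then have "\<forall>\<^sub>F n in sequentially. (c n - 1) * norm y < e" using e by (rule order_tendstoD)
  then obtain n where n: "(c n - 1) * norm y < e" by (auto simp: eventually_sequentially)
  have sa: "self_adjoint ((c n - 1) *\<^sub>R y)" using y by auto
  have "cstar_le ((c n - 1) *\<^sub>R y) (e *\<^sub>R 1)"
  proof (cases "c n \<ge> 1")
    case True
    then show ?thesis
      using cstar_le_norm[OF sa] n cstar_le_scaleR_left[OF positive_1, of "norm ((c n - 1) *\<^sub>R y)" e]
      by (auto intro: cstar_le_trans)
  next
    case False
    have "cstar_le ((c n - 1) *\<^sub>R y) (0 *\<^sub>R y)" using False y by (intro cstar_le_scaleR_left) auto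
    also have "0 *\<^sub>R y = 0 *\<^sub>R 1" by simp
    also have "cstar_le (0 *\<^sub>R 1) (e *\<^sub>R 1)" using e by (intro cstar_le_scaleR_left) auto
    finally show ?thesis .
  qed
  then have "cstar_le (y + (c n - 1) *\<^sub>R y) (y + e *\<^sub>R 1)" by simp
  moreover have "y + (c n - 1) *\<^sub>R y = c n *\<^sub>R y" by (simp add: scaleR_diff_left)
  ultimately show "cstar_le x (y + e *\<^sub>R 1)" using le[of n] cstar_le_trans by metis
qed

text \<open>Thompson's metric \<open>d(x, y) \<le> ln c\<close>, written multiplicatively.\<close>

definition thompson_le :: "real \<Rightarrow> 'a::unital_cstar_algebra \<Rightarrow> 'a \<Rightarrow> bool" where
  "thompson_le c x y \<longleftrightarrow> cstar_le x (c *\<^sub>R y) \<and> cstar_le y (c *\<^sub>R x)"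

lemma thompson_le_sym: "thompson_le c x y \<longleftrightarrow> thompson_le c y x"
  by (auto simp: thompson_le_def)

lemma thompson_le_trans:
  assumes "thompson_le c x y" "thompson_le d y z" "c > 0" "d > 0"
  shows "thompson_le (c * d) x z"
proof -
  have "cstar_le x (c *\<^sub>R (d *\<^sub>R z))"
    using assms by (meson cstar_le_scaleR cstar_le_trans less_imp_le thompson_le_def)
  moreover have "cstar_le z (d *\<^sub>R (c *\<^sub>R x))"
    using assms by (meson cstar_le_scaleR cstar_le_trans less_imp_le thompson_le_def)
  ultimately show ?thesis by (simp add: thompson_le_def mult.commute)
qed

text \<open>Invertibility bounds \<open>y\<close> below by some \<open>e\<close>, so a multiple of
  \<open>y\<close> exceeds \<open>norm x\<close>; the larger of the two constants serves both
  directions.\<close>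

lemma thompson_le_exists:
  assumes "pos_inv x" "pos_inv y"
  obtains c where "c > 0" "thompson_le c x y"
proof -
  have *: "\<exists>c>0. cstar_le x (c *\<^sub>R y)" if x: "pos_inv x" and y: "pos_inv y" for x y :: 'a
  proof -
    obtain e where e: "e > 0" "cstar_le (e *\<^sub>R 1) y" using pos_inv_bounded_below[OF y] by blast
    have "cstar_le x (norm x *\<^sub>R 1)" using x by (intro cstar_le_norm) auto
    also have "cstar_le (norm x *\<^sub>R 1) ((norm x + 1) *\<^sub>R 1)" by (intro cstar_le_scaleR_left) auto
    also have "(norm x + 1) *\<^sub>R 1 = ((norm x + 1) / e) *\<^sub>R (e *\<^sub>R 1 :: 'a)" using e by simp
    also have "cstar_le \<dots> (((norm x + 1) / e) *\<^sub>R y)" using e by (intro cstar_le_scaleR) auto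
    finally show ?thesis using e by (intro exI[of _ "(norm x + 1) / e"]) (simp add: add_nonneg_pos)
  qed
  obtain c d where c: "c > 0" "cstar_le x (c *\<^sub>R y)" and d: "d > 0" "cstar_le y (d *\<^sub>R x)"
    using *[OF assms] *[OF assms(2,1)] by blast
  have "cstar_le x (max c d *\<^sub>R y)"
    using c(2) cstar_le_scaleR_left[of y c "max c d"] assms cstar_le_trans by auto
  moreover have "cstar_le y (max c d *\<^sub>R x)"
    using d(2) cstar_le_scaleR_left[of x d "max c d"] assms cstar_le_trans by auto
  ultimately show ?thesis using that[of "max c d"] c by (simp add: thompson_le_def)
qed

lemma thompson_le_sandwich_iff:
  "pos_inv s \<Longrightarrow> thompson_le c (s * x * s) (s * y * s) \<longleftrightarrow> thompson_le c x y"
  using cstar_le_sandwich_iff[of s x "c *\<^sub>R y"] cstar_le_sandwich_iff[of s y "c *\<^sub>R x"]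
  by (simp add: thompson_le_def)

lemma thompson_le_1D: "thompson_le 1 x y \<Longrightarrow> x = y"
  by (auto simp: thompson_le_def intro: cstar_le_antisym)

text \<open>On invertible positive elements this is the point reflection at \<open>m\<close> in
  Thompson's geometry: an involution for which \<open>m\<close> is the geometric mean of
  \<open>x\<close> and its image.\<close>

definition reflection :: "'a::unital_cstar_algebra \<Rightarrow> 'a \<Rightarrow> 'a" where
  "reflection m x = m * cinv x * m"

lemma pos_inv_reflection [simp]: "pos_inv m \<Longrightarrow> pos_inv x \<Longrightarrow> pos_inv (reflection m x)"
  unfolding reflection_def by (intro pos_inv_sandwich pos_inv_cinv)

lemma reflection_reflection [simp]:
  assumes "pos_inv m" "pos_inv x"
  shows "reflection m (reflection m x) = x"
proof -
  have i: "has_inverse m" "has_inverse x" using assms by auto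
  then have "cinv (m * cinv x * m) = cinv m * (x * cinv m)"
    by (simp add: cinv_mult has_inverse_mult mult.assoc)
  then show ?thesis using i by (simp add: reflection_def mult.assoc cinv)
qed

lemma reflection_self [simp]: "pos_inv m \<Longrightarrow> reflection m m = m"
  by (simp add: reflection_def mult.assoc cinv pos_invD)

lemma reflection_scaleR:
  "pos_inv x \<Longrightarrow> r > 0 \<Longrightarrow> reflection m (r *\<^sub>R x) = inverse r *\<^sub>R reflection m x"
  by (simp add: reflection_def cinv_scaleR pos_invD)

section \<open>Inversion reverses the order; reflections preserve Thompson's metric\<close>

lemma psqrt_cinv_sandwich:
  assumes "pos_inv x"
  shows "psqrt (cinv x) * x * psqrt (cinv x) = 1"
proof -
  define r where "r = psqrt (cinv x)"
  have r: "has_inverse r" "r * r = cinv x"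
    using pos_inv_psqrt[OF pos_inv_cinv[OF assms]] pos_inv_cinv[OF assms] by (auto simp: r_def)
  have "x = cinv (r * r)" using r(2) assms by auto
  also have "\<dots> = cinv r * cinv r" using r(1) by (simp add: cinv_mult)
  finally have x: "x = cinv r * cinv r" .
  have "r * x * r = 1" unfolding x using r(1) by (simp add: mult.assoc cinv)
  then show ?thesis by (simp add: r_def)
qed

lemma psqrt_sandwich_cinv:
  assumes "pos_inv x"
  shows "psqrt x * cinv x * psqrt x = 1"
  using psqrt_cinv_sandwich[OF pos_inv_cinv[OF assms]] assms by auto

lemma cinv_le_1:
  assumes w: "pos_inv w" and le: "cstar_le 1 w"
  shows "cstar_le (cinv w) 1"
proof -
  have q: "self_adjoint (psqrt (cinv w))" using pos_inv_psqrt[OF pos_inv_cinv[OF w]] by auto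
  have "psqrt (cinv w) * 1 * psqrt (cinv w) = cinv w" using pos_inv_cinv[OF w] by auto
  then show ?thesis using cstar_le_sandwich[OF q le] psqrt_cinv_sandwich[OF w] by simp
qed

text \<open>Conjugating by the inverse square root of \<open>x\<close> reduces the claim to a
  comparison with 1.\<close>

lemma cinv_antimono:
  assumes x: "pos_inv x" and le: "cstar_le x y"
  shows "cstar_le (cinv y) (cinv x)"
proof -
  have y: "pos_inv y" using pos_inv_mono[OF x le] .
  define r where "r = psqrt (cinv x)"
  have r: "pos_inv r" "r * r = cinv x"
    using pos_inv_psqrt[OF pos_inv_cinv[OF x]] pos_inv_cinv[OF x] by (auto simp: r_def)
  have "cstar_le (r * x * r) (r * y * r)" using r(1) le by (intro cstar_le_sandwich) auto
  then have "cstar_le 1 (r * y * r)" using psqrt_cinv_sandwich[OF x] by (simp add: r_def)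
  then have le1: "cstar_le (cinv (r * y * r)) 1" by (intro cinv_le_1 pos_inv_sandwich r y)
  have ir: "has_inverse r" "has_inverse y" using r y by auto
  have "r * cinv (r * y * r) * r = cinv y"
    using ir by (simp add: cinv_mult has_inverse_mult mult.assoc cinv)
  moreover have "r * 1 * r = cinv x" using r by simp
  ultimately show ?thesis using cstar_le_sandwich[OF _ le1, of r] r(1) by auto
qed

lemma reflection_le_iff:
  assumes "pos_inv m" "pos_inv x" "pos_inv y"
  shows "cstar_le (reflection m x) (reflection m y) \<longleftrightarrow> cstar_le y x"
proof -
  have *: "cstar_le (reflection m x) (reflection m y)" if "cstar_le y x" "pos_inv y" for x y
    unfolding reflection_def using assms(1) that by (intro cstar_le_sandwich cinv_antimono) auto
  show ?thesis
    using *[of y x] *[of "reflection m x" "reflection m y"] assms by auto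
qed

text \<open>A reflection reverses the order and inverts scalars, so it merely exchanges the two
  inequalities in \<open>thompson_le\<close>.\<close>

lemma thompson_le_reflection_iff:
  assumes "pos_inv m" "pos_inv x" "pos_inv y" "c > 0"
  shows "thompson_le c (reflection m x) (reflection m y) \<longleftrightarrow> thompson_le c x y"
proof -
  have *: "cstar_le (reflection m x) (c *\<^sub>R reflection m y) \<longleftrightarrow> cstar_le y (c *\<^sub>R x)"
    if "pos_inv x" "pos_inv y" for x y
  proof -
    have "c *\<^sub>R reflection m y = reflection m (inverse c *\<^sub>R y)"
      using that assms by (simp add: reflection_scaleR)
    then have "cstar_le (reflection m x) (c *\<^sub>R reflection m y) \<longleftrightarrow> cstar_le (inverse c *\<^sub>R y) x"
      using that assms by (simp add: reflection_le_iff pos_inv_scaleR)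
    also have "\<dots> \<longleftrightarrow> cstar_le y (c *\<^sub>R x)"
      using cstar_le_scaleR_iff[of c "inverse c *\<^sub>R y" x] assms by simp
    finally show ?thesis .
  qed
  show ?thesis using *[of x y] *[of y x] assms by (auto simp: thompson_le_def)
qed

text \<open>The reflection satisfies \<open>d(\<psi> x, x) = 2 d(x, m)\<close>; this drives the Mazur--Ulam argument.\<close>

lemma thompson_le_reflection_halve:
  assumes m: "pos_inv m" and x: "pos_inv x" and c: "c > 0"
    and le: "thompson_le c (reflection m x) x"
  shows "thompson_le (sqrt c) x m"
proof -
  define s where "s = psqrt m"
  have s: "pos_inv s" "has_inverse s" "s * s = m" using pos_inv_psqrt[OF m] m by (auto simp: s_def)
  \<comment> \<open>Moves \<open>m\<close> to 1, where the reflection becomes plain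
    inversion.\<close>
  define y where "y = cinv s * x * cinv s"
  have y: "pos_inv y" "has_inverse y" unfolding y_def using pos_inv_sandwich[OF pos_inv_cinv[OF s(1)] x] by auto
  have xy: "x = s * y * s" using s by (simp add: y_def mult.assoc cinv)
  have "reflection m x = s * cinv y * s"
    unfolding reflection_def xy s(3)[symmetric] using s(2) y(2)
    by (simp add: cinv_mult has_inverse_mult mult.assoc cinv)
  then have ly: "thompson_le c (cinv y) y"
    using le thompson_le_sandwich_iff[OF s(1)] by (simp add: xy)
  \<comment> \<open>Conjugating by \<open>t\<close> turns the comparison of \<open>cinv y\<close>
    with \<open>y\<close> into one of \<open>1\<close> with \<open>y * y\<close>; monotonicity of
    the square root then replaces \<open>c\<close> by \<open>sqrt c\<close>.\<close>
  define t where "t = psqrt y"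
  have t: "pos_inv t" "t * t = y" using pos_inv_psqrt[OF y(1)] y by (auto simp: t_def)
  have tt: "t * cinv y * t = 1" unfolding t_def by (rule psqrt_sandwich_cinv[OF y(1)])
  have tyt: "t * y * t = y * y" unfolding t(2)[symmetric] by (simp add: mult.assoc)
  have sq: "(sqrt c *\<^sub>R w) * (sqrt c *\<^sub>R w) = c *\<^sub>R (w * w)" for w :: 'a
    using c by simp
  have "thompson_le c 1 (y * y)" using ly thompson_le_sandwich_iff[OF t(1), of c "cinv y" y] tt tyt by simp
  then have le: "cstar_le (1 * 1) ((sqrt c *\<^sub>R y) * (sqrt c *\<^sub>R y))"
    "cstar_le (y * y) ((sqrt c *\<^sub>R 1) * (sqrt c *\<^sub>R 1))"
    unfolding sq by (simp_all add: thompson_le_def)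
  have pi: "pos_inv (sqrt c *\<^sub>R y)" "pos_inv (sqrt c *\<^sub>R (1 :: 'a))"
    using y c by (simp_all add: pos_inv_scaleR)
  have "cstar_le 1 (sqrt c *\<^sub>R y)" by (rule cstar_le_of_square_le[OF positive_1 pi(1) le(1)])
  moreover have "cstar_le y (sqrt c *\<^sub>R 1)"
    by (rule cstar_le_of_square_le[OF pos_invD(1)[OF y(1)] pi(2) le(2)])
  ultimately have "thompson_le (sqrt c) y 1" by (simp add: thompson_le_def)
  then have "thompson_le (sqrt c) (s * y * s) (s * 1 * s)" by (simp only: thompson_le_sandwich_iff[OF s(1)])
  then show ?thesis using s by (simp add: xy)
qed

section \<open>Isometries of Thompson's metric and the Mazur-Ulam argument\<close>

definition thompson_isometry :: "('a::unital_cstar_algebra \<Rightarrow> 'b::unital_cstar_algebra) \<Rightarrow> bool" where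
  "thompson_isometry g \<longleftrightarrow> bij_betw g (Collect pos_inv) (Collect pos_inv) \<and>
     (\<forall>x y. \<forall>c>0. pos_inv x \<longrightarrow> pos_inv y \<longrightarrow> (thompson_le c (g x) (g y) \<longleftrightarrow> thompson_le c x y))"

lemma thompson_isometry_pos_inv: "thompson_isometry g \<Longrightarrow> pos_inv x \<Longrightarrow> pos_inv (g x)"
  unfolding thompson_isometry_def bij_betw_def by blast

lemma thompson_isometryD:
  "thompson_isometry g \<Longrightarrow> pos_inv x \<Longrightarrow> pos_inv y \<Longrightarrow> c > 0 \<Longrightarrow>
    thompson_le c (g x) (g y) \<longleftrightarrow> thompson_le c x y"
  unfolding thompson_isometry_def by blast

lemma thompson_isometry_comp:
  fixes f :: "'a::unital_cstar_algebra \<Rightarrow> 'b::unital_cstar_algebra"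
    and g :: "'b \<Rightarrow> 'c::unital_cstar_algebra"
  assumes "thompson_isometry f" "thompson_isometry g"
  shows "thompson_isometry (\<lambda>x. g (f x))"
  unfolding thompson_isometry_def
proof (intro conjI allI impI)
  show "bij_betw (\<lambda>x. g (f x)) (Collect pos_inv) (Collect pos_inv)"
    using assms bij_betw_trans[of f _ _ g] unfolding thompson_isometry_def comp_def by blast
  fix x y :: 'a and c :: real assume "c > 0" "pos_inv x" "pos_inv y"
  then show "thompson_le c (g (f x)) (g (f y)) \<longleftrightarrow> thompson_le c x y"
    using assms by (simp add: thompson_isometryD thompson_isometry_pos_inv)
qed

lemma thompson_isometry_inv:
  fixes g :: "'a::unital_cstar_algebra \<Rightarrow> 'b::unital_cstar_algebra"
  assumes "thompson_isometry g"
  shows "thompson_isometry (inv_into (Collect pos_inv) g)"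
    and "pos_inv x \<Longrightarrow> inv_into (Collect pos_inv) g (g x) = x"
    and "pos_inv y \<Longrightarrow> g (inv_into (Collect pos_inv) g y) = y"
proof -
  let ?h = "inv_into (Collect pos_inv) g"
  have b: "bij_betw g (Collect pos_inv) (Collect pos_inv)"
    using assms by (simp add: thompson_isometry_def)
  show "pos_inv x \<Longrightarrow> ?h (g x) = x" using bij_betw_inv_into_left[OF b] by simp
  show r: "pos_inv y \<Longrightarrow> g (?h y) = y" for y using bij_betw_inv_into_right[OF b] by simp
  have p: "pos_inv (?h y)" if "pos_inv y" for y
    using bij_betw_inv_into[OF b] that by (auto simp: bij_betw_def)
  show "thompson_isometry ?h"
    unfolding thompson_isometry_def
  proof (intro conjI allI impI)
    show "bij_betw ?h (Collect pos_inv) (Collect pos_inv)" by (rule bij_betw_inv_into[OF b])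
    fix x y :: 'b and c :: real assume "c > 0" "pos_inv x" "pos_inv y"
    then show "thompson_le c (?h x) (?h y) \<longleftrightarrow> thompson_le c x y"
      using thompson_isometryD[OF assms p p, of x y c] r by simp
  qed
qed

lemma thompson_isometry_reflection:
  assumes "pos_inv m"
  shows "thompson_isometry (reflection m)"
  unfolding thompson_isometry_def
proof (intro conjI allI impI)
  show "bij_betw (reflection m) (Collect pos_inv) (Collect pos_inv)"
    by (rule bij_betwI[where g = "reflection m"]) (use assms in auto)
qed (use assms in \<open>simp add: thompson_le_reflection_iff\<close>)

text \<open>Let \<open>\<psi>\<close> be the reflection at \<open>m\<close> and \<open>h\<close> the
  inverse of \<open>g\<close>. The map sending \<open>x\<close> to
  \<open>\<psi> (h (\<psi> (g x)))\<close> again fixes \<open>a\<close> and \<open>b\<close>, and it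
  moves \<open>m\<close> by the distance from \<open>\<psi> (g m)\<close> to \<open>g m\<close>,
  twice the displacement under \<open>g\<close>. A displacement bound valid for all such maps can
  thus be halved indefinitely.\<close>

lemma mazur_ulam_fixed_midpoint:
  fixes g :: "'a::unital_cstar_algebra \<Rightarrow> 'a"
  assumes m: "pos_inv m" and a: "pos_inv a" and b: "b = reflection m a"
    and g: "thompson_isometry g" "g a = a" "g b = b"
  shows "g m = m"
proof -
  define \<psi> where "\<psi> = reflection m"
  have \<psi>: "thompson_isometry \<psi>" "\<psi> a = b" "\<psi> b = a" "\<psi> m = m"
    and pb: "pos_inv b"
    using m a b by (simp_all add: \<psi>_def thompson_isometry_reflection)
  obtain c0 where c0: "c0 > 0" "thompson_le c0 a m" using thompson_le_exists[OF a m] .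
  \<comment> \<open>The start \<open>c0 * c0\<close> is the triangle inequality through
    \<open>a\<close>, which \<open>g\<close> fixes; it does not depend on \<open>g\<close>, so the
    induction can range over all such maps.\<close>
  have bound: "thompson_le (root (2 ^ n) (c0 * c0)) (g m) m"
    if "thompson_isometry g" "g a = a" "g b = b" for g :: "'a \<Rightarrow> 'a" and n :: nat
    using that
  proof (induction n arbitrary: g)
    case 0
    have "thompson_le c0 (g m) (g a)"
      using thompson_isometryD[OF 0(1) m a c0(1)] c0(2) thompson_le_sym by blast
    then show ?case using thompson_le_trans[OF _ c0(2) c0(1) c0(1)] 0 by simp
  next
    case (Suc n)
    let ?c = "root (2 ^ n) (c0 * c0)"
    have c: "?c > 0" using c0 by simp
    define h where "h = inv_into (Collect pos_inv) g"
    have h: "thompson_isometry h" "h a = a" "h b = b"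
      using thompson_isometry_inv(1)[OF Suc.prems(1)] thompson_isometry_inv(2)[OF Suc.prems(1) a]
        thompson_isometry_inv(2)[OF Suc.prems(1) pb] Suc.prems by (simp_all add: h_def)
    have gm: "pos_inv (g m)" using thompson_isometry_pos_inv[OF Suc.prems(1) m] .
    have p1: "pos_inv (\<psi> (g m))" using m gm by (simp add: \<psi>_def)
    have p2: "pos_inv (h (\<psi> (g m)))" by (rule thompson_isometry_pos_inv[OF h(1) p1])
    have gh: "g (h (\<psi> (g m))) = \<psi> (g m)"
      using thompson_isometry_inv(3)[OF Suc.prems(1) p1] by (simp add: h_def)
    have "thompson_isometry (\<lambda>x. \<psi> (h (\<psi> (g x))))"
      by (intro thompson_isometry_comp[of "\<lambda>x. h (\<psi> (g x))" \<psi>] thompson_isometry_comp[of "\<lambda>x. \<psi> (g x)" h]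
          thompson_isometry_comp[of g \<psi>] Suc.prems h \<psi>)
    then have "thompson_le ?c (\<psi> (h (\<psi> (g m)))) m"
      by (rule Suc.IH) (simp_all add: Suc.prems h \<psi>)
    then have "thompson_le ?c (\<psi> (h (\<psi> (g m)))) (\<psi> m)" by (simp add: \<psi>)
    then have "thompson_le ?c (h (\<psi> (g m))) m"
      by (simp only: thompson_isometryD[OF \<psi>(1) p2 m c])
    then have "thompson_le ?c (g (h (\<psi> (g m)))) (g m)"
      by (simp only: thompson_isometryD[OF Suc.prems(1) p2 m c])
    then have "thompson_le ?c (\<psi> (g m)) (g m)" by (simp add: gh)
    then have "thompson_le (sqrt ?c) (g m) m"
      unfolding \<psi>_def by (rule thompson_le_reflection_halve[OF m gm c])
    moreover have "sqrt ?c = root (2 ^ Suc n) (c0 * c0)"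
      by (simp add: sqrt_def real_root_mult_exp)
    ultimately show ?case by simp
  qed
  have "(\<lambda>n. root n (c0 * c0)) \<longlonglongrightarrow> 1" using c0 by (intro LIMSEQ_root_const) simp
  moreover have "filterlim (\<lambda>n. (2::nat) ^ n) at_top sequentially"
    by (intro filterlim_subseq strict_monoI power_strict_increasing) auto
  ultimately have lim: "(\<lambda>n. root (2 ^ n) (c0 * c0)) \<longlonglongrightarrow> 1" by (rule filterlim_compose)
  have pg: "positive (g m)" using thompson_isometry_pos_inv[OF g(1) m] by auto
  show ?thesis
  proof (rule cstar_le_antisym)
    show "cstar_le (g m) m"
      by (rule cstar_le_limit[OF lim]) (use bound[OF g] m in \<open>auto simp: thompson_le_def\<close>)
    show "cstar_le m (g m)"
      by (rule cstar_le_limit[OF lim]) (use bound[OF g] pg in \<open>auto simp: thompson_le_def\<close>)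
  qed
qed

text \<open>The witness is the geometric mean of \<open>a\<close> and \<open>b\<close>: conjugation
  by the inverse root of \<open>a\<close> moves \<open>a\<close> to 1 and \<open>b\<close> to
  \<open>w\<close>, and the midpoint of 1 and \<open>w\<close> is the square root of
  \<open>w\<close>.\<close>

lemma midpoint_exists:
  assumes a: "pos_inv a" and b: "pos_inv b"
  obtains m where "pos_inv m" "reflection m a = b"
proof -
  define s where "s = psqrt a"
  have s: "pos_inv s" "has_inverse s" "s * s = a" using pos_inv_psqrt[OF a] a by (auto simp: s_def)
  define w where "w = cinv s * b * cinv s"
  have w: "pos_inv w" unfolding w_def by (intro pos_inv_sandwich pos_inv_cinv s b)
  define r where "r = psqrt w"
  have r: "pos_inv r" "r * r = w" using pos_inv_psqrt[OF w] w by (auto simp: r_def)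
  have "reflection (s * r * s) a = s * (r * r) * s"
    unfolding reflection_def s(3)[symmetric] using s(2)
    by (simp add: cinv_mult mult.assoc)
  also have "\<dots> = b" using s(2) by (simp add: r w_def mult.assoc cinv)
  finally show ?thesis using that[of "s * r * s"] pos_inv_sandwich[OF s(1) r(1)] by blast
qed

section \<open>Binomial expansion, powers and roots of inequalities\<close>

lemma binomial_one_plus:
  fixes z :: "'a::real_algebra_1"
  shows "(1 + z) ^ n = (\<Sum>k\<le>n. real (n choose k) *\<^sub>R z ^ k)"
proof (induction n)
  case (Suc n)
  let ?f = "\<lambda>k. real (n choose k) *\<^sub>R z ^ k"
  have "(\<Sum>k\<le>Suc n. real (Suc n choose k) *\<^sub>R z ^ k)
      = 1 + (\<Sum>k\<le>n. real (Suc n choose Suc k) *\<^sub>R z ^ Suc k)"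
    by (subst sum.atMost_Suc_shift) simp
  also have "(\<Sum>k\<le>n. real (Suc n choose Suc k) *\<^sub>R z ^ Suc k) = (\<Sum>k\<le>n. z * ?f k) + (\<Sum>k\<le>n. ?f (Suc k))"
    by (simp add: scaleR_add_left sum.distrib)
  also have "1 + ((\<Sum>k\<le>n. z * ?f k) + (\<Sum>k\<le>n. ?f (Suc k))) = (\<Sum>k\<le>n. z * ?f k) + (\<Sum>k\<le>Suc n. ?f k)"
    using sum.atMost_Suc_shift[of ?f n] by (simp del: sum.atMost_Suc)
  also have "(\<Sum>k\<le>Suc n. ?f k) = (\<Sum>k\<le>n. ?f k)" by simp
  finally show ?case
    unfolding power_Suc Suc.IH distrib_right by (simp only: mult_1_left sum_distrib_left add.commute)
qed simp

lemma pos_inv_power: "pos_inv z \<Longrightarrow> pos_inv (z ^ n)"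
proof (induction n rule: less_induct)
  case (less n)
  consider "n = 0" | "n = 1" | k where "n = Suc (Suc k)" by (metis One_nat_def not0_implies_Suc)
  then show ?case
  proof cases
    case 3
    then have "z ^ n = z * z ^ k * z" by (simp add: power_commutes mult.assoc)
    then show ?thesis using less 3 pos_inv_sandwich[of z "z ^ k"] by simp
  qed (use less in simp_all)
qed

text \<open>Monotonicity has been established for square roots, so the root is taken by repeated
  halving of the exponent; hence the exponents \<open>2 ^ n\<close>.\<close>

lemma cstar_le_root:
  assumes "pos_inv x" "pos_inv y" "c > 0" "cstar_le (x ^ (2 ^ n)) (c *\<^sub>R y ^ (2 ^ n))"
  shows "cstar_le x (root (2 ^ n) c *\<^sub>R y)"
  using assms(3,4)
proof (induction n arbitrary: c)
  case (Suc n)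
  have sq: "w ^ (2 ^ Suc n) = w ^ (2 ^ n) * w ^ (2 ^ n)" for w :: 'a
    by (simp add: mult_2 flip: power_add)
  have "cstar_le (x ^ (2 ^ n) * x ^ (2 ^ n)) ((sqrt c *\<^sub>R y ^ (2 ^ n)) * (sqrt c *\<^sub>R y ^ (2 ^ n)))"
    using Suc.prems unfolding sq by simp
  then have "cstar_le (x ^ (2 ^ n)) (sqrt c *\<^sub>R y ^ (2 ^ n))"
    by (rule cstar_le_of_square_le[rotated 2])
      (use Suc.prems pos_inv_power[OF assms(1)] pos_inv_power[OF assms(2)] in \<open>auto intro: pos_inv_scaleR\<close>)
  then have "cstar_le x (root (2 ^ n) (sqrt c) *\<^sub>R y)" using Suc.prems by (intro Suc.IH) auto
  then show ?case by (simp add: sqrt_def real_root_mult_exp mult.commute[of 2])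
qed simp

lemma positive_sum: "(\<And>i. i \<in> I \<Longrightarrow> positive (f i)) \<Longrightarrow> positive (sum f I)"
  using cstar_le_sum[of I "\<lambda>_. 0" f] by (simp add: cstar_le_0_iff)

section \<open>Unital homogeneous order isomorphisms are additive\<close>

locale unital_cone_iso =
  fixes T :: "'a::unital_cstar_algebra \<Rightarrow> 'b::unital_cstar_algebra"
  assumes bij: "bij_betw T (Collect pos_inv) (Collect pos_inv)"
    and le_iff: "\<And>x y. pos_inv x \<Longrightarrow> pos_inv y \<Longrightarrow> cstar_le (T x) (T y) \<longleftrightarrow> cstar_le x y"
    and scaleR: "\<And>r x. r > 0 \<Longrightarrow> pos_inv x \<Longrightarrow> T (r *\<^sub>R x) = r *\<^sub>R T x"
    and one [simp]: "T 1 = 1"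
begin

lemma pos_inv [simp]: "pos_inv x \<Longrightarrow> pos_inv (T x)"
  using bij by (auto simp: bij_betw_def)

lemma inv_T:
  "pos_inv x \<Longrightarrow> inv_into (Collect pos_inv) T (T x) = x"
  "pos_inv y \<Longrightarrow> T (inv_into (Collect pos_inv) T y) = y"
  "pos_inv y \<Longrightarrow> pos_inv (inv_into (Collect pos_inv) T y)"
  using bij_betw_inv_into_left[OF bij] bij_betw_inv_into_right[OF bij] bij_betw_inv_into[OF bij]
  by (auto simp: bij_betw_def)

lemma isometry: "thompson_isometry T"
  unfolding thompson_isometry_def
proof (intro conjI allI impI bij)
  fix x y :: 'a and c :: real assume "c > 0" "pos_inv x" "pos_inv y"
  then show "thompson_le c (T x) (T y) \<longleftrightarrow> thompson_le c x y"
    using le_iff[of x "c *\<^sub>R y"] le_iff[of y "c *\<^sub>R x"]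
    by (simp add: thompson_le_def scaleR pos_inv_scaleR)
qed

text \<open>Take a midpoint \<open>m'\<close> of \<open>T a\<close> and \<open>T b\<close> in the
  target. Applying \<open>T\<close>, the reflection at \<open>m'\<close>, the inverse of
  \<open>T\<close> and the reflection at \<open>m\<close> in turn fixes \<open>a\<close> and
  \<open>b\<close>, hence \<open>m\<close>. So the reflection at \<open>m'\<close> fixes
  \<open>T m\<close>, and its only fixed point is \<open>m'\<close>.\<close>

lemma reflection:
  assumes m: "pos_inv m" and a: "pos_inv a"
  shows "T (reflection m a) = reflection (T m) (T a)"
proof -
  define b where "b = reflection m a"
  have b: "pos_inv b" using m a by (simp add: b_def)
  obtain m' where m': "pos_inv m'" "reflection m' (T a) = T b"
    using midpoint_exists[of "T a" "T b"] a b by auto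
  define h where "h = inv_into (Collect pos_inv) T"
  define g where "g = (\<lambda>x. reflection m (h (reflection m' (T x))))"
  have h: "thompson_isometry h" "\<And>x. pos_inv x \<Longrightarrow> h (T x) = x" "\<And>y. pos_inv y \<Longrightarrow> T (h y) = y"
      "\<And>y. pos_inv y \<Longrightarrow> pos_inv (h y)"
    using thompson_isometry_inv(1)[OF isometry] inv_T by (simp_all add: h_def)
  have "thompson_isometry g"
    unfolding g_def
    by (intro thompson_isometry_comp[of "\<lambda>x. h (reflection m' (T x))" "reflection m"]
        thompson_isometry_comp[of "\<lambda>x. reflection m' (T x)" h] thompson_isometry_comp[of T "reflection m'"]
        isometry h thompson_isometry_reflection m m')
  moreover have "g a = a" using m a b by (simp add: g_def m' h(2)) (simp add: b_def)
  moreover have "g b = b"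
  proof -
    have "reflection m' (T b) = T a" using m' a by (metis pos_inv reflection_reflection)
    then show ?thesis using a by (simp add: g_def h(2) b_def)
  qed
  ultimately have "g m = m" by (rule mazur_ulam_fixed_midpoint[OF m a b_def])
  define y where "y = reflection m' (T m)"
  have y: "pos_inv y" using m m' by (simp add: y_def)
  have "reflection m (h y) = m" using \<open>g m = m\<close> by (simp add: g_def y_def)
  then have "h y = m" using m h(4)[OF y] by (metis reflection_reflection reflection_self)
  then have "y = T m" using h(3)[OF y] by simp
  then have "thompson_le 1 (reflection m' (T m)) (T m)" by (simp add: y_def thompson_le_def)
  from thompson_le_reflection_halve[OF m'(1) _ _ this] have "T m = m'"
    using m by (simp add: thompson_le_1D)
  then show ?thesis using m' by (simp add: b_def)
qed

text \<open>Reflecting 1 at \<open>m\<close> gives \<open>m * m\<close>. Reflecting at 1 gives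
  inverses, and reflecting \<open>cinv a\<close> at \<open>m\<close> gives \<open>m * a * m\<close>,
  which are the next two laws.\<close>

lemma square: "pos_inv m \<Longrightarrow> T (m * m) = T m * T m"
  using reflection[of m 1] by (simp add: reflection_def)

lemma map_cinv: "pos_inv a \<Longrightarrow> T (cinv a) = cinv (T a)"
  using reflection[of 1 a] by (simp add: reflection_def)

lemma sandwich: "pos_inv m \<Longrightarrow> pos_inv a \<Longrightarrow> T (m * a * m) = T m * T a * T m"
  using reflection[of m "cinv a"] by (simp add: reflection_def map_cinv pos_inv_cinv pos_invD)

text \<open>\<open>T\<close> is not known to be multiplicative, so the exponent drops by two at a
  time through \<open>sandwich\<close>.\<close>

lemma power: "pos_inv z \<Longrightarrow> T (z ^ n) = T z ^ n"
proof (induction n rule: less_induct)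
  case (less n)
  consider "n = 0" | "n = 1" | k where "n = Suc (Suc k)" by (metis One_nat_def not0_implies_Suc)
  then show ?case
  proof cases
    case 3
    then have *: "w ^ n = w * w ^ k * w" for w :: "'c::monoid_mult" by (simp add: power_commutes mult.assoc)
    show ?thesis unfolding * using less 3 by (simp add: sandwich pos_inv_power)
  qed (use less in simp_all)
qed

text \<open>
  Each term of the binomial expansion of \<open>(1 + z)\<^sup>n\<close> is dominated by the whole sum, so
  \<open>(1 + T z)\<^sup>n \<le> (n + 1) T(1 + z)\<^sup>n\<close>; taking \<open>n\<close>-th roots makes the factor \<open>n + 1\<close> disappear.
\<close>

lemma superadditive_one:
  assumes z: "pos_inv z"
  shows "cstar_le (1 + T z) (T (1 + z))"
proof -
  have p: "pos_inv (1 + z)" "pos_inv (1 + T z)"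
    using z pos_inv[OF z] by (auto intro!: pos_inv_add_positive simp del: pos_inv)
  have bin: "cstar_le ((1 + T z) ^ n) (real (n + 1) *\<^sub>R T (1 + z) ^ n)" for n
  proof -
    have le: "cstar_le (real (n choose k) *\<^sub>R T z ^ k) (T (1 + z) ^ n)" if k: "k \<le> n" for k
    proof -
      let ?f = "\<lambda>k. real (n choose k) *\<^sub>R z ^ k"
      have "(1 + z) ^ n - ?f k = sum ?f ({..n} - {k})"
        unfolding binomial_one_plus using k by (simp add: sum_diff1)
      moreover have "positive (sum ?f ({..n} - {k}))"
        by (intro positive_sum positive_scaleR pos_invD(1) pos_inv_power z) simp
      ultimately have "cstar_le (?f k) ((1 + z) ^ n)" by (simp add: cstar_le_def)
      then have "cstar_le (T (?f k)) (T ((1 + z) ^ n))"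
        using k z p(1) by (subst le_iff) (simp_all add: pos_inv_scaleR pos_inv_power)
      then show ?thesis using k z p(1) by (simp add: power scaleR pos_inv_power)
    qed
    have "cstar_le (\<Sum>k\<le>n. real (n choose k) *\<^sub>R T z ^ k) (\<Sum>k\<le>n. T (1 + z) ^ n)"
      using le by (intro cstar_le_sum) simp
    also have "(\<Sum>k\<le>n. T (1 + z) ^ n) = real (n + 1) *\<^sub>R T (1 + z) ^ n"
      by (subst sum_constant_scaleR) simp
    finally show ?thesis by (simp only: binomial_one_plus)
  qed
  have root: "cstar_le (1 + T z) (root (2 ^ n) (real (2 ^ n + 1)) *\<^sub>R T (1 + z))" for n
    by (rule cstar_le_root[OF p(2) pos_inv[OF p(1)] _ bin]) (simp add: add_pos_pos)
  have lim: "(\<lambda>n. root n (real (n + 1))) \<longlonglongrightarrow> 1"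
  \<comment> \<open>The upper bound comes from \<open>n + 1 \<le> 2 * n\<close>, which holds from
    \<open>n = 1\<close> on.\<close>
  proof (rule tendsto_sandwich[where f = "\<lambda>_. 1" and h = "\<lambda>n. root n 2 * root n (real n)"])
    have "(\<lambda>n. root n 2 * root n (real n)) \<longlonglongrightarrow> 1 * 1"
      by (intro tendsto_mult LIMSEQ_root LIMSEQ_root_const) simp
    then show "(\<lambda>n. root n 2 * root n (real n)) \<longlonglongrightarrow> 1" by simp
    show "\<forall>\<^sub>F n in sequentially. root n (real (n + 1)) \<le> root n 2 * root n (real n)"
      by (rule eventually_sequentiallyI[of 1]) (simp flip: real_root_mult)
    show "\<forall>\<^sub>F n in sequentially. 1 \<le> root n (real (n + 1))"
      by (rule eventually_sequentiallyI[of 1]) simp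
  qed simp
  have "filterlim (\<lambda>n. (2::nat) ^ n) at_top sequentially"
    by (intro filterlim_subseq strict_monoI power_strict_increasing) auto
  from filterlim_compose[OF lim this] have "(\<lambda>n. root (2 ^ n) (real (2 ^ n + 1))) \<longlonglongrightarrow> 1" .
  from cstar_le_limit[OF this root] show ?thesis using pos_inv[OF p(1)] by blast
qed

lemma inverse: "unital_cone_iso (inv_into (Collect pos_inv) T)" (is "unital_cone_iso ?S")
proof
  show "bij_betw ?S (Collect pos_inv) (Collect pos_inv)" by (rule bij_betw_inv_into[OF bij])
  fix x y :: 'b assume "pos_inv x" "pos_inv y"
  then show "cstar_le (?S x) (?S y) \<longleftrightarrow> cstar_le x y" using le_iff[of "?S x" "?S y"] by (simp add: inv_T)
next
  fix r :: real and x :: 'b assume r: "r > 0" "pos_inv x"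
  then have "?S (T (r *\<^sub>R ?S x)) = r *\<^sub>R ?S x" by (intro inv_T pos_inv_scaleR)
  then show "?S (r *\<^sub>R x) = r *\<^sub>R ?S x" using r by (simp add: scaleR inv_T)
next
  show "?S 1 = 1" using inv_T(1)[of 1] by simp
qed

lemma add_one:
  assumes z: "pos_inv z"
  shows "T (1 + z) = 1 + T z"
proof (rule cstar_le_antisym)
  let ?S = "inv_into (Collect pos_inv) T"
  show "cstar_le (1 + T z) (T (1 + z))" by (rule superadditive_one[OF z])
  have p: "pos_inv (1 + z)" "pos_inv (1 + T z)"
    using z pos_inv[OF z] by (auto intro!: pos_inv_add_positive simp del: pos_inv)
  have "cstar_le (1 + ?S (T z)) (?S (1 + T z))"
    using unital_cone_iso.superadditive_one[OF inverse, of "T z"] z by simp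
  then have "cstar_le (1 + z) (?S (1 + T z))" using z by (simp add: inv_T)
  then have "cstar_le (T (1 + z)) (T (?S (1 + T z)))" using p by (subst le_iff) (simp_all only: inv_T)
  then show "cstar_le (T (1 + z)) (1 + T z)" using p by (simp add: inv_T)
qed

lemma add:
  assumes x: "pos_inv x" and y: "pos_inv y"
  shows "T (x + y) = T x + T y"
proof -
  define s where "s = psqrt x"
  have s: "pos_inv s" "has_inverse s" "s * s = x" using pos_inv_psqrt[OF x] x by (auto simp: s_def)
  define z where "z = cinv s * y * cinv s"
  have z: "pos_inv z" unfolding z_def by (intro pos_inv_sandwich pos_inv_cinv s y)
  have p: "pos_inv (1 + z)" using z by (auto intro!: pos_inv_add_positive)
  have y': "y = s * z * s" using s(2) by (simp add: z_def mult.assoc cinv)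
  have "x + y = s * (1 + z) * s" using s(3) by (simp add: y' algebra_simps)
  then have "T (x + y) = T s * (1 + T z) * T s" using s(1) p z by (simp add: sandwich add_one)
  also have "\<dots> = T s * T s + T s * T z * T s" by (simp add: algebra_simps)
  also have "\<dots> = T x + T y" using s(1) z square[OF s(1)] by (simp add: s(3) y' sandwich)
  finally show ?thesis .
qed

end


section \<open>Jordan $*$-isomorphisms\<close>

definition re_part :: "'a::unital_cstar_algebra \<Rightarrow> 'a" where
  "re_part x = (1/2) *\<^sub>C (x + adj x)"

definition im_part :: "'a::unital_cstar_algebra \<Rightarrow> 'a" where
  "im_part x = (- \<i> / 2) *\<^sub>C (x - adj x)"

lemma self_adjoint_parts [simp]: "self_adjoint (re_part x)" "self_adjoint (im_part x)"
  by (simp_all add: self_adjoint_def re_part_def im_part_def adj_add adj_diff adj_scaleC add.commute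
      scaleC.scale_right_diff_distrib)

lemma re_im_decomp: "re_part x + \<i> *\<^sub>C im_part x = x"
proof -
  have "re_part x + \<i> *\<^sub>C im_part x = (1/2 + 1/2) *\<^sub>C x"
    unfolding scaleC_add_left by (simp add: re_part_def im_part_def scaleC_add_right scaleC.scale_right_diff_distrib)
  then show ?thesis by simp
qed

lemma re_im_unique:
  assumes "self_adjoint h" "self_adjoint k"
  shows "re_part (h + \<i> *\<^sub>C k) = h" "im_part (h + \<i> *\<^sub>C k) = k"
proof -
  have a: "adj (h + \<i> *\<^sub>C k) = h - \<i> *\<^sub>C k"
    using assms by (simp add: self_adjoint_def adj_add adj_scaleC)
  have "re_part (h + \<i> *\<^sub>C k) = (1/2 + 1/2) *\<^sub>C h"
    unfolding re_part_def a scaleC_add_left by (simp add: scaleC_add_right scaleC.scale_right_diff_distrib)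
  then show "re_part (h + \<i> *\<^sub>C k) = h" by simp
  have "im_part (h + \<i> *\<^sub>C k) = (1/2 + 1/2) *\<^sub>C k"
    unfolding im_part_def a scaleC_add_left by (simp add: scaleC_add_right scaleC.scale_right_diff_distrib)
  then show "im_part (h + \<i> *\<^sub>C k) = k" by simp
qed

lemma norm_parts_le: "norm (re_part x) \<le> norm x" "norm (im_part x) \<le> norm x"
  using norm_triangle_ineq[of x "adj x"] norm_triangle_ineq4[of x "adj x"]
  by (simp_all add: re_part_def im_part_def norm_scaleC norm_divide)

lemma jordan_prod_self [simp]: "jordan_prod x x = x * x"
  by (simp add: jordan_prod_def flip: scaleR_2)

lemma jordan_star_isomorphism_inv:
  assumes "jordan_star_isomorphism J"
  shows "jordan_star_isomorphism (inv J)"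
proof -
  have b: "bij J" and J: "\<And>x y. J (x + y) = J x + J y" "\<And>c x. J (c *\<^sub>C x) = c *\<^sub>C J x"
    "\<And>x y. J (jordan_prod x y) = jordan_prod (J x) (J y)" "\<And>x. J (adj x) = adj (J x)"
    using assms by (auto simp: jordan_star_isomorphism_def)
  have [simp]: "J (inv J y) = y" "inv J (J x) = x" for x y
    using b by (simp_all add: bij_is_inj bij_is_surj surj_f_inv_f)
  have e: "inv J y = x \<longleftrightarrow> y = J x" for x y by auto
  show ?thesis unfolding jordan_star_isomorphism_def
    using bij_imp_bij_inv[OF b] by (simp add: e J)
qed

section \<open>Jordan isomorphisms preserve spectra, self-adjoint norms and powers\<close>

locale jordan_iso =
  fixes J :: "'a::unital_cstar_algebra \<Rightarrow> 'b::unital_cstar_algebra"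
  assumes iso: "jordan_star_isomorphism J"
begin

lemma bij: "bij J" and add: "J (x + y) = J x + J y" and scaleC: "J (c *\<^sub>C x) = c *\<^sub>C J x"
  and jordan: "J (jordan_prod x y) = jordan_prod (J x) (J y)" and map_adj: "J (adj x) = adj (J x)"
  using iso by (auto simp: jordan_star_isomorphism_def)

lemma scaleR: "J (r *\<^sub>R x) = r *\<^sub>R J x"
  by (simp add: scaleR_scaleC scaleC)

lemma diff: "J (x - y) = J x - J y"
  using add[of x "- y"] scaleR[of "-1" y] by simp

lemma anticommutator: "J (x * y + y * x) = J x * J y + J y * J x"
proof -
  have "2 *\<^sub>R J (jordan_prod x y) = 2 *\<^sub>R jordan_prod (J x) (J y)" by (simp add: jordan)
  then show ?thesis by (simp add: jordan_prod_def scaleR)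
qed

lemma square: "J (x * x) = J x * J x"
  using jordan[of x x] by simp

text \<open>Surjectivity gives \<open>u\<close> with \<open>J u = 1\<close>; the anticommutator of
  \<open>u\<close> and 1 then reads \<open>2 J 1 = 2\<close>.\<close>

lemma one: "J 1 = 1"
proof -
  obtain u where u: "J u = 1" using bij by (metis bij_pointE)
  have "J u * J 1 + J 1 * J u = J u + J u"
    using anticommutator[of u 1] by (simp add: add)
  then have "2 *\<^sub>R J 1 = 2 *\<^sub>R 1" by (simp add: u scaleR_2)
  then show ?thesis by simp
qed

text \<open>The triple product is a Jordan expression: twice \<open>x * y * x\<close> is the
  anticommutator with \<open>x\<close> applied twice to \<open>y\<close>, minus the anticommutator
  of \<open>x * x\<close> with \<open>y\<close>.\<close>

lemma sandwich: "J (x * y * x) = J x * J y * J x"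
proof -
  have "x * (x * y + y * x) + (x * y + y * x) * x - ((x * x) * y + y * (x * x)) = 2 *\<^sub>R (x * y * x)"
    by (simp add: algebra_simps scaleR_2)
  then have "2 *\<^sub>R J (x * y * x) = J (x * (x * y + y * x) + (x * y + y * x) * x) - J ((x * x) * y + y * (x * x))"
    by (simp flip: scaleR diff)
  also have "\<dots> = J x * (J x * J y + J y * J x) + (J x * J y + J y * J x) * J x - ((J x * J x) * J y + J y * (J x * J x))"
    by (simp only: anticommutator square)
  also have "\<dots> = 2 *\<^sub>R (J x * J y * J x)" by (simp add: algebra_simps scaleR_2)
  finally show ?thesis by simp
qed

text \<open>Applying \<open>sandwich\<close> to \<open>a * (cinv a * cinv a) * a = 1\<close> gives a
  triple product equal to 1, whose two bracketings display a left and a right inverse of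
  \<open>J a\<close>.\<close>

lemma has_inverse:
  assumes a: "has_inverse a" shows "has_inverse (J a)"
proof (rule left_right_inverse)
  have "J (a * (cinv a * cinv a) * a) = 1" using a by (simp add: cinv mult.assoc one)
  then have *: "J a * J (cinv a * cinv a) * J a = 1" by (simp only: sandwich)
  show "(J a * J (cinv a * cinv a)) * J a = 1" using * .
  show "J a * (J (cinv a * cinv a) * J a) = 1" using * by (simp only: mult.assoc)
qed

lemma spectrum_eq: "spectrum (J a) = spectrum a"
proof -
  interpret inv: jordan_iso "inv J" by unfold_locales (rule jordan_star_isomorphism_inv[OF iso])
  have [simp]: "inv J (J x) = x" for x using bij by (simp add: bij_is_inj)
  have "has_inverse (c *\<^sub>C 1 - J a) \<longleftrightarrow> has_inverse (c *\<^sub>C 1 - a)" for c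
    using has_inverse[of "c *\<^sub>C 1 - a"] inv.has_inverse[of "J (c *\<^sub>C 1 - a)"]
    by (auto simp: diff scaleC one inv.diff inv.scaleC inv.one)
  then show ?thesis by (auto simp: spectrum_iff)
qed

lemma self_adjoint: "self_adjoint a \<Longrightarrow> self_adjoint (J a)"
  by (metis map_adj self_adjoint_def)

lemma positive: "positive a \<Longrightarrow> positive (J a)"
  using self_adjoint by (simp add: positive_def spectrum_eq)

lemma norm_self_adjoint:
  assumes a: "self_adjoint a"
  shows "norm (J a) = norm a"
proof (rule antisym)
  obtain c where "c \<in> spectrum (J a)" "cmod c = norm (J a)"
    by (rule self_adjoint_norm_in_spectrum[OF self_adjoint[OF a]])
  then show "norm (J a) \<le> norm a" using spectrum_norm_le spectrum_eq by metis
  obtain c where "c \<in> spectrum a" "cmod c = norm a" by (rule self_adjoint_norm_in_spectrum[OF a])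
  then show "norm a \<le> norm (J a)" using spectrum_norm_le spectrum_eq by metis
qed

text \<open>The spectrum controls \<open>J\<close> on self-adjoint elements, and splitting into two
  of them costs the factor 2; any constant would do for carrying limits through \<open>J\<close> in
  \<open>map_fc_rel\<close>.\<close>

lemma norm_le: "norm (J x) \<le> 2 * norm x"
proof -
  have "J x = J (re_part x) + \<i> *\<^sub>C J (im_part x)"
    using re_im_decomp[of x] by (metis add scaleC)
  then have "norm (J x) \<le> norm (J (re_part x)) + norm (J (im_part x))"
    using norm_triangle_ineq[of "J (re_part x)" "\<i> *\<^sub>C J (im_part x)"] by (simp add: norm_scaleC)
  then show ?thesis
    using norm_parts_le[of x] by (simp add: norm_self_adjoint)
qed

text \<open>\<open>J\<close> need not be multiplicative, but \<open>a\<close> commutes with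
  \<open>peval a p\<close>, so their anticommutator is twice their product.\<close>

lemma map_peval: "J (peval a p) = peval (J a) p"
proof (induction p)
  case 0
  show ?case using scaleR[of 0 0] by simp
next
  case (pCons c p)
  have comm: "peval b p * b = b * peval b p" for b :: "'c::unital_cstar_algebra"
    using peval_mult[of b "[:0, 1:]" p] peval_mult[of b p "[:0, 1:]"] by (simp add: mult.commute)
  have "2 *\<^sub>R J (a * peval a p) = J (a * peval a p + peval a p * a)"
    by (simp add: comm add scaleR_2)
  also have "\<dots> = 2 *\<^sub>R (J a * peval (J a) p)"
    unfolding anticommutator pCons.IH by (simp only: comm scaleR_2)
  finally show ?case by (simp add: add scaleC one)
qed

lemma map_fc_rel:
  assumes r: "fc_rel a f b"
  shows "fc_rel (J a) f (J b)"
  unfolding fc_rel_def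
proof (intro allI impI)
  fix \<epsilon> :: real assume \<epsilon>: "\<epsilon> > 0"
  then obtain p where p: "\<And>z. z \<in> spectrum a \<Longrightarrow> cmod (f z - poly p z) \<le> \<epsilon> / 2" "norm (b - peval a p) \<le> \<epsilon> / 2"
    using fc_relD[OF r, of "\<epsilon> / 2"] by auto
  have "norm (J b - peval (J a) p) \<le> \<epsilon>"
    using norm_le[of "b - peval a p"] p(2) by (simp add: diff map_peval)
  moreover have "cmod (f z - poly p z) \<le> \<epsilon>" if "z \<in> spectrum (J a)" for z
    using p(1)[of z] that \<epsilon> by (simp add: spectrum_eq)
  ultimately show "\<exists>p. (\<forall>z\<in>spectrum (J a). cmod (f z - poly p z) \<le> \<epsilon>) \<and> norm (J b - peval (J a) p) \<le> \<epsilon>"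
    by blast
qed

lemma map_cpow:
  assumes a: "positive a" and r: "r > 0"
  shows "J (cpow a r) = cpow (J a) r"
  unfolding cpow_def
  using assms positive[OF a]
  by (intro cfc_eqI[symmetric] map_fc_rel fc_rel_cfc continuous_on_cpow) auto

lemma norm_diamond_eq:
  assumes x: "positive x" and y: "positive y" and p: "p > 0"
  shows "norm (diamond p (J x) (J y)) = norm (diamond p x y)"
proof -
  have "positive (cpow x (p / 2) * cpow y p * cpow x (p / 2))"
    using assms by (intro positive_sandwich positive_self_adjoint positive_cpow) auto
  then have "norm (J (cpow x (p / 2) * cpow y p * cpow x (p / 2))) = norm (cpow x (p / 2) * cpow y p * cpow x (p / 2))"
    by (intro norm_self_adjoint) auto
  then show ?thesis
    using assms positive[OF x] positive[OF y] by (simp add: norm_diamond sandwich map_cpow)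
qed

end


text \<open>The complex-linear extension acts on real and imaginary parts; polarizing the square law
  gives anticommutators of self-adjoint elements, and these determine those of arbitrary
  ones.\<close>

lemma jordan_extension:
  fixes L :: "'a::unital_cstar_algebra \<Rightarrow> 'b::unital_cstar_algebra"
  assumes bij: "bij_betw L (Collect self_adjoint) (Collect self_adjoint)"
    and add: "\<And>h k. self_adjoint h \<Longrightarrow> self_adjoint k \<Longrightarrow> L (h + k) = L h + L k"
    and scaleR: "\<And>r h. self_adjoint h \<Longrightarrow> L (r *\<^sub>R h) = r *\<^sub>R L h"
    and square: "\<And>h. self_adjoint h \<Longrightarrow> L (h * h) = L h * L h"
  obtains J where "jordan_star_isomorphism J" "\<And>h. self_adjoint h \<Longrightarrow> J h = L h"
proof
  define J where "J = (\<lambda>x. L (re_part x) + \<i> *\<^sub>C L (im_part x))"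
  have sa: "self_adjoint (L h)" if "self_adjoint h" for h
    using bij that by (auto simp: bij_betw_def)
  have J: "J (h + \<i> *\<^sub>C k) = L h + \<i> *\<^sub>C L k" if "self_adjoint h" "self_adjoint k" for h k
    using that by (simp add: J_def re_im_unique)
  have L0: "L 0 = 0" using scaleR[of 0 0] by simp
  have diff: "L (h - k) = L h - L k" if "self_adjoint h" "self_adjoint k" for h k
    using add[OF that(1) self_adjoint_scaleR[OF that(2)], of "-1"] scaleR[OF that(2), of "-1"] by simp
  show JL: "J h = L h" if "self_adjoint h" for h
    using J[OF that, of 0] L0 by simp
  have anti_sa: "self_adjoint (h * k + k * h)" if "self_adjoint h" "self_adjoint k" for h k :: 'a
    using that by (simp add: self_adjoint_def adj_add adj_mult add.commute)
  have anti: "L (h * k + k * h) = L h * L k + L k * L h" if h: "self_adjoint h" and k: "self_adjoint k" for h k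
  proof -
    have sq: "self_adjoint (h * h)" "self_adjoint (k * k)"
      using h k by (simp_all add: self_adjoint_def adj_mult)
    have "(h + k) * (h + k) = (h * h + k * k) + (h * k + k * h)" by (simp add: algebra_simps)
    then have "L h * L h + L k * L k + L (h * k + k * h) = (L h + L k) * (L h + L k)"
      using square[OF self_adjoint_add[OF h k]] h k sq anti_sa[OF h k]
      by (simp add: add self_adjoint_add square)
    then show ?thesis by (simp add: algebra_simps)
  qed
  have J_add: "J (x + y) = J x + J y" for x y
  proof -
    have "x + y = (re_part x + re_part y) + \<i> *\<^sub>C (im_part x + im_part y)"
      using re_im_decomp[of x] re_im_decomp[of y] by (simp add: scaleC_add_right algebra_simps)
    then have "J (x + y) = L (re_part x + re_part y) + \<i> *\<^sub>C L (im_part x + im_part y)"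
      using J[of "re_part x + re_part y" "im_part x + im_part y"] by (simp add: self_adjoint_add)
    then show ?thesis by (simp add: add J_def scaleC_add_right)
  qed
  have J_scaleR: "J (r *\<^sub>R x) = r *\<^sub>R J x" for r x
  proof -
    have "r *\<^sub>R x = r *\<^sub>R re_part x + \<i> *\<^sub>C (r *\<^sub>R im_part x)"
      using arg_cong[OF re_im_decomp[of x], of "scaleR r"] by (simp add: scaleR_scaleC scaleC_add_right mult.commute)
    then have "J (r *\<^sub>R x) = L (r *\<^sub>R re_part x) + \<i> *\<^sub>C L (r *\<^sub>R im_part x)"
      using J[of "r *\<^sub>R re_part x" "r *\<^sub>R im_part x"] by (simp add: self_adjoint_scaleR)
    also have "\<dots> = r *\<^sub>R L (re_part x) + \<i> *\<^sub>C (r *\<^sub>R L (im_part x))" by (simp add: scaleR)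
    also have "\<dots> = r *\<^sub>R J x" by (simp add: J_def scaleR_scaleC scaleC_add_right mult.commute)
    finally show ?thesis .
  qed
  have J_ii: "J (\<i> *\<^sub>C x) = \<i> *\<^sub>C J x" for x
  proof -
    have "\<i> *\<^sub>C x = (-1) *\<^sub>R im_part x + \<i> *\<^sub>C re_part x"
      using arg_cong[OF re_im_decomp[of x], of "scaleC \<i>"] by (simp add: scaleC_add_right add.commute)
    then have "J (\<i> *\<^sub>C x) = L ((-1) *\<^sub>R im_part x) + \<i> *\<^sub>C L (re_part x)"
      using J[of "(-1) *\<^sub>R im_part x" "re_part x"] self_adjoint_scaleR[of "im_part x" "-1"] by simp
    then show ?thesis by (simp add: scaleR[of _ "-1", simplified] J_def scaleC_add_right add.commute)
  qed
  have J_scaleC: "J (c *\<^sub>C x) = c *\<^sub>C J x" for c x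
  proof -
    have c: "c *\<^sub>C w = Re c *\<^sub>R w + Im c *\<^sub>R (\<i> *\<^sub>C w)" for w :: "'c::unital_cstar_algebra"
      by (subst complex_eq[of c]) (simp add: scaleC_add_left scaleR_scaleC mult.commute)
    show ?thesis unfolding c by (simp add: J_add J_scaleR J_ii)
  qed
  have anti_J: "J (x * y + y * x) = J x * J y + J y * J x" for x y
  proof -
    define h k u v where "h = re_part x" and "k = im_part x" and "u = re_part y" and "v = im_part y"
    have s: "self_adjoint h" "self_adjoint k" "self_adjoint u" "self_adjoint v"
      by (simp_all add: h_def k_def u_def v_def)
    have x: "x = h + \<i> *\<^sub>C k" and y: "y = u + \<i> *\<^sub>C v"
      by (simp_all add: h_def k_def u_def v_def re_im_decomp)
    have e: "(h + \<i> *\<^sub>C k) * (u + \<i> *\<^sub>C v) + (u + \<i> *\<^sub>C v) * (h + \<i> *\<^sub>C k)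
      = ((h * u + u * h) - (k * v + v * k)) + \<i> *\<^sub>C ((h * v + v * h) + (k * u + u * k))" for h k u v :: "'c::unital_cstar_algebra"
      by (simp add: algebra_simps scaleC_add_right)
    have "J (x * y + y * x) = L ((h * u + u * h) - (k * v + v * k)) + \<i> *\<^sub>C L ((h * v + v * h) + (k * u + u * k))"
      unfolding x y e by (intro J self_adjoint_add self_adjoint_diff anti_sa s)
    also have "\<dots> = (L h + \<i> *\<^sub>C L k) * (L u + \<i> *\<^sub>C L v) + (L u + \<i> *\<^sub>C L v) * (L h + \<i> *\<^sub>C L k)"
      unfolding e using s by (simp only: add diff anti anti_sa)
    finally show ?thesis by (simp add: x y J s)
  qed
  show "jordan_star_isomorphism J"
    unfolding jordan_star_isomorphism_def
  proof (intro conjI allI J_add J_scaleC)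
    show "J (jordan_prod x y) = jordan_prod (J x) (J y)" for x y
      by (simp add: jordan_prod_def J_scaleR anti_J)
    show "J (adj x) = adj (J x)" for x
    proof -
      have "adj x = re_part x + \<i> *\<^sub>C ((-1) *\<^sub>R im_part x)"
        using arg_cong[OF re_im_decomp[of x], of adj] self_adjoint_parts[of x]
        by (simp add: adj_add adj_scaleC self_adjoint_def)
      then have "J (adj x) = L (re_part x) + \<i> *\<^sub>C L ((-1) *\<^sub>R im_part x)"
        using J[of "re_part x" "(-1) *\<^sub>R im_part x"] self_adjoint_scaleR[of "im_part x" "-1"] by simp
      also have "L ((-1) *\<^sub>R im_part x) = - L (im_part x)" by (simp only: scaleR self_adjoint_parts) simp
      also have "L (re_part x) + \<i> *\<^sub>C - L (im_part x) = adj (J x)"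
        using sa[OF self_adjoint_parts(1)[of x]] sa[OF self_adjoint_parts(2)[of x]]
        by (simp add: J_def adj_add adj_scaleC self_adjoint_def)
      finally show ?thesis .
    qed
    have inj: "inj J"
    proof (rule injI)
      fix x y assume "J x = J y"
      then have "L (re_part x) = L (re_part y)" "L (im_part x) = L (im_part y)"
        unfolding J_def using re_im_unique sa self_adjoint_parts by metis+
      then have "re_part x = re_part y" "im_part x = im_part y"
        using bij by (simp_all add: bij_betw_def inj_on_def)
      then show "x = y" using re_im_decomp by metis
    qed
    have "\<exists>x. J x = y" for y
    proof -
      have "re_part y \<in> L ` Collect self_adjoint" "im_part y \<in> L ` Collect self_adjoint"
        using bij by (simp_all add: bij_betw_def)
      then obtain h k where "self_adjoint h" "self_adjoint k" "L h = re_part y" "L k = im_part y"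
        by auto
      then have "J (h + \<i> *\<^sub>C k) = y" by (simp add: J re_im_decomp)
      then show ?thesis ..
    qed
    then show "bij J" using inj by (metis bijI surjI surj_def)
  qed
qed


section \<open>Effect algebra maps preserving the norm of the sequential product\<close>

lemma cstar_le_iff_norm_sandwich:
  assumes x: "positive x" and y: "positive y"
  shows "cstar_le x y \<longleftrightarrow> (\<forall>z\<in>effects. norm (psqrt z * x * psqrt z) \<le> norm (psqrt z * y * psqrt z))"
proof (intro iffI ballI)
  fix z :: 'a assume "cstar_le x y" "z \<in> effects"
  then have "self_adjoint (psqrt z)"
    using positive_self_adjoint[OF positive_cpow[of z "1/2"]] by (simp add: effects_iff)
  then show "norm (psqrt z * x * psqrt z) \<le> norm (psqrt z * y * psqrt z)"
    using \<open>cstar_le x y\<close> x by (intro norm_mono positive_sandwich cstar_le_sandwich)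
next
  assume le: "\<forall>z\<in>effects. norm (psqrt z * x * psqrt z) \<le> norm (psqrt z * y * psqrt z)"
  show "cstar_le x y"
  proof (rule cstar_le_epsilon)
    fix e :: real assume e: "e > 0"
    define w where "w = e *\<^sub>R 1 + y"
    have w: "pos_inv w" unfolding w_def using e y by (intro pos_inv_add_positive pos_inv_scaleR) auto
    \<comment> \<open>Large enough for the test element \<open>cinv (c *\<^sub>R w)\<close> to have
      norm at most 1 and thus be an effect; the added 1 makes \<open>c\<close> positive.\<close>
    define c where "c = norm (cinv w) + 1"
    have c: "c > 0" "norm (cinv w) \<le> c" by (simp_all add: c_def add_nonneg_pos)
    define s where "s = psqrt (cinv (c *\<^sub>R w))"
    have cw: "pos_inv (c *\<^sub>R w)" using w c by (simp add: pos_inv_scaleR)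
    have s: "pos_inv s" unfolding s_def by (intro pos_inv_psqrt pos_inv_cinv cw)
    have "c *\<^sub>R (s * w * s) = 1" using psqrt_cinv_sandwich[OF cw] by (simp add: s_def)
    then have sws: "s * w * s = (1 / c) *\<^sub>R 1"
      using c(1) by (metis divide_self_if less_irrefl mult.commute scaleR_one scaleR_scaleR times_divide_eq_left mult_1)
    have "cinv (c *\<^sub>R w) \<in> effects"
      using pos_inv_cinv[OF cw] w c by (auto simp: effects_iff cinv_scaleR divide_simps)
    with le have "norm (s * x * s) \<le> norm (s * y * s)" by (simp add: s_def)
    also have "norm (s * y * s) \<le> 1 / c"
    proof -
      have "cstar_le y w" using e by (auto simp: w_def cstar_le_def)
      then have "cstar_le (s * y * s) ((1 / c) *\<^sub>R 1)"
        using cstar_le_sandwich[of s y w] s by (auto simp: sws)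
      then show ?thesis using s y c by (subst (asm) cstar_le_scaleR_1_iff) (auto intro: positive_sandwich)
    qed
    finally have "cstar_le (s * x * s) ((1 / c) *\<^sub>R 1)"
      using s x c by (subst cstar_le_scaleR_1_iff) (auto intro: positive_sandwich)
    then show "cstar_le x (y + e *\<^sub>R 1)"
      unfolding sws[symmetric] cstar_le_sandwich_iff[OF s] by (simp add: w_def add.commute)
  qed
qed

lemma positive_eqI_norm_sandwich:
  assumes "positive x" "positive y"
    and "\<And>z. z \<in> effects \<Longrightarrow> norm (psqrt z * x * psqrt z) = norm (psqrt z * y * psqrt z)"
  shows "x = y"
  using assms by (intro cstar_le_antisym) (simp_all add: cstar_le_iff_norm_sandwich)

lemma one_effects [simp]: "1 \<in> effects"
  by (simp add: effects_iff)

lemma scaleR_effects: "x \<in> effects \<Longrightarrow> 0 \<le> c \<Longrightarrow> c \<le> 1 \<Longrightarrow> c *\<^sub>R x \<in> effects"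
  by (auto simp: effects_iff mult_le_one)

lemma normalize_effects: "positive x \<Longrightarrow> 0 < r \<Longrightarrow> norm x \<le> r \<Longrightarrow> (1 / r) *\<^sub>R x \<in> effects"
  by (auto simp: effects_iff)

lemma shift_pos_inv:
  assumes "self_adjoint h" "norm h < t"
  shows "pos_inv (h + t *\<^sub>R 1)"
proof (rule pos_invI)
  show "0 < t - norm h" using assms by simp
  have "cstar_le (- h) (norm (- h) *\<^sub>R 1)" using assms by (intro cstar_le_norm) auto
  then have "cstar_le (- h + (h + (t - norm h) *\<^sub>R 1)) (norm h *\<^sub>R 1 + (h + (t - norm h) *\<^sub>R 1))"
    unfolding cstar_le_add_right_iff by simp
  moreover have "norm h *\<^sub>R 1 + (h + (t - norm h) *\<^sub>R 1) = h + t *\<^sub>R 1" by (simp add: algebra_simps)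
  ultimately show "cstar_le ((t - norm h) *\<^sub>R 1) (h + t *\<^sub>R 1)" by simp
qed

section \<open>From the effects to the cone and to the self-adjoint part\<close>

locale sequential_norm_preserver =
  fixes T :: "'a::unital_cstar_algebra \<Rightarrow> 'b::unital_cstar_algebra"
  assumes image: "T ` effects = effects"
    and norm_eq: "\<And>x y. x \<in> effects \<Longrightarrow> y \<in> effects \<Longrightarrow>
      norm (psqrt (T x) * T y * psqrt (T x)) = norm (psqrt x * y * psqrt x)"
begin

lemma effects [simp]: "x \<in> effects \<Longrightarrow> T x \<in> effects"
  using image by blast

lemma positive [simp]: "x \<in> effects \<Longrightarrow> positive (T x)"
  using effects effects_iff by blast

text \<open>Surjectivity lets every test effect in the target be written as \<open>T z\<close>,
  where \<open>norm_eq\<close> translates both norms back to the source.\<close>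

lemma le_iff:
  assumes "x \<in> effects" "y \<in> effects"
  shows "cstar_le (T x) (T y) \<longleftrightarrow> cstar_le x y"
proof -
  have "cstar_le (T x) (T y) \<longleftrightarrow>
      (\<forall>z\<in>T ` effects. norm (psqrt z * T x * psqrt z) \<le> norm (psqrt z * T y * psqrt z))"
    using assms by (simp add: cstar_le_iff_norm_sandwich image)
  also have "\<dots> \<longleftrightarrow> cstar_le x y"
    using assms by (simp add: norm_eq cstar_le_iff_norm_sandwich effects_iff)
  finally show ?thesis .
qed

lemma inj: "inj_on T effects"
proof (rule inj_onI)
  fix x y assume "x \<in> effects" "y \<in> effects" "T x = T y"
  then show "x = y" using le_iff[of x y] le_iff[of y x] by (auto intro: cstar_le_antisym)
qed

lemma scaleR:
  assumes x: "x \<in> effects" and c: "0 \<le> c" "c \<le> 1"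
  shows "T (c *\<^sub>R x) = c *\<^sub>R T x"
proof (rule positive_eqI_norm_sandwich)
  note cx = scaleR_effects[OF x c]
  show "positive (T (c *\<^sub>R x))" "positive (c *\<^sub>R T x)" using cx x c by auto
  fix w :: 'b assume "w \<in> effects"
  then obtain z where z: "z \<in> effects" "w = T z" using image by blast
  then show "norm (psqrt w * T (c *\<^sub>R x) * psqrt w) = norm (psqrt w * (c *\<^sub>R T x) * psqrt w)"
    using cx x by (simp add: norm_eq)
qed

lemma one: "T 1 = 1"
proof (rule cstar_le_antisym)
  show "cstar_le (T 1) 1" using effects[OF one_effects] by (simp add: effects_def)
  obtain u where u: "u \<in> effects" "T u = 1" using image one_effects by (metis imageE)
  then have "cstar_le u 1" by (simp add: effects_def)
  then show "cstar_le 1 (T 1)" using le_iff[OF u(1) one_effects] u(2) by simp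
qed

text \<open>The divisor is never zero and puts a positive \<open>x\<close> among the effects; by
  homogeneity any other positive divisor of at least \<open>norm x\<close> gives the same value
  (\<open>ext_eq\<close>).\<close>

definition ext :: "'a \<Rightarrow> 'b" where
  "ext x = (norm x + 1) *\<^sub>R T ((1 / (norm x + 1)) *\<^sub>R x)"

lemma ext_eq:
  assumes x: "positive x" and r: "r > 0" "norm x \<le> r"
  shows "ext x = r *\<^sub>R T ((1 / r) *\<^sub>R x)"
proof -
  have *: "s *\<^sub>R T ((1 / s) *\<^sub>R x) = r *\<^sub>R T ((1 / r) *\<^sub>R x)" if "0 < r" "norm x \<le> r" "r \<le> s" for r s
  proof -
    have "T ((r / s) *\<^sub>R ((1 / r) *\<^sub>R x)) = (r / s) *\<^sub>R T ((1 / r) *\<^sub>R x)"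
      using that x by (intro scaleR normalize_effects) auto
    then show ?thesis using that by simp
  qed
  have "0 < norm x + 1" by (simp add: add_nonneg_pos)
  then show ?thesis
    unfolding ext_def using *[of r "norm x + 1"] *[of "norm x + 1" r] r by (cases "r \<le> norm x + 1") auto
qed

lemma ext_effects: "x \<in> effects \<Longrightarrow> ext x = T x"
  using ext_eq[of x 1] by (simp add: effects_iff)

lemma positive_ext [simp]:
  assumes "positive x" shows "positive (ext x)"
proof -
  have "0 < norm x + 1" by (simp add: add_nonneg_pos)
  then show ?thesis
    unfolding ext_def using assms by (intro positive_scaleR positive normalize_effects) auto
qed

lemma ext_le_iff:
  assumes x: "positive x" and y: "positive y"
  shows "cstar_le (ext x) (ext y) \<longleftrightarrow> cstar_le x y"
proof -
  define r where "r = norm x + norm y + 1"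
  have r: "r > 0" "norm x \<le> r" "norm y \<le> r" by (simp_all add: r_def add_nonneg_pos)
  have "cstar_le (ext x) (ext y) \<longleftrightarrow> cstar_le (T ((1 / r) *\<^sub>R x)) (T ((1 / r) *\<^sub>R y))"
    using r x y by (simp add: ext_eq[of _ r] cstar_le_scaleR_iff)
  also have "\<dots> \<longleftrightarrow> cstar_le x y"
    using r x y by (simp add: le_iff normalize_effects cstar_le_scaleR_iff)
  finally show ?thesis .
qed

lemma ext_scaleR:
  assumes x: "positive x" and c: "c > 0"
  shows "ext (c *\<^sub>R x) = c *\<^sub>R ext x"
proof -
  have r: "norm x + 1 > 0" by (simp add: add_nonneg_pos)
  have "ext (c *\<^sub>R x) = (c * (norm x + 1)) *\<^sub>R T ((1 / (c * (norm x + 1))) *\<^sub>R (c *\<^sub>R x))"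
    using x c r by (intro ext_eq mult_pos_pos) (auto simp: algebra_simps)
  then show ?thesis using c by (simp add: ext_def)
qed

lemma ext_one: "ext 1 = 1"
  by (simp add: ext_effects one)

lemma inverse: "sequential_norm_preserver (inv_into effects T)"
proof
  have b: "bij_betw T effects effects" using inj image by (simp add: bij_betw_def)
  show "inv_into effects T ` effects = effects"
    using bij_betw_inv_into[OF b] by (simp add: bij_betw_def)
  fix x y :: 'b assume xy: "x \<in> effects" "y \<in> effects"
  then have "inv_into effects T x \<in> effects" "inv_into effects T y \<in> effects"
    using bij_betw_inv_into[OF b] by (auto simp: bij_betw_def)
  from norm_eq[OF this] show "norm (psqrt (inv_into effects T x) * inv_into effects T y * psqrt (inv_into effects T x))
      = norm (psqrt x * y * psqrt x)"
    using bij_betw_inv_into_right[OF b] xy by simp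
qed

lemma ext_pos_inv:
  assumes x: "pos_inv x" shows "pos_inv (ext x)"
proof -
  obtain e where e: "e > 0" "cstar_le (e *\<^sub>R 1) x" using pos_inv_bounded_below[OF x] .
  have "cstar_le (ext (e *\<^sub>R 1)) (ext x)" using e x by (subst ext_le_iff) auto
  then show ?thesis using e(1) by (intro pos_invI[of e]) (simp_all add: ext_scaleR ext_one)
qed

lemma norm_ext_le: "positive x \<Longrightarrow> r > 0 \<Longrightarrow> norm x \<le> r \<Longrightarrow> norm (ext x) \<le> r"
  using effects[OF normalize_effects, of x r] by (simp add: ext_eq effects_iff)

lemma ext_inverse:
  assumes x: "positive x"
  shows "sequential_norm_preserver.ext (inv_into effects T) (ext x) = x"
proof -
  interpret S: sequential_norm_preserver "inv_into effects T" by (rule inverse)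
  define r where "r = norm x + 1"
  have r: "r > 0" "norm x \<le> r" by (simp_all add: r_def add_nonneg_pos)
  have "S.ext (ext x) = r *\<^sub>R inv_into effects T ((1 / r) *\<^sub>R ext x)"
    using r x by (intro S.ext_eq norm_ext_le) auto
  also have "(1 / r) *\<^sub>R ext x = T ((1 / r) *\<^sub>R x)" using r x by (simp add: ext_eq)
  also have "inv_into effects T (T ((1 / r) *\<^sub>R x)) = (1 / r) *\<^sub>R x"
    using r x by (intro inv_into_f_f inj normalize_effects)
  finally show ?thesis using r by simp
qed

lemma inverse_ext:
  assumes y: "positive y"
  shows "ext (sequential_norm_preserver.ext (inv_into effects T) y) = y"
proof -
  interpret S: sequential_norm_preserver "inv_into effects T" by (rule inverse)
  define r where "r = norm y + 1"
  have r: "r > 0" "norm y \<le> r" by (simp_all add: r_def add_nonneg_pos)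
  have "ext (S.ext y) = r *\<^sub>R T ((1 / r) *\<^sub>R S.ext y)"
    using r y by (intro ext_eq S.norm_ext_le) auto
  also have "(1 / r) *\<^sub>R S.ext y = inv_into effects T ((1 / r) *\<^sub>R y)" using r y by (simp add: S.ext_eq)
  also have "T (inv_into effects T ((1 / r) *\<^sub>R y)) = (1 / r) *\<^sub>R y"
    using r y image by (intro f_inv_into_f) (simp add: normalize_effects)
  finally show ?thesis using r by simp
qed

sublocale cone: unital_cone_iso ext
proof
  interpret S: sequential_norm_preserver "inv_into effects T" by (rule inverse)
  show "bij_betw ext (Collect pos_inv) (Collect pos_inv)"
    by (rule bij_betwI[where g = S.ext])
      (auto simp: ext_pos_inv S.ext_pos_inv ext_inverse inverse_ext)
qed (simp_all add: ext_le_iff ext_scaleR ext_one pos_invD)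

text \<open>For self-adjoint \<open>h\<close> the shift exceeds the norm, which makes the argument
  of \<open>ext\<close> positive and invertible; additivity of \<open>ext\<close> on such elements
  makes the value independent of the shift (\<open>lin_eq\<close>).\<close>

definition lin :: "'a \<Rightarrow> 'b" where
  "lin h = ext (h + (norm h + 1) *\<^sub>R 1) - (norm h + 1) *\<^sub>R 1"

lemma ext_shift:
  "pos_inv x \<Longrightarrow> t > 0 \<Longrightarrow> ext (x + t *\<^sub>R 1) = ext x + t *\<^sub>R 1"
  by (simp add: cone.add pos_inv_scaleR ext_scaleR ext_one)

lemma lin_eq:
  assumes h: "self_adjoint h" and t: "t > 0" "pos_inv (h + t *\<^sub>R 1)"
  shows "lin h = ext (h + t *\<^sub>R 1) - t *\<^sub>R 1"
proof -
  define s where "s = norm h + 1"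
  have s: "s > 0" "pos_inv (h + s *\<^sub>R 1)"
    using shift_pos_inv[OF h, of s] by (simp_all add: s_def add_nonneg_pos)
  have "ext (h + s *\<^sub>R 1) + t *\<^sub>R 1 = ext ((h + t *\<^sub>R 1) + s *\<^sub>R 1)"
    using ext_shift[OF s(2) t(1)] by (simp add: ac_simps)
  also have "\<dots> = ext (h + t *\<^sub>R 1) + s *\<^sub>R 1" by (rule ext_shift[OF t(2) s(1)])
  finally show ?thesis unfolding lin_def s_def[symmetric] by (simp add: algebra_simps)
qed

lemma lin_pos_inv: "pos_inv x \<Longrightarrow> lin x = ext x"
  using lin_eq[of x 1] ext_shift[of x 1] pos_inv_add_positive[of x 1] by auto

lemma self_adjoint_lin:
  assumes "self_adjoint h" shows "self_adjoint (lin h)"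
proof -
  have "pos_inv (ext (h + (norm h + 1) *\<^sub>R 1))" using shift_pos_inv[OF assms] by (intro ext_pos_inv) simp
  then show ?thesis unfolding lin_def by (intro self_adjoint_diff self_adjoint_scaleR self_adjoint_1) auto
qed

lemma lin_add:
  assumes h: "self_adjoint h" and k: "self_adjoint k"
  shows "lin (h + k) = lin h + lin k"
proof -
  define t where "t = norm h + norm k + 1"
  have t: "t > 0" "pos_inv (h + t *\<^sub>R 1)" "pos_inv (k + t *\<^sub>R 1)"
    using shift_pos_inv[OF h, of t] shift_pos_inv[OF k, of t] by (simp_all add: t_def add_nonneg_pos)
  have e: "h + k + (t + t) *\<^sub>R 1 = (h + t *\<^sub>R 1) + (k + t *\<^sub>R 1)" by (simp only: scaleR_add_left ac_simps)
  have p: "pos_inv (h + k + (t + t) *\<^sub>R 1)" unfolding e by (rule pos_inv_add_positive[OF t(2) pos_invD(1)[OF t(3)]])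
  have "lin (h + k) = ext (h + k + (t + t) *\<^sub>R 1) - (t + t) *\<^sub>R 1"
    using h k t(1) p by (intro lin_eq) auto
  also have "\<dots> = (ext (h + t *\<^sub>R 1) + ext (k + t *\<^sub>R 1)) - (t + t) *\<^sub>R 1"
    unfolding e by (simp only: cone.add t)
  also have "\<dots> = lin h + lin k"
    unfolding scaleR_add_left using h k t by (simp add: lin_eq[of _ t])
  finally show ?thesis .
qed

lemma lin_scaleR:
  assumes h: "self_adjoint h"
  shows "lin (r *\<^sub>R h) = r *\<^sub>R lin h"
proof -
  have pos: "lin (r *\<^sub>R h) = r *\<^sub>R lin h" if "r > 0" for r
  proof -
    define t where "t = norm h + 1"
    have t: "t > 0" "pos_inv (h + t *\<^sub>R 1)"
      using shift_pos_inv[OF h, of t] by (simp_all add: t_def add_nonneg_pos)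
    have e: "r *\<^sub>R h + (r * t) *\<^sub>R 1 = r *\<^sub>R (h + t *\<^sub>R 1)" by (simp add: scaleR_add_right)
    have "lin (r *\<^sub>R h) = ext (r *\<^sub>R h + (r * t) *\<^sub>R 1) - (r * t) *\<^sub>R 1"
      using h t that by (intro lin_eq) (auto simp: e pos_inv_scaleR)
    also have "\<dots> = r *\<^sub>R lin h"
      unfolding e using h t that by (simp add: ext_scaleR lin_eq[of _ t] pos_invD scaleR_diff_right)
    finally show ?thesis .
  qed
  have zero: "lin 0 = 0" using lin_add[of 0 0] by simp
  have "lin ((-r) *\<^sub>R h) + lin (r *\<^sub>R h) = 0"
    using lin_add[of "(-r) *\<^sub>R h" "r *\<^sub>R h"] h zero by (simp add: self_adjoint_scaleR self_adjoint_minus)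
  then show ?thesis using pos[of r] pos[of "-r"] zero
    by (cases r "0 :: real" rule: linorder_cases) (simp_all add: add_eq_0_iff)
qed

lemma lin_one: "lin 1 = 1"
  by (simp add: lin_pos_inv ext_one)

text \<open>The square law is available for the invertible positive element
  \<open>q = h + t\<close>; expanding both squares, the linear and constant terms cancel.\<close>

lemma lin_square:
  assumes h: "self_adjoint h"
  shows "lin (h * h) = lin h * lin h"
proof -
  define t where "t = norm h + 1"
  define q where "q = h + t *\<^sub>R 1"
  have q: "pos_inv q" unfolding q_def t_def by (rule shift_pos_inv[OF h]) simp
  have hh: "self_adjoint (h * h)" using h by (simp add: self_adjoint_def adj_mult)
  have "pos_inv (q * q)" using pos_inv_power[OF q, of 2] by (simp add: power2_eq_square)
  then have "lin (q * q) = lin q * lin q" using q by (simp add: lin_pos_inv cone.square)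
  moreover have "q * q = h * h + ((2 * t) *\<^sub>R h + (t * t) *\<^sub>R 1)"
    by (simp add: q_def algebra_simps scaleR_add_left flip: scaleR_2)
  moreover have "lin q = lin h + t *\<^sub>R 1"
    using h by (simp add: q_def lin_add lin_scaleR lin_one self_adjoint_scaleR)
  ultimately have "lin (h * h) + ((2 * t) *\<^sub>R lin h + (t * t) *\<^sub>R 1) = (lin h + t *\<^sub>R 1) * (lin h + t *\<^sub>R 1)"
    using h hh by (simp add: lin_add lin_scaleR lin_one self_adjoint_scaleR self_adjoint_add)
  also have "\<dots> = lin h * lin h + ((2 * t) *\<^sub>R lin h + (t * t) *\<^sub>R 1)"
    by (simp add: algebra_simps flip: scaleR_2)
  finally show ?thesis by simp
qed

lemma lin_le_iff:
  assumes h: "self_adjoint h" and k: "self_adjoint k"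
  shows "cstar_le (lin h) (lin k) \<longleftrightarrow> cstar_le h k"
proof -
  define t where "t = norm h + norm k + 1"
  have t: "t > 0" "pos_inv (h + t *\<^sub>R 1)" "pos_inv (k + t *\<^sub>R 1)"
    using shift_pos_inv[OF h, of t] shift_pos_inv[OF k, of t] by (simp_all add: t_def add_nonneg_pos)
  have "cstar_le (lin h) (lin k) \<longleftrightarrow> cstar_le (lin h + t *\<^sub>R 1) (lin k + t *\<^sub>R 1)" by simp
  also have "\<dots> \<longleftrightarrow> cstar_le (ext (h + t *\<^sub>R 1)) (ext (k + t *\<^sub>R 1))"
    using h k t by (simp add: lin_eq[of _ t])
  also have "\<dots> \<longleftrightarrow> cstar_le h k" using t by (simp add: ext_le_iff pos_invD)
  finally show ?thesis .
qed

lemma lin_bij: "bij_betw lin (Collect self_adjoint) (Collect self_adjoint)"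
  unfolding bij_betw_def
proof (intro conjI equalityI subsetI inj_onI)
  fix h k assume "h \<in> Collect self_adjoint" "k \<in> Collect self_adjoint" "lin h = lin k"
  then show "h = k" using lin_le_iff[of h k] lin_le_iff[of k h] cstar_le_antisym[of h k] by simp
next
  fix k assume "k \<in> lin ` Collect self_adjoint"
  then show "k \<in> Collect self_adjoint" using self_adjoint_lin by auto
next
  fix k :: 'b assume "k \<in> Collect self_adjoint"
  then have k: "self_adjoint k" by simp
  define t where "t = norm k + 1"
  have t: "t > 0" "pos_inv (k + t *\<^sub>R 1)"
    using shift_pos_inv[OF k, of t] by (simp_all add: t_def add_nonneg_pos)
  then have "k + t *\<^sub>R 1 \<in> ext ` Collect pos_inv" using cone.bij by (simp add: bij_betw_def)
  then obtain q where q: "pos_inv q" "ext q = k + t *\<^sub>R 1" by auto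
  have qt: "self_adjoint (q - t *\<^sub>R 1)"
    using q(1) by (intro self_adjoint_diff self_adjoint_scaleR self_adjoint_1) auto
  have "lin (q - t *\<^sub>R 1) = k" using lin_eq[OF qt t(1)] q by simp
  then show "k \<in> lin ` Collect self_adjoint" using qt by auto
qed

text \<open>Additivity of \<open>ext\<close> is known on invertible elements, so at a general effect
  the two maps are compared up to \<open>e\<close>: once through \<open>e + x\<close> in the source,
  once through the preimage \<open>q\<close> of \<open>e + ext x\<close>, which is invertible in the
  target.\<close>

lemma lin_effects:
  assumes x: "x \<in> effects"
  shows "lin x = T x"
proof -
  have px: "positive x" and sx: "self_adjoint x" using x by (auto simp: effects_iff)
  have "lin x = ext x"
  proof (rule cstar_le_antisym; rule cstar_le_epsilon)
    fix e :: real assume e: "e > 0"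
    have p: "pos_inv (e *\<^sub>R 1 + x)" "pos_inv (e *\<^sub>R 1 + ext x)"
      using e px by (auto intro!: pos_inv_add_positive pos_inv_scaleR)
    have "cstar_le (ext x) (ext (e *\<^sub>R 1 + x))"
      using px p(1) e by (subst ext_le_iff) (auto simp: cstar_le_def)
    moreover have "ext (e *\<^sub>R 1 + x) = lin x + e *\<^sub>R 1"
      using lin_eq[OF sx e] p(1) by (simp add: add.commute)
    ultimately show "cstar_le (ext x) (lin x + e *\<^sub>R 1)" by simp
    have "e *\<^sub>R 1 + ext x \<in> ext ` Collect pos_inv" using p(2) cone.bij by (simp add: bij_betw_def)
    then obtain q where q: "pos_inv q" "ext q = e *\<^sub>R 1 + ext x" by auto
    have "cstar_le (ext x) (ext q)" using e by (auto simp: q cstar_le_def)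
    then have "cstar_le x q" using px q(1) by (simp add: ext_le_iff pos_invD)
    then have "cstar_le (lin x) (lin q)" using sx q(1) by (subst lin_le_iff) auto
    then show "cstar_le (lin x) (ext x + e *\<^sub>R 1)" using q by (simp add: lin_pos_inv add.commute)
  qed
  then show ?thesis using x by (simp add: ext_effects)
qed

lemma jordan_star_isomorphism_exists:
  obtains J where "jordan_star_isomorphism J" "\<forall>x\<in>effects. T x = J x"
proof -
  obtain J where J: "jordan_star_isomorphism J" "\<And>h. self_adjoint h \<Longrightarrow> J h = lin h"
  proof (rule jordan_extension[of lin])
    show "bij_betw lin (Collect self_adjoint) (Collect self_adjoint)" by (rule lin_bij)
  qed (simp_all add: lin_add lin_scaleR lin_square)
  show ?thesis
  proof (rule that[OF J(1)], rule ballI)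
    fix x :: 'a assume x: "x \<in> effects"
    then have "self_adjoint x" by (auto simp: effects_iff)
    then show "T x = J x" using J(2) lin_effects[OF x] by simp
  qed
qed

end


section \<open>The general exponent\<close>

theorem corollary5p6:
  fixes \<phi> :: "'a::unital_cstar_algebra \<Rightarrow> 'b::unital_cstar_algebra"
    and p :: real
  assumes "\<phi> ` effects = effects"
    and "p > 0"
  shows "(\<forall>x\<in>effects. \<forall>y\<in>effects. norm (diamond p (\<phi> x) (\<phi> y)) = norm (diamond p x y)) \<longleftrightarrow>
    (\<exists>J :: 'a \<Rightarrow> 'b. jordan_star_isomorphism J \<and> (\<forall>x\<in>effects. \<phi> x = J x))"
proof
  assume "\<exists>J :: 'a \<Rightarrow> 'b. jordan_star_isomorphism J \<and> (\<forall>x\<in>effects. \<phi> x = J x)"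
  then obtain J where J: "jordan_iso J" "\<And>x. x \<in> effects \<Longrightarrow> \<phi> x = J x"
    using jordan_iso.intro by blast
  then show "\<forall>x\<in>effects. \<forall>y\<in>effects. norm (diamond p (\<phi> x) (\<phi> y)) = norm (diamond p x y)"
    using \<open>p > 0\<close> by (simp add: jordan_iso.norm_diamond_eq effects_iff)
next
  assume eq: "\<forall>x\<in>effects. \<forall>y\<in>effects. norm (diamond p (\<phi> x) (\<phi> y)) = norm (diamond p x y)"
  have \<phi>: "\<phi> x \<in> effects" if "x \<in> effects" for x using assms(1) that by blast
  have pos: "positive x" if "x \<in> effects" for x :: "'c::unital_cstar_algebra"
    using that by (simp add: effects_iff)
  have sandwich: "norm (cpow x (p / 2) * cpow y p * cpow x (p / 2)) = norm (diamond p x y) powr p"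
    if "x \<in> effects" "y \<in> effects" for x y :: "'c::unital_cstar_algebra"
    using that \<open>p > 0\<close> by (simp add: norm_diamond pos powr_powr)
  \<comment> \<open>Makes \<open>psqrt (T x)\<close> the power \<open>p / 2\<close> of \<phi> at
    \<open>cpow x (1 / p)\<close>, so that the hypothesis on \<open>diamond p\<close> becomes the
    condition \<open>norm_eq\<close>.\<close>
  define T where "T = (\<lambda>x. cpow (\<phi> (cpow x (1 / p))) p)"
  have root: "cpow x (1 / p) \<in> effects" if "x \<in> effects" for x :: "'c::unital_cstar_algebra"
    using that \<open>p > 0\<close> by (simp add: cpow_effects)
  interpret T: sequential_norm_preserver T
  proof
    show "T ` effects = effects"
    proof (intro equalityI subsetI)
      fix y assume "y \<in> T ` effects"
      then show "y \<in> effects" using \<open>p > 0\<close> by (auto simp: T_def intro!: cpow_effects \<phi> root)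
    next
      fix y :: 'b assume y: "y \<in> effects"
      then obtain u where u: "u \<in> effects" "\<phi> u = cpow y (1 / p)"
        using assms(1) root[of y] by (metis imageE)
      have "T (cpow u p) = y"
        using u y \<open>p > 0\<close> by (simp add: T_def cpow_cpow pos)
      then show "y \<in> T ` effects" using u \<open>p > 0\<close> by (auto intro: cpow_effects)
    qed
  next
    fix x y :: 'a assume xy: "x \<in> effects" "y \<in> effects"
    let ?x = "cpow x (1 / p)" and ?y = "cpow y (1 / p)"
    have "norm (psqrt (T x) * T y * psqrt (T x)) = norm (diamond p (\<phi> ?x) (\<phi> ?y)) powr p"
      using xy \<open>p > 0\<close> by (simp add: T_def cpow_cpow pos \<phi> root flip: sandwich)
    also have "\<dots> = norm (diamond p ?x ?y) powr p" using xy eq by (simp add: root)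
    also have "\<dots> = norm (psqrt x * y * psqrt x)"
      using xy \<open>p > 0\<close> by (simp add: cpow_cpow pos root flip: sandwich)
    finally show "norm (psqrt (T x) * T y * psqrt (T x)) = norm (psqrt x * y * psqrt x)" .
  qed
  obtain J where J: "jordan_star_isomorphism J" "\<forall>x\<in>effects. T x = J x"
    by (rule T.jordan_star_isomorphism_exists)
  interpret J: jordan_iso J by unfold_locales (rule J)
  have "\<phi> x = J x" if x: "x \<in> effects" for x
  proof -
    have "cpow (\<phi> x) p = T (cpow x p)" using x \<open>p > 0\<close> by (simp add: T_def cpow_cpow pos)
    also have "\<dots> = cpow (J x) p" using x \<open>p > 0\<close> by (simp add: J cpow_effects J.map_cpow pos)
    finally have "cpow (cpow (\<phi> x) p) (1 / p) = cpow (cpow (J x) p) (1 / p)" by simp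
    then show ?thesis using x \<open>p > 0\<close> by (simp add: cpow_cpow pos \<phi> J.positive)
  qed
  then show "\<exists>J :: 'a \<Rightarrow> 'b. jordan_star_isomorphism J \<and> (\<forall>x\<in>effects. \<phi> x = J x)"
    using J(1) by blast
qed

end
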